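(* Let $N\ge 2$, $v\in\mathbb{R}^N$ with $|v|<1$, and $2<p<2+\frac{2}{N}$. Then, for any $a>0$ and any $m>m_p^*(a)$, the minimization problem $d_p(a)=\inf_{\varphi\in\mathcal{S}_a}E_p(\varphi)$ has at least one minimizer, i.e. there exists $\varphi\in\mathcal{S}_a$ with $E_p(\varphi)=d_p(a)$.
   Context: Functions are complex-valued on $\mathbb{R}^N$ unless stated otherwise; $\|\cdot\|_q$ is the $L^q(\mathbb{R}^N)$ norm; $\hat u$ is the (unitary) Fourier transform. $H^{1/2}(\mathbb{R}^N)$ is the usual fractional Sobolev space and $W^{1/2}(\mathbb{R}^N):=\{\varphi\in H^{1/2}(\mathbb{R}^N): |\varphi|^2\log|\varphi|^2\in L^1(\mathbb{R}^N)\}$ (with $0\log 0=0$). For $m>0$ the operator $\sqrt{-\Delta+m^2}-m$ is the Fourier multiplier with symbol $\sqrt{|k|^2+m^2}-m$, and $\int\bar\varphi(\sqrt{-\Delta+m^2}-m+iv\cdot\nabla)\varphi\,dx$ is understood as the quadratic form $\int_{\mathbb{R}^N}(\sqrt{|k|^2+m^2}-m-v\cdot k)|\hat\varphi(k)|^2\,dk$ on $H^{1/2}(\mathbb{R}^N)$. For $a>0$: $\mathcal{S}_a:=\{\varphi\in W^{1/2}(\mathbb{R}^N):\|\varphi\|_2^2=a\}$, and $$E_p(\varphi):=\frac12\int_{\mathbb{R}^N}\bar\varphi(\sqrt{-\Delta+m^2}-m+iv\cdot\nabla)\varphi\,dx-\frac1p\|\varphi\|_p^p-\frac12\int_{\mathbb{R}^N}|\varphi|^2(\log|\varphi|^2-1)\,dx,\qquad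 d_p(a):=\inf_{\varphi\in\mathcal{S}_a}E_p(\varphi).$$ Let $\mathcal{X}_a:=\{u\in\mathcal{S}_a\cap C_c^\infty(\mathbb{R}^N,\mathbb{R}):\int_{\mathbb{R}^N}|u|^2(\log|u|^2-1)\,dx\ge0\}$ (a non-empty set), and for $2<p\le 2+\frac2N$ let $$m_p^*(a):=\frac{p\sqrt{1-|v|^2}}{4}\inf_{u\in\mathcal{X}_a}\frac{\|\nabla u\|_2^2}{\|u\|_p^p}.$$ *)

theory Defs
  imports "HOL-Analysis.Analysis"
begin

text \<open>
  Functions on a Euclidean space are represented by Borel functions, integrated against
  \<^term>\<open>lborel\<close>; every class in a space \<open>L\<^sup>q\<close> has such a representative, and none of the
  quantities below depends on its choice.
\<close>

definition Lq_norm :: "real \<Rightarrow> ('a::euclidean_space \<Rightarrow> 'b::real_normed_vector) \<Rightarrow> real" where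
  "Lq_norm q u = (LINT x|lborel. norm (u x) powr q) powr (1 / q)"

definition L2 :: "('a::euclidean_space \<Rightarrow> complex) set" where
  "L2 = {u. u \<in> borel_measurable lborel \<and> integrable lborel (\<lambda>x. (cmod (u x))\<^sup>2)}"

definition truncated_fourier :: "('a::euclidean_space \<Rightarrow> complex) \<Rightarrow> real \<Rightarrow> 'a \<Rightarrow> complex" where
  "truncated_fourier u R k =
     of_real ((2 * pi) powr (- real DIM('a) / 2)) *
     set_lebesgue_integral lborel (cball 0 R) (\<lambda>x. cis (- (k \<bullet> x)) * u x)"

text \<open>
  The unitary Fourier transform of \<open>u \<in> L\<^sup>2\<close> is the limit in \<open>L\<^sup>2\<close> of the Fourier integrals
  over balls. Plancherel's theorem gives its existence and its uniqueness almost everywhere;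
  \<open>fourier\<close> picks a representative.
\<close>

definition is_fourier :: "('a::euclidean_space \<Rightarrow> complex) \<Rightarrow> ('a \<Rightarrow> complex) \<Rightarrow> bool" where
  "is_fourier u g \<longleftrightarrow> g \<in> L2 \<and>
     ((\<lambda>R. \<integral>\<^sup>+ k. ennreal ((cmod (truncated_fourier u R k - g k))\<^sup>2) \<partial>lborel) \<longlongrightarrow> 0) at_top"

definition fourier :: "('a::euclidean_space \<Rightarrow> complex) \<Rightarrow> 'a \<Rightarrow> complex" where
  "fourier u = (SOME g. is_fourier u g)"

definition H_half :: "('a::euclidean_space \<Rightarrow> complex) set" where
  "H_half = {u \<in> L2. integrable lborel (\<lambda>k. sqrt (1 + (norm k)\<^sup>2) * (cmod (fourier u k))\<^sup>2)}"

text \<open>Here and below, \<open>0 log 0 = 0\<close> holds because of the factor in front of \<^const>\<open>ln\<close>.\<close>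

definition W_half :: "('a::euclidean_space \<Rightarrow> complex) set" where
  "W_half = {u \<in> H_half. integrable lborel (\<lambda>x. (cmod (u x))\<^sup>2 * ln ((cmod (u x))\<^sup>2))}"

definition S_mass :: "real \<Rightarrow> ('a::euclidean_space \<Rightarrow> complex) set" where
  "S_mass a = {u \<in> W_half. (Lq_norm 2 u)\<^sup>2 = a}"

text \<open>The form of \<open>sqrt(-\<Delta> + m\<^sup>2) - m + iv\<cdot>\<nabla>\<close>; since \<open>\<nabla>\<close> has symbol \<open>ik\<close>, the
  drift \<open>iv\<cdot>\<nabla>\<close> has symbol \<open>-v\<cdot>k\<close>.\<close>

definition kinetic_form :: "real \<Rightarrow> 'a::euclidean_space \<Rightarrow> ('a \<Rightarrow> complex) \<Rightarrow> real" where
  "kinetic_form m v u =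
     (LINT k|lborel. (sqrt ((norm k)\<^sup>2 + m\<^sup>2) - m - v \<bullet> k) * (cmod (fourier u k))\<^sup>2)"

definition log_term :: "('a::euclidean_space \<Rightarrow> complex) \<Rightarrow> real" where
  "log_term u = (LINT x|lborel. (cmod (u x))\<^sup>2 * (ln ((cmod (u x))\<^sup>2) - 1))"

definition E_energy :: "real \<Rightarrow> 'a::euclidean_space \<Rightarrow> real \<Rightarrow> ('a \<Rightarrow> complex) \<Rightarrow> real" where
  "E_energy m v p u =
     kinetic_form m v u / 2 - (Lq_norm p u) powr p / p - log_term u / 2"

text \<open>The infimum is taken in the extended reals, so that attaining it includes its finiteness.\<close>

definition d_inf :: "real \<Rightarrow> 'a::euclidean_space \<Rightarrow> real \<Rightarrow> real \<Rightarrow> ereal" where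
  "d_inf m v p a = (INF u\<in>S_mass a. ereal (E_energy m v p u))"

primrec C_k :: "nat \<Rightarrow> ('a::euclidean_space \<Rightarrow> real) \<Rightarrow> bool" where
  "C_k 0 f \<longleftrightarrow> continuous_on UNIV f"
| "C_k (Suc n) f \<longleftrightarrow> f differentiable_on UNIV \<and>
     (\<forall>h. C_k n (\<lambda>x. frechet_derivative f (at x) h))"

definition Cc_infinity :: "('a::euclidean_space \<Rightarrow> real) set" where
  "Cc_infinity = {u. (\<forall>n. C_k n u) \<and> compact (closure {x. u x \<noteq> 0})}"

definition grad :: "('a::euclidean_space \<Rightarrow> real) \<Rightarrow> 'a \<Rightarrow> 'a" where
  "grad u x = (THE D. GDERIV u x :> D)"

definition X_set :: "real \<Rightarrow> ('a::euclidean_space \<Rightarrow> real) set" where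
  "X_set a = {u \<in> Cc_infinity. (\<lambda>x. complex_of_real (u x)) \<in> S_mass a \<and>
     log_term (\<lambda>x. complex_of_real (u x)) \<ge> 0}"

text \<open>For \<open>a > 0\<close> the set of quotients is nonempty and bounded below by \<open>0\<close>.\<close>

definition m_star :: "'a::euclidean_space \<Rightarrow> real \<Rightarrow> real \<Rightarrow> real" where
  "m_star v p a = p * sqrt (1 - (norm v)\<^sup>2) / 4 *
     (INF u\<in>(X_set a :: ('a \<Rightarrow> real) set). (Lq_norm 2 (grad u))\<^sup>2 / (Lq_norm p u) powr p)"

end

theory Submission
  imports Defs "HOL-Probability.Characteristic_Functions" "HOL-Complex_Analysis.Great_Picard"
begin

text \<open>
  The proof is the direct method, and the logarithm supplies the compactness. Let \<open>d\<close> be the infimum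
  and write \<open>A\<close> for the energy \<open>\<integral> |k| |u\<^sup>^(k)|\<^sup>2 dk\<close>.

  \<^item> \<^bold>\<open>Coercivity.\<close> Splitting frequencies at a radius \<open>R\<close> shows that the part of \<open>u\<close> where
    \<open>|u| > t\<close> has mass at most a multiple of \<open>A / t\<^bsup>2/N\<^esup>\<close> (lemma \<open>large_values_mass\<close>). Summing over
    dyadic \<open>t\<close> bounds the integral of \<open>|u|\<^sup>p\<close> over \<open>|u| > T\<close> by a multiple of \<open>T\<^bsup>p-2-2/N\<^esup> A\<close>, with
    a negative exponent since \<open>p < 2 + 2/N\<close>. The same power dominates \<open>|u|\<^sup>2 log |u|\<^sup>2\<close> from above,
    while the quadratic form is at least \<open>(1 - |v|) A\<close> up to a multiple of the mass. Hence \<open>A\<close>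
    is bounded along a minimizing sequence.

  \<^item> \<^bold>\<open>Strict subadditivity.\<close> If \<open>w\<close> has mass \<open>b \<le> a\<close>, scaling it up to mass \<open>a\<close> gives
    \<open>E(w) \<ge> (b/a) d + (b/2) log (a/b)\<close>; the last term comes from the logarithm.

  \<^item> \<^bold>\<open>Concentration.\<close> Cut \<open>u\<close> by all translates \<open>\<eta>(\<cdot> - y)\<close> of a cutoff and integrate the energy of
    the pieces over \<open>y\<close>. On the Fourier side this convolves \<open>|u\<^sup>^|\<^sup>2\<close> with \<open>|\<eta>\<^sup>^|\<^sup>2\<close>, so the quadratic
    form changes by no more than the first moment of \<open>|\<eta>\<^sup>^|\<^sup>2\<close>; the changes in the other
    terms are controlled by integrals of \<open>\<eta>\<close> alone. For a long plateau all these errors are small relative to the mass of the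
    cutoff. If no piece held almost all of the mass, the term \<open>(b/2) log (a/b)\<close> would push the
    average above the energy of \<open>u\<close>. So minimizing sequences are tight up to translations, which rules
    out vanishing and splitting at once.

  \<^item> \<^bold>\<open>Compactness and limit.\<close> A tight sequence with bounded \<open>A\<close> is precompact in \<open>L\<^sup>2\<close>
    (lemma \<open>tight_sequence_precompact\<close>). Fatou's lemma, applied to the quadratic form and to the
    potential plus a compensating term, shows that the energy is lower semicontinuous, so the limit is
    a minimizer.

  Everything rests on Plancherel's theorem, which is derived from the transform of the Gaussian.
\<close>


section \<open>Square-integrable functions\<close>

definition L2norm :: "('a::euclidean_space \<Rightarrow> complex) \<Rightarrow> real" where
  "L2norm f = sqrt (LINT x|lborel. (cmod (f x))\<^sup>2)"

lemma L2_measurable: "f \<in> L2 \<Longrightarrow> f \<in> borel_measurable borel"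
  by (simp add: L2_def)

lemma L2_integrable: "f \<in> L2 \<Longrightarrow> integrable lborel (\<lambda>x. (cmod (f x))\<^sup>2)"
  by (simp add: L2_def)

lemma L2norm_nonneg [simp]: "0 \<le> L2norm f"
  by (simp add: L2norm_def)

lemma L2norm_square: "(L2norm f)\<^sup>2 = (LINT x|lborel. (cmod (f x))\<^sup>2)"
  by (simp add: L2norm_def)

lemma nn_integral_L2:
  "f \<in> L2 \<Longrightarrow> (\<integral>\<^sup>+x. ennreal ((cmod (f x))\<^sup>2) \<partial>lborel) = ennreal ((L2norm f)\<^sup>2)"
  by (simp add: L2norm_square L2_def nn_integral_eq_integral)

lemma L2_I:
  assumes "f \<in> borel_measurable borel" "(\<integral>\<^sup>+x. ennreal ((cmod (f x))\<^sup>2) \<partial>lborel) \<le> ennreal B"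
  shows "f \<in> L2"
proof -
  have "(\<integral>\<^sup>+x. ennreal ((cmod (f x))\<^sup>2) \<partial>lborel) < \<infinity>"
    using assms(2) le_less_trans ennreal_less_top by fastforce
  then show ?thesis using assms(1) unfolding L2_def
    by (auto intro!: integrableI_nonneg)
qed

lemma L2norm_le_I:
  assumes "f \<in> borel_measurable borel" "(\<integral>\<^sup>+x. ennreal ((cmod (f x))\<^sup>2) \<partial>lborel) \<le> ennreal (B\<^sup>2)" "0 \<le> B"
  shows "L2norm f \<le> B"
proof -
  have "f \<in> L2" using L2_I assms by blast
  then have "(L2norm f)\<^sup>2 \<le> B\<^sup>2" using nn_integral_L2[of f] assms(2) by simp
  then show ?thesis using assms(3) power2_le_imp_le by blast
qed

lemma L2_bounded:
  assumes "f \<in> L2" "g \<in> borel_measurable borel" "AE x in lborel. cmod (g x) \<le> C * cmod (f x)"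
  shows "g \<in> L2" "0 \<le> C \<Longrightarrow> L2norm g \<le> C * L2norm f"
proof -
  have le: "AE x in lborel. (cmod (g x))\<^sup>2 \<le> C\<^sup>2 * (cmod (f x))\<^sup>2"
    using assms(3)
  proof eventually_elim
    case (elim x)
    then have "(cmod (g x))\<^sup>2 \<le> (C * cmod (f x))\<^sup>2" by (intro power_mono) auto
    then show ?case by (simp add: power_mult_distrib)
  qed
  note [measurable] = assms(2) L2_measurable[OF assms(1)]
  have int: "integrable lborel (\<lambda>x. C\<^sup>2 * (cmod (f x))\<^sup>2)" using L2_integrable[OF assms(1)] by simp
  have "integrable lborel (\<lambda>x. (cmod (g x))\<^sup>2)"
    by (rule Bochner_Integration.integrable_bound[OF int]) (use le in auto)
  then show g: "g \<in> L2" using assms(2) by (simp add: L2_def)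
  assume "0 \<le> C"
  have "(L2norm g)\<^sup>2 \<le> C\<^sup>2 * (L2norm f)\<^sup>2"
    unfolding L2norm_square integral_mult_right_zero[symmetric]
    by (rule integral_mono_AE) (use le int L2_integrable[OF g] in auto)
  then have "(L2norm g)\<^sup>2 \<le> (C * L2norm f)\<^sup>2" by (simp add: power_mult_distrib)
  then show "L2norm g \<le> C * L2norm f"
    by (rule power2_le_imp_le) (use \<open>0 \<le> C\<close> in auto)
qed

lemma L2_cong_AE:
  assumes "f \<in> L2" "g \<in> borel_measurable borel" "AE x in lborel. g x = f x"
  shows "g \<in> L2" "L2norm g = L2norm f"
proof -
  show "g \<in> L2" by (rule L2_bounded(1)[OF assms(1,2), of 1]) (use assms(3) in auto)
  note [measurable] = assms(2) L2_measurable[OF assms(1)]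
  show "L2norm g = L2norm f" unfolding L2norm_def
    by (intro arg_cong[of _ _ sqrt] integral_cong_AE) (use assms(3) in auto)
qed

lemma L2_mult:
  assumes "f \<in> L2" "g \<in> borel_measurable borel" "\<And>x. cmod (g x) \<le> C"
  shows "(\<lambda>x. g x * f x) \<in> L2" "L2norm (\<lambda>x. g x * f x) \<le> C * L2norm f"
proof -
  note [measurable] = assms(2) L2_measurable[OF assms(1)]
  have le: "AE x in lborel. cmod (g x * f x) \<le> C * cmod (f x)"
    using assms(3) by (auto simp: norm_mult intro!: mult_right_mono)
  have "0 \<le> C" using assms(3)[of undefined] norm_ge_zero order_trans by blast
  then show "(\<lambda>x. g x * f x) \<in> L2" "L2norm (\<lambda>x. g x * f x) \<le> C * L2norm f"
    using L2_bounded[OF assms(1) _ le] by auto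
qed

lemma L2_cmult: "f \<in> L2 \<Longrightarrow> (\<lambda>x. c * f x) \<in> L2"
  by (rule L2_mult(1)[where g="\<lambda>_. c" and C="cmod c"]) auto

lemma L2norm_cmult: "L2norm (\<lambda>x. c * f x) = cmod c * L2norm f"
  by (simp add: L2norm_def norm_mult power_mult_distrib real_sqrt_mult)

lemma L2norm_unimodular:
  assumes "\<And>x. cmod (g x) = 1" shows "L2norm (\<lambda>x. g x * f x) = L2norm f"
  by (simp add: L2norm_def norm_mult assms)

lemma L2_indicator:
  assumes "f \<in> L2" "A \<in> sets borel"
  shows "(\<lambda>x. indicator A x * f x) \<in> L2" "L2norm (\<lambda>x. indicator A x * f x) \<le> L2norm f"
  using L2_mult[OF assms(1), of "indicator A" 1] assms(2) by (auto simp: indicator_def)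

lemma L2norm_commute: "L2norm (\<lambda>x. f x - g x) = L2norm (\<lambda>x. g x - f x)"
  by (simp add: L2norm_def norm_minus_commute)

lemma Cauchy_Schwarz_L2:
  assumes "f \<in> L2" "g \<in> L2"
  shows "integrable lborel (\<lambda>x. cmod (f x) * cmod (g x))"
    "(LINT x|lborel. cmod (f x) * cmod (g x)) \<le> L2norm f * L2norm g"
proof -
  note [measurable] = L2_measurable[OF assms(1)] L2_measurable[OF assms(2)]
  have "(\<integral>\<^sup>+x. ennreal (cmod (f x)) * ennreal (cmod (g x)) \<partial>lborel)\<^sup>2 \<le>
      (\<integral>\<^sup>+x. (ennreal (cmod (f x)))\<^sup>2 \<partial>lborel) * (\<integral>\<^sup>+x. (ennreal (cmod (g x)))\<^sup>2 \<partial>lborel)"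
    by (rule Cauchy_Schwarz_nn_integral) auto
  also have "\<dots> = ennreal ((L2norm f * L2norm g)\<^sup>2)"
    using nn_integral_L2[OF assms(1)] nn_integral_L2[OF assms(2)]
    by (simp add: ennreal_power ennreal_mult power_mult_distrib)
  finally have sq: "(\<integral>\<^sup>+x. ennreal (cmod (f x) * cmod (g x)) \<partial>lborel)\<^sup>2 \<le> ennreal ((L2norm f * L2norm g)\<^sup>2)"
    by (simp add: ennreal_mult)
  have le: "(\<integral>\<^sup>+x. ennreal (cmod (f x) * cmod (g x)) \<partial>lborel) \<le> ennreal (L2norm f * L2norm g)"
  proof (cases "\<integral>\<^sup>+x. ennreal (cmod (f x) * cmod (g x)) \<partial>lborel")
    case (real r)
    then have "r\<^sup>2 \<le> (L2norm f * L2norm g)\<^sup>2" using sq by (simp add: ennreal_power)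
    then have "r \<le> L2norm f * L2norm g" by (rule power2_le_imp_le) auto
    then show ?thesis using real by (simp add: ennreal_leI)
  next
    case top
    then show ?thesis using sq by (simp add: power2_eq_square ennreal_top_mult top_unique)
  qed
  show int: "integrable lborel (\<lambda>x. cmod (f x) * cmod (g x))"
    by (rule integrableI_nonneg) (auto intro: le_less_trans[OF le])
  show "(LINT x|lborel. cmod (f x) * cmod (g x)) \<le> L2norm f * L2norm g"
    using le by (subst (asm) nn_integral_eq_integral[OF int]) auto
qed

lemma L2_add:
  assumes "f \<in> L2" "g \<in> L2"
  shows "(\<lambda>x. f x + g x) \<in> L2" "L2norm (\<lambda>x. f x + g x) \<le> L2norm f + L2norm g"
proof -
  note [measurable] = L2_measurable[OF assms(1)] L2_measurable[OF assms(2)]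
  let ?S = "\<lambda>x. (cmod (f x))\<^sup>2 + 2 * (cmod (f x) * cmod (g x)) + (cmod (g x))\<^sup>2"
  note I = L2_integrable[OF assms(1)] L2_integrable[OF assms(2)] Cauchy_Schwarz_L2[OF assms]
  have le: "(cmod (f x + g x))\<^sup>2 \<le> ?S x" for x
  proof -
    have "(cmod (f x + g x))\<^sup>2 \<le> (cmod (f x) + cmod (g x))\<^sup>2"
      by (intro power_mono norm_triangle_ineq) auto
    also have "\<dots> = ?S x" by (simp add: power2_sum)
    finally show ?thesis .
  qed
  have int: "integrable lborel ?S" using I by simp
  show add: "(\<lambda>x. f x + g x) \<in> L2" unfolding L2_def using le
    by (auto intro!: Bochner_Integration.integrable_bound[OF int])
  have "(L2norm (\<lambda>x. f x + g x))\<^sup>2 \<le> (LINT x|lborel. ?S x)"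
    unfolding L2norm_square using le int L2_integrable[OF add] by (intro integral_mono) auto
  also have "\<dots> = (L2norm f)\<^sup>2 + 2 * (LINT x|lborel. cmod (f x) * cmod (g x)) + (L2norm g)\<^sup>2"
    using I by (simp add: L2norm_square)
  also have "\<dots> \<le> (L2norm f + L2norm g)\<^sup>2" using I(4) by (simp add: power2_sum)
  finally show "L2norm (\<lambda>x. f x + g x) \<le> L2norm f + L2norm g"
    by (rule power2_le_imp_le) auto
qed

lemma L2_diff:
  assumes "f \<in> L2" "g \<in> L2"
  shows "(\<lambda>x. f x - g x) \<in> L2" "L2norm (\<lambda>x. f x - g x) \<le> L2norm f + L2norm g"
  using L2_add[OF assms(1) L2_cmult[OF assms(2), of "-1"]] L2norm_cmult[of "-1" g] by auto

lemma L2norm_triangle_diff: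
  assumes "f \<in> L2" "g \<in> L2" "h \<in> L2"
  shows "L2norm (\<lambda>x. f x - h x) \<le> L2norm (\<lambda>x. f x - g x) + L2norm (\<lambda>x. g x - h x)"
  using L2_add(2)[OF L2_diff(1)[OF assms(1,2)] L2_diff(1)[OF assms(2,3)]] by simp

lemma L2norm_diff_abs:
  assumes "f \<in> L2" "g \<in> L2"
  shows "\<bar>L2norm f - L2norm g\<bar> \<le> L2norm (\<lambda>x. f x - g x)"
proof -
  have "L2norm f \<le> L2norm (\<lambda>x. f x - g x) + L2norm g"
    using L2_add(2)[OF L2_diff(1)[OF assms] assms(2)] by simp
  moreover have "L2norm g \<le> L2norm (\<lambda>x. g x - f x) + L2norm f"
    using L2_add(2)[OF L2_diff(1)[OF assms(2,1)] assms(1)] by simp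
  ultimately show ?thesis using L2norm_commute[of f g] by simp
qed

lemma L2norm_tendsto:
  assumes "\<And>n. f n \<in> L2" "g \<in> L2" "(\<lambda>n. L2norm (\<lambda>x. f n x - g x)) \<longlonglongrightarrow> 0"
  shows "(\<lambda>n. L2norm (f n)) \<longlonglongrightarrow> L2norm g"
proof -
  have "(\<lambda>n. L2norm (f n) - L2norm g) \<longlonglongrightarrow> 0"
    by (rule Lim_null_comparison[OF _ assms(3)]) (use L2norm_diff_abs[OF assms(1,2)] in auto)
  then show ?thesis by (simp add: LIM_zero_iff)
qed

lemma L2norm_zero_AE:
  assumes "f \<in> L2" "L2norm f = 0" shows "AE x in lborel. f x = 0"
proof -
  note [measurable] = L2_measurable[OF assms(1)]
  have "(\<integral>\<^sup>+x. ennreal ((cmod (f x))\<^sup>2) \<partial>lborel) = 0" using assms by (simp add: nn_integral_L2)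
  then show ?thesis by (subst (asm) nn_integral_0_iff_AE) auto
qed

lemma L2_limit_unique_AE:
  assumes "\<And>n. f n \<in> L2" "g \<in> L2" "h \<in> L2"
    "(\<lambda>n. L2norm (\<lambda>x. f n x - g x)) \<longlonglongrightarrow> 0" "(\<lambda>n. L2norm (\<lambda>x. f n x - h x)) \<longlonglongrightarrow> 0"
  shows "AE x in lborel. g x = h x"
proof -
  have "L2norm (\<lambda>x. g x - h x) \<le> L2norm (\<lambda>x. f n x - g x) + L2norm (\<lambda>x. f n x - h x)" for n
    using L2norm_triangle_diff[OF assms(2) assms(1) assms(3), of n] by (simp add: L2norm_commute)
  then have "L2norm (\<lambda>x. g x - h x) \<le> 0"
    using tendsto_add[OF assms(4,5)] by (intro LIMSEQ_le_const) auto
  then have "L2norm (\<lambda>x. g x - h x) = 0" by (simp add: antisym)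
  then show ?thesis using L2norm_zero_AE[OF L2_diff(1)[OF assms(2,3)]] by auto
qed

text \<open>
  Where the limit vanishes the inequality is trivial. This covers the zeros of a function that is
  inserted into \<open>s\<^sup>2 log s\<^sup>2\<close>.
\<close>
lemma nn_integral_Fatou_bound_zero:
  assumes [measurable]: "\<And>n. f n \<in> borel_measurable M"
    and lim: "AE x in M. g x = (0::ennreal) \<or> (\<lambda>n. f n x) \<longlonglongrightarrow> g x"
    and le: "\<And>n. (\<integral>\<^sup>+x. f n x \<partial>M) \<le> ennreal (b n)" and b: "b \<longlonglongrightarrow> B"
  shows "(\<integral>\<^sup>+x. g x \<partial>M) \<le> ennreal B"
proof -
  have "(\<integral>\<^sup>+x. g x \<partial>M) \<le> (\<integral>\<^sup>+x. liminf (\<lambda>n. f n x) \<partial>M)"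
    by (rule nn_integral_mono_AE, use lim in eventually_elim) (auto simp: lim_imp_Liminf)
  also have "\<dots> \<le> liminf (\<lambda>n. \<integral>\<^sup>+x. f n x \<partial>M)" by (rule nn_integral_liminf) simp
  also have "\<dots> \<le> liminf (\<lambda>n. ennreal (b n))" by (rule Liminf_mono) (use le in auto)
  also have "\<dots> = ennreal B" by (intro lim_imp_Liminf tendsto_ennrealI b) auto
  finally show ?thesis .
qed

lemma nn_integral_Fatou_bound:
  assumes "\<And>n. f n \<in> borel_measurable M" "AE x in M. (\<lambda>n. f n x) \<longlonglongrightarrow> (g x :: ennreal)"
    "\<And>n. (\<integral>\<^sup>+x. f n x \<partial>M) \<le> ennreal (b n)" "b \<longlonglongrightarrow> B"
  shows "(\<integral>\<^sup>+x. g x \<partial>M) \<le> ennreal B"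
  by (rule nn_integral_Fatou_bound_zero[OF assms(1) _ assms(3,4)]) (use assms(2) in eventually_elim, simp)

lemma L2_limit_AE_subseq:
  assumes "\<And>n. f n \<in> L2" "g \<in> L2" "(\<lambda>n. L2norm (\<lambda>x. f n x - g x)) \<longlonglongrightarrow> 0"
  obtains r :: "nat \<Rightarrow> nat" where "strict_mono r" "AE x in lborel. (\<lambda>n. f (r n) x) \<longlonglongrightarrow> g x"
proof -
  have "(\<lambda>n. (LINT x|lborel. norm ((cmod (f n x - g x))\<^sup>2))) \<longlonglongrightarrow> 0"
    using tendsto_power[OF assms(3), of 2] by (simp add: L2norm_square)
  moreover have "integrable lborel (\<lambda>x. (cmod (f n x - g x))\<^sup>2)" for n
    by (rule L2_integrable[OF L2_diff(1)[OF assms(1,2)]])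
  ultimately obtain r where r: "strict_mono r"
    "AE x in lborel. (\<lambda>n. (cmod (f (r n) x - g x))\<^sup>2) \<longlonglongrightarrow> 0"
    using tendsto_L1_AE_subseq[of lborel "\<lambda>n x. (cmod (f n x - g x))\<^sup>2"] by auto
  have "AE x in lborel. (\<lambda>n. f (r n) x) \<longlonglongrightarrow> g x"
    using r(2)
  proof eventually_elim
    case (elim x)
    then have "(\<lambda>n. cmod (f (r n) x - g x)) \<longlonglongrightarrow> 0" using tendsto_real_sqrt[OF elim] by simp
    then show ?case by (simp add: tendsto_norm_zero_iff LIM_zero_iff)
  qed
  with r(1) that show ?thesis by blast
qed

text \<open>
  The sum of \<open>2\<^sup>n |f (n+1) - f n|\<^sup>2\<close> has a finite integral, so it is finite almost everywhere, and
  there the increments decay geometrically.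
\<close>
lemma L2_fast_Cauchy_AE:
  assumes f: "\<And>n. f n \<in> L2" and fast: "\<And>n. L2norm (\<lambda>x. f (Suc n) x - f n x) \<le> (1/2)^n"
  shows "AE x in lborel. Cauchy (\<lambda>n. f n x)"
proof -
  note [measurable] = L2_measurable[OF f]
  let ?d = "\<lambda>n x. (cmod (f (Suc n) x - f n x))\<^sup>2"
  have "(\<integral>\<^sup>+x. (\<Sum>n. ennreal (2^n * ?d n x)) \<partial>lborel) = (\<Sum>n. \<integral>\<^sup>+x. ennreal (2^n * ?d n x) \<partial>lborel)"
    by (rule nn_integral_suminf) simp
  also have "\<dots> \<le> (\<Sum>n. ennreal ((1/2)^n))"
  proof (intro suminf_le summableI)
    fix n
    have "(\<integral>\<^sup>+x. ennreal (2^n * ?d n x) \<partial>lborel) = ennreal (2^n) * (\<integral>\<^sup>+x. ennreal (?d n x) \<partial>lborel)"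
      by (subst nn_integral_cmult[symmetric]) (auto simp: ennreal_mult)
    also have "\<dots> = ennreal (2^n * (L2norm (\<lambda>x. f (Suc n) x - f n x))\<^sup>2)"
      by (simp add: nn_integral_L2[OF L2_diff(1)[OF f f]] ennreal_mult)
    also have "\<dots> \<le> ennreal (2^n * ((1/2)^n)\<^sup>2)"
      by (intro ennreal_leI mult_left_mono power_mono fast) auto
    also have "\<dots> = ennreal ((1/2)^n)"
      by (simp add: power2_eq_square power_divide)
    finally show "(\<integral>\<^sup>+x. ennreal (2^n * ?d n x) \<partial>lborel) \<le> ennreal ((1/2)^n)" .
  qed
  also have "\<dots> = ennreal 2"
    by (subst suminf_ennreal2) (auto simp: summable_geometric suminf_geometric)
  finally have fin: "(\<integral>\<^sup>+x. (\<Sum>n. ennreal (2^n * ?d n x)) \<partial>lborel) \<noteq> \<infinity>"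
    by (auto simp: top_unique)
  have "AE x in lborel. (\<Sum>n. ennreal (2^n * ?d n x)) \<noteq> \<infinity>"
    by (rule nn_integral_PInf_AE[OF _ fin]) simp
  then show ?thesis
  proof eventually_elim
    case (elim x)
    then have "summable (\<lambda>n. 2^n * ?d n x)"
      by (intro summable_suminf_not_top) auto
    from summable_imp_Bseq[OF this] obtain C where "\<forall>n. norm (2^n * ?d n x) \<le> C"
      by (rule BseqE)
    then have C: "\<And>n. \<bar>2^n * ?d n x\<bar> \<le> C" by simp
    have C0: "0 \<le> C" using order_trans[OF abs_ge_zero C[of 0]] .
    have bound: "cmod (f (Suc n) x - f n x) \<le> sqrt C * (sqrt (1/2))^n" for n
    proof -
      have "?d n x \<le> C * (1/2)^n" using C[of n] by (simp add: field_simps power_divide)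
      then have "sqrt (?d n x) \<le> sqrt (C * (1/2)^n)" by (rule real_sqrt_le_mono)
      then show ?thesis by (simp add: real_sqrt_mult real_sqrt_power)
    qed
    have "summable (\<lambda>n. sqrt C * (sqrt (1/2))^n)"
      by (intro summable_mult summable_geometric) (simp add: real_sqrt_lt_1_iff)
    then have "summable (\<lambda>n. f (Suc n) x - f n x)"
      by (rule summable_comparison_test') (use bound in auto)
    then have "convergent (\<lambda>n. \<Sum>i<n. f (Suc i) x - f i x)" by (simp add: summable_iff_convergent)
    then have "convergent (\<lambda>n. f n x - f 0 x)" by (simp add: sum_lessThan_telescope[of "\<lambda>n. f n x"])
    then have "convergent (\<lambda>n. f n x)" using convergent_add[OF _ convergent_const[of "f 0 x"]] by fastforce
    then show ?case by (simp add: Cauchy_convergent_iff)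
  qed
qed


lemma L2_complete:
  assumes f: "\<And>n. f n \<in> L2"
    and Cauchy: "\<And>e. e > 0 \<Longrightarrow> \<exists>M. \<forall>m\<ge>M. \<forall>n\<ge>M. L2norm (\<lambda>x. f m x - f n x) \<le> e"
  obtains g where "g \<in> L2" "(\<lambda>n. L2norm (\<lambda>x. f n x - g x)) \<longlonglongrightarrow> 0"
proof -
  have "\<exists>r. \<forall>k. (\<forall>m\<ge>r k. \<forall>n\<ge>r k. L2norm (\<lambda>x. f m x - f n x) \<le> (1/2)^k) \<and> r k < r (Suc k)"
  proof (rule dependent_nat_choice)
    show "\<exists>x. \<forall>m\<ge>x. \<forall>n\<ge>x. L2norm (\<lambda>y. f m y - f n y) \<le> (1/2)^0" using Cauchy[of 1] by simp
  next
    fix x k :: nat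
    obtain M where M: "\<And>m n. m \<ge> M \<Longrightarrow> n \<ge> M \<Longrightarrow> L2norm (\<lambda>y. f m y - f n y) \<le> (1/2)^Suc k"
      using Cauchy[of "(1/2)^Suc k"] by force
    then show "\<exists>y. (\<forall>m\<ge>y. \<forall>n\<ge>y. L2norm (\<lambda>x. f m x - f n x) \<le> (1/2)^Suc k) \<and> x < y"
      by (intro exI[of _ "max M (Suc x)"]) auto
  qed
  then obtain r where r: "\<And>k m n. r k \<le> m \<Longrightarrow> r k \<le> n \<Longrightarrow> L2norm (\<lambda>x. f m x - f n x) \<le> (1/2)^k"
    "\<And>k. r k < r (Suc k)" by blast
  have mono: "r k \<le> r n" if "k \<le> n" for k n
    using that r(2) lift_Suc_mono_le[of r] less_imp_le by blast
  define g where "g x = lim (\<lambda>n. f (r n) x)" for x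
  note [measurable] = L2_measurable[OF f]
  have g_meas [measurable]: "g \<in> borel_measurable borel" unfolding g_def by measurable
  have "AE x in lborel. Cauchy (\<lambda>n. f (r n) x)"
    by (rule L2_fast_Cauchy_AE[OF f]) (use r less_imp_le in blast)
  then have lim: "AE x in lborel. (\<lambda>n. f (r n) x) \<longlonglongrightarrow> g x"
    by eventually_elim (auto simp: g_def Cauchy_convergent_iff convergent_LIMSEQ_iff)
  have dist: "(\<integral>\<^sup>+x. ennreal ((cmod (f m x - g x))\<^sup>2) \<partial>lborel) \<le> ennreal (((1/2)^k)\<^sup>2)" if "m \<ge> r k" for m k
  proof (rule nn_integral_Fatou_bound)
    show "AE x in lborel. (\<lambda>n. ennreal ((cmod (f m x - f (r (n + k)) x))\<^sup>2)) \<longlonglongrightarrow> ennreal ((cmod (f m x - g x))\<^sup>2)"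
      using lim
    proof eventually_elim
      case (elim x)
      then have "(\<lambda>n. f (r (n + k)) x) \<longlonglongrightarrow> g x" by (rule LIMSEQ_ignore_initial_segment)
      then show ?case by (intro tendsto_ennrealI tendsto_intros)
    qed
    fix n
    have "(L2norm (\<lambda>x. f m x - f (r (n + k)) x))\<^sup>2 \<le> ((1/2)^k)\<^sup>2"
      using r(1)[OF that mono[of k "n + k"]] by (intro power_mono) auto
    then show "(\<integral>\<^sup>+x. ennreal ((cmod (f m x - f (r (n + k)) x))\<^sup>2) \<partial>lborel) \<le> ennreal (((1/2)^k)\<^sup>2)"
      by (subst nn_integral_L2[OF L2_diff(1)[OF f f]]) (rule ennreal_leI)
  qed auto
  have "(\<lambda>x. f (r 0) x - g x) \<in> L2" by (rule L2_I[OF _ dist[of 0 "r 0"]]) auto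
  from L2_diff(1)[OF f[of "r 0"] this] have g: "g \<in> L2" by simp
  have le: "L2norm (\<lambda>x. f m x - g x) \<le> (1/2)^k" if "m \<ge> r k" for m k
    by (rule L2norm_le_I[OF _ dist[OF that]]) auto
  have "(\<lambda>n. L2norm (\<lambda>x. f n x - g x)) \<longlonglongrightarrow> 0"
  proof (rule LIMSEQ_I)
    fix e :: real assume "e > 0"
    then obtain k where "(1/2)^k < e" using real_arch_pow_inv[of e "1/2"] by auto
    then show "\<exists>no. \<forall>n\<ge>no. norm (L2norm (\<lambda>x. f n x - g x) - 0) < e"
      using le[of k] by (intro exI[of _ "r k"]) (auto intro: le_less_trans)
  qed
  with g that show ?thesis by blast
qed

section \<open>Translations and dilations\<close>

lemma nn_integral_lborel_affine:
  fixes f :: "'a::euclidean_space \<Rightarrow> ennreal"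
  assumes [measurable]: "f \<in> borel_measurable borel" and c: "c \<noteq> 0"
  shows "(\<integral>\<^sup>+x. f x \<partial>lborel) = ennreal (\<bar>c\<bar> ^ DIM('a)) * (\<integral>\<^sup>+x. f (t + c *\<^sub>R x) \<partial>lborel)"
  by (subst lborel_affine[OF c, of t])
     (simp add: nn_integral_density nn_integral_distr nn_integral_cmult)

lemma integrable_lborel_affine:
  fixes f :: "'a::euclidean_space \<Rightarrow> 'b :: {banach, second_countable_topology}"
  assumes f: "integrable lborel f" and c: "c \<noteq> 0"
  shows "integrable lborel (\<lambda>x. f (t + c *\<^sub>R x))"
proof -
  note [measurable] = borel_measurable_integrable[OF f]
  have "(\<integral>\<^sup>+x. norm (f x) \<partial>lborel) < \<infinity>" using f by (simp add: integrable_iff_bounded)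
  then have "(\<integral>\<^sup>+x. norm (f (t + c *\<^sub>R x)) \<partial>lborel) < \<infinity>"
    using c by (subst (asm) nn_integral_lborel_affine[of _ c t]) (auto simp: ennreal_mult_less_top)
  then show ?thesis by (simp add: integrable_iff_bounded)
qed

lemma integral_lborel_affine:
  fixes f :: "'a::euclidean_space \<Rightarrow> 'b :: {banach, second_countable_topology}"
  assumes f: "integrable lborel f" and c: "c \<noteq> 0"
  shows "(LINT x|lborel. f x) = \<bar>c\<bar> ^ DIM('a) *\<^sub>R (LINT x|lborel. f (t + c *\<^sub>R x))"
proof -
  note [measurable] = borel_measurable_integrable[OF f]
  show ?thesis
    by (subst lborel_affine[OF c, of t]) (simp add: integral_density integral_distr)
qed

lemma nn_integral_lborel_shift:
  "f \<in> borel_measurable borel \<Longrightarrow> (\<integral>\<^sup>+x. f (x + t) \<partial>lborel) = (\<integral>\<^sup>+x. f (x::'a::euclidean_space) \<partial>lborel)"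
  using nn_integral_lborel_affine[of f 1 t] by (simp add: add.commute)

lemma nn_integral_lborel_uminus:
  "f \<in> borel_measurable borel \<Longrightarrow> (\<integral>\<^sup>+x. f (- x) \<partial>lborel) = (\<integral>\<^sup>+x. f (x::'a::euclidean_space) \<partial>lborel)"
  using nn_integral_lborel_affine[of f "-1" 0] by simp

lemma integrable_lborel_shift:
  fixes f :: "'a::euclidean_space \<Rightarrow> 'b :: {banach, second_countable_topology}"
  shows "integrable lborel f \<Longrightarrow> integrable lborel (\<lambda>x. f (x + t))"
  using integrable_lborel_affine[of f 1 t] by (simp add: add.commute)

lemma integral_lborel_shift:
  fixes f :: "'a::euclidean_space \<Rightarrow> 'b :: {banach, second_countable_topology}"
  shows "integrable lborel f \<Longrightarrow> (LINT x|lborel. f (x + t)) = (LINT x|lborel. f x)"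
  using integral_lborel_affine[of f 1 t] by (simp add: add.commute)

lemma L2_shift:
  assumes "f \<in> L2" shows "(\<lambda>x. f (x + t)) \<in> L2" "L2norm (\<lambda>x. f (x + t)) = L2norm f"
proof -
  note [measurable] = L2_measurable[OF assms]
  show "(\<lambda>x. f (x + t)) \<in> L2"
    using integrable_lborel_shift[OF L2_integrable[OF assms], of t] by (auto simp: L2_def)
  show "L2norm (\<lambda>x. f (x + t)) = L2norm f" unfolding L2norm_def
    using integral_lborel_shift[OF L2_integrable[OF assms], of t] by simp
qed

text \<open>
  For an open set \<open>U\<close> the negative part of \<open>1\<^sub>U(x + h) - 1\<^sub>U(x)\<close> tends to \<open>0\<close> at every point, and
  it carries half of the \<open>L\<^sup>1\<close> norm because the integral of the difference vanishes. Outer regularity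
  then reduces measurable sets to open ones.
\<close>
lemma indicator_translation_tendsto_open:
  fixes U :: "'a::euclidean_space set" and h :: "nat \<Rightarrow> 'a"
  assumes U: "open U" "emeasure lborel U < \<infinity>" and h: "h \<longlonglongrightarrow> 0"
  shows "(\<lambda>n. LINT x|lborel. \<bar>indicat_real U (x + h n) - indicat_real U x\<bar>) \<longlonglongrightarrow> 0"
proof -
  have [measurable]: "U \<in> sets borel" using U(1) by simp
  have int: "integrable lborel (indicat_real U)" using U by (intro integrable_real_indicator) auto
  have int': "integrable lborel (\<lambda>x. indicat_real U (x + t))" for t
    by (rule integrable_lborel_shift[OF int])
  let ?p = "\<lambda>n x. max 0 (indicat_real U x - indicat_real U (x + h n))"
  have p: "integrable lborel (?p n)" for n
    by (intro integrable_max Bochner_Integration.integrable_diff int int') simp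
  have eq: "(LINT x|lborel. \<bar>indicat_real U (x + h n) - indicat_real U x\<bar>) = 2 * (LINT x|lborel. ?p n x)" for n
  proof -
    have "(LINT x|lborel. \<bar>indicat_real U (x + h n) - indicat_real U x\<bar>) =
        (LINT x|lborel. 2 * ?p n x + (indicat_real U (x + h n) - indicat_real U x))"
      by (rule Bochner_Integration.integral_cong) (auto simp: max_def abs_if)
    also have "\<dots> = 2 * (LINT x|lborel. ?p n x) + ((LINT x|lborel. indicat_real U (x + h n)) - (LINT x|lborel. indicat_real U x))"
      using p[of n] int int'[of "h n"] by simp
    also have "(LINT x|lborel. indicat_real U (x + h n)) = (LINT x|lborel. indicat_real U x)"
      by (rule integral_lborel_shift[OF int])
    finally show ?thesis by simp
  qed
  have "(\<lambda>n. LINT x|lborel. ?p n x) \<longlonglongrightarrow> (LINT x|(lborel::'a measure). (0::real))"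
  proof (rule integral_dominated_convergence[where w="indicat_real U"])
    show "AE x in lborel. (\<lambda>n. ?p n x) \<longlonglongrightarrow> 0"
    proof (rule AE_I2)
      fix x
      show "(\<lambda>n. ?p n x) \<longlonglongrightarrow> 0"
      proof (cases "x \<in> U")
        case True
        have "(\<lambda>n. x + h n) \<longlonglongrightarrow> x" using tendsto_add[OF tendsto_const h] by simp
        then have "\<forall>\<^sub>F n in sequentially. x + h n \<in> U" using topological_tendstoD U(1) True by blast
        then have "\<forall>\<^sub>F n in sequentially. ?p n x = 0" by eventually_elim (use True in auto)
        then show ?thesis by (rule tendsto_eventually)
      qed (auto simp: indicator_def)
    qed
  qed (use int in \<open>auto simp: indicator_def\<close>)
  then show ?thesis unfolding eq by (auto intro: tendsto_mult_right_zero)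
qed

lemma integral_abs_triangle3:
  fixes f g h k :: "'a \<Rightarrow> 'b :: {banach, second_countable_topology}"
  assumes "integrable M f" "integrable M g" "integrable M h" "integrable M k"
  shows "(LINT x|M. norm (f x - k x)) \<le> (LINT x|M. norm (f x - g x)) + (LINT x|M. norm (g x - h x)) + (LINT x|M. norm (h x - k x))"
proof -
  have "(LINT x|M. norm (f x - k x)) \<le> (LINT x|M. norm (f x - g x) + norm (g x - h x) + norm (h x - k x))"
  proof (rule integral_mono)
    fix x
    have "f x - k x = (f x - g x) + (g x - h x) + (h x - k x)" by simp
    then show "norm (f x - k x) \<le> norm (f x - g x) + norm (g x - h x) + norm (h x - k x)"
      by (metis norm_triangle_le norm_triangle_ineq add_mono order_refl)
  qed (use assms in auto)
  also have "\<dots> = (LINT x|M. norm (f x - g x)) + (LINT x|M. norm (g x - h x)) + (LINT x|M. norm (h x - k x))"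
    using assms by simp
  finally show ?thesis .
qed

text \<open>Approximation in \<open>L\<^sup>1\<close> transfers the convergence, since translations preserve the norm.\<close>
lemma L1_translation_tendsto_approx:
  fixes f :: "'a::euclidean_space \<Rightarrow> 'b :: {banach, second_countable_topology}"
  assumes f: "integrable lborel f"
    and approx: "\<And>e. e > 0 \<Longrightarrow> \<exists>g. integrable lborel g \<and> (LINT x|lborel. norm (g x - f x)) \<le> e \<and>
        (\<lambda>n. LINT x|lborel. norm (g (x + h n) - g x)) \<longlonglongrightarrow> 0"
  shows "(\<lambda>n. LINT x|lborel. norm (f (x + h n) - f x)) \<longlonglongrightarrow> 0"
proof (rule LIMSEQ_I)
  fix e :: real assume "e > 0"
  then obtain g where g: "integrable lborel g" "(LINT x|lborel. norm (g x - f x)) \<le> e/4"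
    "(\<lambda>n. LINT x|lborel. norm (g (x + h n) - g x)) \<longlonglongrightarrow> 0" using approx[of "e/4"] by auto
  from LIMSEQ_D[OF g(3), of "e/4"] \<open>e > 0\<close> obtain N where
    N: "\<And>n. n \<ge> N \<Longrightarrow> (LINT x|lborel. norm (g (x + h n) - g x)) < e/4" by auto
  have "norm ((LINT x|lborel. norm (f (x + h n) - f x)) - 0) < e" if "n \<ge> N" for n
  proof -
    have "(LINT x|lborel. norm (f (x + h n) - g (x + h n))) = (LINT x|lborel. norm (f x - g x))"
      using integral_lborel_shift[of "\<lambda>x. norm (f x - g x)" "h n"] f g(1) by simp
    with integral_abs_triangle3[OF integrable_lborel_shift[OF f, of "h n"] integrable_lborel_shift[OF g(1), of "h n"] g(1) f]
      g(2) N[OF that] \<open>e > 0\<close>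
    show ?thesis by (simp add: norm_minus_commute)
  qed
  then show "\<exists>N. \<forall>n\<ge>N. norm ((LINT x|lborel. norm (f (x + h n) - f x)) - 0) < e" by blast
qed

lemma L1_translation_tendsto:
  fixes f :: "'a::euclidean_space \<Rightarrow> 'b :: {banach, second_countable_topology}"
  assumes f: "integrable lborel f" and h: "h \<longlonglongrightarrow> 0"
  shows "(\<lambda>n. LINT x|lborel. norm (f (x + h n) - f x)) \<longlonglongrightarrow> 0"
  using f
proof (induction rule: integrable_induct)
  case (base A c)
  have [measurable]: "A \<in> sets borel" using base by simp
  show ?case
  proof (rule L1_translation_tendsto_approx)
    show "integrable lborel (\<lambda>x. indicat_real A x *\<^sub>R c)" using base by simp
    fix e :: real assume "e > 0"
    then have "e / (norm c + 1) > 0" by (simp add: add_nonneg_pos)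
    then obtain U where U: "open U" "A \<subseteq> U" "U - A \<in> lmeasurable" "emeasure lebesgue (U - A) < ennreal (e / (norm c + 1))"
      using sets_lebesgue_outer_open[of A] base(1) by blast
    have [measurable]: "U \<in> sets borel" using U(1) by simp
    have diff: "emeasure lborel (U - A) < ennreal (e / (norm c + 1))" using U(4) by simp
    have fin: "emeasure lborel U < \<infinity>"
    proof -
      have "emeasure lborel U \<le> emeasure lborel A + emeasure lborel (U - A)"
        using emeasure_subadditive[of A lborel "U - A"] U(2) by (simp add: Un_absorb1)
      also have "\<dots> < \<infinity>" using base(2) diff ennreal_less_top less_trans by (fastforce simp: ennreal_add_less_top)
      finally show ?thesis .
    qed
    let ?g = "\<lambda>x. indicat_real U x *\<^sub>R c"
    have "(LINT x|lborel. norm (?g x - indicat_real A x *\<^sub>R c)) = (LINT x|lborel. indicat_real (U - A) x * norm c)"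
      by (rule Bochner_Integration.integral_cong) (use U(2) in \<open>auto simp: indicator_def\<close>)
    also have "\<dots> = measure lborel (U - A) * norm c" by simp
    also have "\<dots> \<le> e / (norm c + 1) * norm c"
      using diff \<open>e > 0\<close> by (intro mult_right_mono) (auto simp: measure_def enn2real_leI less_imp_le)
    also have "\<dots> \<le> e"
    proof -
      have "0 < norm c + 1" by (simp add: add_nonneg_pos)
      moreover have "e * norm c \<le> e * (norm c + 1)" using \<open>e > 0\<close> by (intro mult_left_mono) auto
      ultimately show ?thesis by (simp add: pos_divide_le_eq)
    qed
    finally have "(LINT x|lborel. norm (?g x - indicat_real A x *\<^sub>R c)) \<le> e" .
    moreover have "integrable lborel ?g" using fin by simp
    moreover have "(\<lambda>n. LINT x|lborel. norm (?g (x + h n) - ?g x)) \<longlonglongrightarrow> 0"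
    proof -
      have "(\<lambda>n. (LINT x|lborel. \<bar>indicat_real U (x + h n) - indicat_real U x\<bar>) * norm c) \<longlonglongrightarrow> 0"
        using indicator_translation_tendsto_open[OF U(1) fin h] by (rule tendsto_mult_left_zero)
      moreover have "norm (?g (x + t) - ?g x) = \<bar>indicat_real U (x + t) - indicat_real U x\<bar> * norm c" for x t
        by (simp flip: scaleR_diff_left)
      ultimately show ?thesis by simp
    qed
    ultimately show "\<exists>g. integrable lborel g \<and> (LINT x|lborel. norm (g x - indicat_real A x *\<^sub>R c)) \<le> e \<and>
        (\<lambda>n. LINT x|lborel. norm (g (x + h n) - g x)) \<longlonglongrightarrow> 0" by blast
  qed
next
  case (add f g)
  show ?case
  proof (rule Lim_null_comparison[OF _ tendsto_add_zero[OF add(3,4)]], rule always_eventually, rule allI)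
    fix n
    note I = add(1,2) integrable_lborel_shift[OF add(1), of "h n"] integrable_lborel_shift[OF add(2), of "h n"]
    have "(LINT x|lborel. norm (f (x + h n) + g (x + h n) - (f x + g x))) \<le>
      (LINT x|lborel. norm (f (x + h n) - f x) + norm (g (x + h n) - g x))"
      using I by (intro integral_mono) (auto intro: norm_diff_triangle_ineq)
    also have "\<dots> = (LINT x|lborel. norm (f (x + h n) - f x)) + (LINT x|lborel. norm (g (x + h n) - g x))"
      using I by simp
    finally show "norm (LINT x|lborel. norm (f (x + h n) + g (x + h n) - (f x + g x))) \<le>
      (LINT x|lborel. norm (f (x + h n) - f x)) + (LINT x|lborel. norm (g (x + h n) - g x))" by simp
  qed
next
  case (lim f s)
  show ?case
  proof (rule L1_translation_tendsto_approx[OF lim(4)])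
    fix e :: real assume "e > 0"
    have "(\<lambda>i. LINT x|lborel. norm (s i x - f x)) \<longlonglongrightarrow> (LINT x|(lborel::'a measure). (0::real))"
    proof (rule integral_dominated_convergence[where w="\<lambda>x. 3 * norm (f x)"])
      show "AE x in lborel. norm (norm (s i x - f x)) \<le> 3 * norm (f x)" for i
      proof (rule AE_I2)
        fix x show "norm (norm (s i x - f x)) \<le> 3 * norm (f x)"
          using lim(3)[of x i] norm_triangle_ineq4[of "s i x" "f x"] by simp
      qed
      show "AE x in lborel. (\<lambda>i. norm (s i x - f x)) \<longlonglongrightarrow> 0"
        using lim(2) by (auto intro!: tendsto_norm_zero LIM_zero)
    qed (use lim in auto)
    then have "(\<lambda>i. LINT x|lborel. norm (s i x - f x)) \<longlonglongrightarrow> 0" by simp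
    from order_tendstoD(2)[OF this \<open>e > 0\<close>] obtain i where "(LINT x|lborel. norm (s i x - f x)) < e"
      by (auto simp: eventually_sequentially)
    then have "(LINT x|lborel. norm (s i x - f x)) \<le> e" by simp
    with lim(1)[of i] lim(5)[of i] show "\<exists>g. integrable lborel g \<and> (LINT x|lborel. norm (g x - f x)) \<le> e \<and>
        (\<lambda>n. LINT x|lborel. norm (g (x + h n) - g x)) \<longlonglongrightarrow> 0" by blast
  qed
qed

section \<open>The Fourier integral of integrable functions\<close>

definition fourier_integral :: "('a::euclidean_space \<Rightarrow> complex) \<Rightarrow> 'a \<Rightarrow> complex" where
  "fourier_integral f k =
     of_real ((2 * pi) powr (- real DIM('a) / 2)) * (LINT x|lborel. cis (- (k \<bullet> x)) * f x)"

lemma cis_measurable [measurable]: "cis \<in> borel_measurable borel"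
  by (intro borel_measurable_continuous_onI continuous_intros)

lemma cnj_measurable [measurable]: "cnj \<in> borel_measurable borel"
  by (intro borel_measurable_continuous_onI continuous_intros)

lemma integrable_unimodular_mult:
  fixes f :: "'a \<Rightarrow> complex"
  assumes "integrable M f" "g \<in> borel_measurable M" "\<And>x. cmod (g x) \<le> 1"
  shows "integrable M (\<lambda>x. g x * f x)"
proof (rule Bochner_Integration.integrable_bound[OF assms(1)])
  show "AE x in M. norm (g x * f x) \<le> norm (f x)"
    using assms(3) by (auto simp: norm_mult mult_left_le_one_le)
qed (use assms borel_measurable_integrable in auto)

lemma integrable_cis_mult:
  fixes f :: "'a::euclidean_space \<Rightarrow> complex"
  shows "integrable lborel f \<Longrightarrow> integrable lborel (\<lambda>x. cis (k \<bullet> x) * f x)"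
  "integrable lborel f \<Longrightarrow> integrable lborel (\<lambda>x. cis (- (k \<bullet> x)) * f x)"
  by (auto intro!: integrable_unimodular_mult)

lemma fourier_integral_measurable [measurable]:
  assumes [measurable]: "f \<in> borel_measurable borel"
  shows "fourier_integral f \<in> borel_measurable borel"
  unfolding fourier_integral_def
  by (intro borel_measurable_times borel_measurable_const lborel.borel_measurable_lebesgue_integral)
     measurable

lemma fourier_integral_bound:
  fixes f :: "'a::euclidean_space \<Rightarrow> complex"
  shows "cmod (fourier_integral f k) \<le> (2 * pi) powr (- real DIM('a) / 2) * (LINT x|lborel. cmod (f x))"
proof -
  have "cmod (LINT x|lborel. cis (- (k \<bullet> x)) * f x) \<le> (LINT x|lborel. norm (cis (- (k \<bullet> x)) * f x))"
    by (rule integral_norm_bound)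
  then show ?thesis unfolding fourier_integral_def
    by (simp add: norm_mult mult_left_mono)
qed

lemma fourier_integral_diff:
  assumes "integrable lborel f" "integrable lborel g"
  shows "fourier_integral (\<lambda>x. f x - g x) k = fourier_integral f k - fourier_integral g k"
  using integrable_cis_mult(2)[OF assms(1), of k] integrable_cis_mult(2)[OF assms(2), of k]
  by (simp add: fourier_integral_def right_diff_distrib)

lemma fourier_integral_modulate:
  "fourier_integral (\<lambda>x. cis (- (l \<bullet> x)) * f x) k = fourier_integral f (k + l)"
proof -
  have "cis (- (k \<bullet> x)) * (cis (- (l \<bullet> x)) * f x) = cis (- ((k + l) \<bullet> x)) * f x" for x
    by (simp add: mult.assoc[symmetric] cis_mult inner_add_left)
  then show ?thesis unfolding fourier_integral_def by (simp only:)
qed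

lemma fourier_integral_translate:
  assumes f: "integrable lborel f"
  shows "fourier_integral (\<lambda>x. f (x - y)) k = cis (- (k \<bullet> y)) * fourier_integral f k"
proof -
  have "(LINT x|lborel. cis (- (k \<bullet> x)) * f x) = (LINT x|lborel. cis (- (k \<bullet> (x - y))) * f (x - y))"
    using integral_lborel_shift[OF integrable_cis_mult(2)[OF f, of k], of "-y"] by simp
  also have "\<dots> = (LINT x|lborel. cis (k \<bullet> y) * (cis (- (k \<bullet> x)) * f (x - y)))"
    by (simp add: mult.assoc[symmetric] cis_mult inner_diff_right algebra_simps)
  finally have "(LINT x|lborel. cis (- (k \<bullet> x)) * f x) = cis (k \<bullet> y) * (LINT x|lborel. cis (- (k \<bullet> x)) * f (x - y))"
    by simp
  then show ?thesis unfolding fourier_integral_def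
    by (simp add: mult.assoc[symmetric] mult.left_commute cis_mult)
qed

lemma integral_lborel_reflect:
  fixes f :: "'a::euclidean_space \<Rightarrow> 'b :: {banach, second_countable_topology}"
  assumes "integrable lborel f"
  shows "integrable lborel (\<lambda>y. f (x - y))" "(LINT y|lborel. f (x - y)) = (LINT y|lborel. f y)"
  using integrable_lborel_affine[OF assms, of "-1" x] integral_lborel_affine[OF assms, of "-1" x] by auto

lemma integrable_pair_mult:
  fixes f g :: "'a::euclidean_space \<Rightarrow> complex" and c :: "'a \<Rightarrow> 'a \<Rightarrow> complex"
  assumes "integrable lborel f" "integrable lborel g"
    and c: "case_prod c \<in> borel_measurable (borel \<Otimes>\<^sub>M borel)" "\<And>x y. cmod (c x y) \<le> 1"
  shows "integrable (lborel \<Otimes>\<^sub>M lborel) (\<lambda>(x, y). c x y * (f x * g y))"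
proof -
  have [measurable]: "f \<in> borel_measurable borel" "g \<in> borel_measurable borel"
    using assms borel_measurable_integrable by fastforce+
  have "integrable (lborel \<Otimes>\<^sub>M lborel) (\<lambda>z. f (fst z) * g (snd z))"
  proof (rule lborel_pair.Fubini_integrable)
    show "integrable lborel (\<lambda>x. LBINT y. norm (f (fst (x, y)) * g (snd (x, y))))"
      using assms(1) by (simp add: norm_mult)
  qed (use assms in auto)
  then have "integrable (lborel \<Otimes>\<^sub>M lborel) (\<lambda>z. case_prod c z * (f (fst z) * g (snd z)))"
    by (rule integrable_unimodular_mult) (use c in auto)
  then show ?thesis by (simp add: case_prod_unfold)
qed

text \<open>The multiplication formula, an instance of Fubini's theorem.\<close>
lemma fourier_integral_multiplication:
  fixes f g :: "'a::euclidean_space \<Rightarrow> complex"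
  assumes "integrable lborel f" "integrable lborel g"
  shows "(LINT k|lborel. fourier_integral f k * g k) = (LINT k|lborel. f k * fourier_integral g k)"
proof -
  let ?c = "complex_of_real ((2 * pi) powr (- real DIM('a) / 2))"
  have "integrable (lborel \<Otimes>\<^sub>M lborel) (\<lambda>(x, k). cis (- (k \<bullet> x)) * (f x * g k))"
    by (rule integrable_pair_mult[OF assms]) auto
  from lborel_pair.Fubini_integral[OF this]
  have "(LINT k|lborel. LINT x|lborel. cis (- (k \<bullet> x)) * (f x * g k)) =
      (LINT x|lborel. LINT k|lborel. cis (- (k \<bullet> x)) * (f x * g k))" .
  moreover have "?c * (LINT x|lborel. cis (- (k \<bullet> x)) * (f x * g k)) = fourier_integral f k * g k" for k
    by (simp add: fourier_integral_def mult.assoc[symmetric])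
  moreover have "?c * (LINT k|lborel. cis (- (k \<bullet> x)) * (f x * g k)) = f x * fourier_integral g x" for x
  proof -
    have "cis (- (k \<bullet> x)) * (f x * g k) = f x * (cis (- (x \<bullet> k)) * g k)" for k
      by (simp add: inner_commute)
    then have "(LINT k|lborel. cis (- (k \<bullet> x)) * (f x * g k)) = f x * (LINT k|lborel. cis (- (x \<bullet> k)) * g k)"
      by (simp only: integral_mult_right_zero)
    then show ?thesis by (simp add: fourier_integral_def)
  qed
  ultimately show ?thesis by (metis (no_types, lifting) Bochner_Integration.integral_cong integral_mult_right_zero)
qed

section \<open>The Gaussian\<close>

lemma std_normal_characteristic:
  "integrable lborel (\<lambda>x. cis (t * x) * complex_of_real (std_normal_density x))"
  "(LINT x|lborel. cis (t * x) * complex_of_real (std_normal_density x)) = of_real (exp (- t\<^sup>2 / 2))"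
proof -
  have "integrable lborel (\<lambda>x. complex_of_real (std_normal_density x))" by simp
  then show "integrable lborel (\<lambda>x. cis (t * x) * complex_of_real (std_normal_density x))"
    by (rule integrable_unimodular_mult) auto
  have "char std_normal_distribution t = (LINT x|lborel. std_normal_density x *\<^sub>R iexp (t * x))"
    unfolding char_def by (subst integral_density) (auto simp: normal_density_nonneg)
  also have "\<dots> = (LINT x|lborel. cis (t * x) * complex_of_real (std_normal_density x))"
    by (rule Bochner_Integration.integral_cong) (auto simp: cis_conv_exp scaleR_conv_of_real)
  finally show "(LINT x|lborel. cis (t * x) * complex_of_real (std_normal_density x)) = of_real (exp (- t\<^sup>2 / 2))"
    by (simp add: char_std_normal_distribution)
qed

lemma norm_eq_sum_Basis: "(norm (x::'a::euclidean_space))\<^sup>2 = (\<Sum>b\<in>Basis. (x \<bullet> b)\<^sup>2)"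
  unfolding power2_norm_eq_inner by (subst euclidean_inner) (simp add: power2_eq_square)

lemma prod_std_normal_density:
  fixes x :: "'a::euclidean_space"
  shows "(\<Prod>b\<in>Basis. std_normal_density (x \<bullet> b)) = (2 * pi) powr (- real DIM('a) / 2) * exp (- (norm x)\<^sup>2 / 2)"
proof -
  have "(\<Prod>b\<in>(Basis::'a set). std_normal_density (x \<bullet> b)) =
     (1 / sqrt (2 * pi)) ^ DIM('a) * exp (\<Sum>b\<in>Basis. - (x \<bullet> b)\<^sup>2 / 2)"
    by (simp add: std_normal_density_def prod.distrib exp_sum prod_dividef power_divide)
  also have "(1 / sqrt (2 * pi)) = (2 * pi) powr (- (1/2))"
    by (simp only: powr_minus) (simp add: powr_half_sqrt inverse_eq_divide)
  also have "((2 * pi) powr (- (1/2))) ^ DIM('a) = (2 * pi) powr (- real DIM('a) / 2)"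
    by (simp add: powr_realpow[symmetric] powr_powr)
  also have "(\<Sum>b\<in>(Basis::'a set). - (x \<bullet> b)\<^sup>2 / 2) = - (norm x)\<^sup>2 / 2"
    by (simp add: norm_eq_sum_Basis sum_negf sum_divide_distrib)
  finally show ?thesis .
qed

lemma cis_sum: "finite A \<Longrightarrow> cis (\<Sum>a\<in>A. f a) = (\<Prod>a\<in>A. cis (f a))"
  by (induction A rule: finite_induct) (auto simp: cis_mult[symmetric])

lemma gaussian_integral:
  fixes w :: "'a::euclidean_space"
  defines "c \<equiv> (2 * pi) powr (- real DIM('a) / 2)"
  shows "integrable lborel (\<lambda>x. cis (w \<bullet> x) * complex_of_real (c * exp (- (norm x)\<^sup>2 / 2)))"
    "(LINT x|lborel. cis (w \<bullet> x) * complex_of_real (c * exp (- (norm x)\<^sup>2 / 2))) = of_real (exp (- (norm w)\<^sup>2 / 2))"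
proof -
  interpret product_sigma_finite "\<lambda>_::'a. lborel :: real measure" ..
  let ?F = "\<lambda>x::'a. cis (w \<bullet> x) * complex_of_real (c * exp (- (norm x)\<^sup>2 / 2))"
  let ?g = "\<lambda>b x. cis ((w \<bullet> b) * x) * complex_of_real (std_normal_density x)"
  let ?T = "\<lambda>f. \<Sum>b\<in>(Basis::'a set). f b *\<^sub>R b"
  have F [measurable]: "?F \<in> borel_measurable borel" by measurable
  have eq: "?F (?T f) = (\<Prod>b\<in>Basis. ?g b (f b))" for f
  proof -
    have "c * exp (- (norm (?T f))\<^sup>2 / 2) = (\<Prod>b\<in>Basis. std_normal_density (f b))"
      unfolding c_def prod_std_normal_density[symmetric] by (rule prod.cong) auto
    moreover have "cis (w \<bullet> ?T f) = (\<Prod>b\<in>Basis. cis ((w \<bullet> b) * f b))"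
      by (subst cis_sum[symmetric]) (auto simp: inner_sum_right mult.commute)
    ultimately show ?thesis by (simp add: prod.distrib)
  qed
  have "integrable (Pi\<^sub>M Basis (\<lambda>_. lborel)) (\<lambda>f. \<Prod>b\<in>(Basis::'a set). ?g b (f b))"
    by (rule product_integrable_prod) (auto intro: std_normal_characteristic)
  then show "integrable lborel ?F"
    by (subst lborel_eq, subst integrable_distr_eq) (simp_all only: eq F, measurable)
  have "(LINT x|lborel. ?F x) = (LINT f|Pi\<^sub>M Basis (\<lambda>_. lborel). ?F (?T f))"
    by (subst lborel_eq, subst integral_distr) (simp_all only: F, measurable)
  also have "\<dots> = (\<Prod>b\<in>Basis. LINT x|lborel. ?g b x)"
    unfolding eq by (rule product_integral_prod) (auto intro: std_normal_characteristic)
  also have "\<dots> = (\<Prod>b\<in>Basis. of_real (exp (- (w \<bullet> b)\<^sup>2 / 2)))"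
    by (simp add: std_normal_characteristic(2))
  also have "\<dots> = of_real (exp (- (norm w)\<^sup>2 / 2))"
    by (simp add: norm_eq_sum_Basis exp_sum[symmetric] sum_negf sum_divide_distrib flip: of_real_prod)
  finally show "(LINT x|lborel. ?F x) = of_real (exp (- (norm w)\<^sup>2 / 2))" .
qed

lemma integrable_gaussian:
  "integrable lborel (\<lambda>x::'a::euclidean_space. (2 * pi) powr (- real DIM('a) / 2) * exp (- (norm x)\<^sup>2 / 2))"
  "(LINT x::'a|lborel. (2 * pi) powr (- real DIM('a) / 2) * exp (- (norm x)\<^sup>2 / 2)) = 1"
proof -
  show "integrable lborel (\<lambda>x::'a. (2 * pi) powr (- real DIM('a) / 2) * exp (- (norm x)\<^sup>2 / 2))"
    using integrable_Re[OF gaussian_integral(1)[of "0::'a"]] by (simp del: of_real_mult)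
  from arg_cong[OF gaussian_integral(2)[of "0::'a"], of Re]
  show "(LINT x::'a|lborel. (2 * pi) powr (- real DIM('a) / 2) * exp (- (norm x)\<^sup>2 / 2)) = 1"
    by (simp del: of_real_mult of_real_exp)
qed

lemma fourier_integral_gaussian:
  fixes k :: "'a::euclidean_space"
  assumes t: "t > 0"
  defines "G \<equiv> \<lambda>x::'a. complex_of_real (exp (- t\<^sup>2 * (norm x)\<^sup>2 / 2))"
  shows "integrable lborel G"
    and "fourier_integral G k = of_real (exp (- (norm k)\<^sup>2 / (2 * t\<^sup>2)) / t ^ DIM('a))"
proof -
  let ?c = "(2 * pi) powr (- real DIM('a) / 2)"
  let ?F = "\<lambda>w x::'a. cis (w \<bullet> x) * complex_of_real (?c * exp (- (norm x)\<^sup>2 / 2))"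
  have c: "?c \<noteq> 0" by simp
  have F: "?F w (t *\<^sub>R x) = ?c * (cis ((t *\<^sub>R w) \<bullet> x) * G x)" for w x
    by (simp add: G_def power_mult_distrib)
  from integrable_lborel_affine[OF gaussian_integral(1)[of "0::'a"], of t 0] t
  have "integrable lborel (\<lambda>x. complex_of_real ?c * G x)" by (simp add: G_def power_mult_distrib)
  then have int: "integrable lborel (\<lambda>x. inverse (complex_of_real ?c) * (complex_of_real ?c * G x))"
    by (rule integrable_mult_right)
  have "(\<lambda>x. inverse C * (C * G x)) = G" if "C \<noteq> 0" for C using that by auto
  from int this[of "complex_of_real ?c"] c show "integrable lborel G" by (simp only: of_real_eq_0_iff not_False_eq_True)
  define w where "w = (- 1 / t) *\<^sub>R k"
  have tw: "t *\<^sub>R w = - k" using t by (simp add: w_def)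
  have "of_real (exp (- (norm w)\<^sup>2 / 2)) = (t ^ DIM('a)) *\<^sub>R (LINT x|lborel. ?F w (0 + t *\<^sub>R x))"
    using integral_lborel_affine[OF gaussian_integral(1)[of w], of t 0] gaussian_integral(2)[of w] t by simp
  also have "(LINT x|lborel. ?F w (0 + t *\<^sub>R x)) = fourier_integral G k"
    unfolding add_0_left F fourier_integral_def tw by simp
  finally have "of_real (exp (- (norm w)\<^sup>2 / 2)) = (t ^ DIM('a)) *\<^sub>R fourier_integral G k" .
  moreover have "(norm w)\<^sup>2 = (norm k)\<^sup>2 / t\<^sup>2" by (simp add: w_def power_divide)
  ultimately show "fourier_integral G k = of_real (exp (- (norm k)\<^sup>2 / (2 * t\<^sup>2)) / t ^ DIM('a))"
    using t by (simp add: scaleR_conv_of_real field_simps)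
qed

section \<open>Plancherel's theorem\<close>

definition autocorrelation :: "('a::euclidean_space \<Rightarrow> complex) \<Rightarrow> 'a \<Rightarrow> complex" where
  "autocorrelation f w = (LINT x|lborel. f x * cnj (f (x - w)))"

lemma autocorrelation_integrable_pair:
  fixes f :: "'a::euclidean_space \<Rightarrow> complex"
  assumes f: "integrable lborel f"
  shows "integrable (lborel \<Otimes>\<^sub>M lborel) (\<lambda>(x, w). f x * cnj (f (x - w)))"
proof -
  have [measurable]: "f \<in> borel_measurable borel" using f borel_measurable_integrable by fastforce
  note refl = integral_lborel_reflect[OF integrable_norm[OF f]]
  show ?thesis
  proof (rule lborel_pair.Fubini_integrable)
    show "integrable lborel (\<lambda>x. LBINT y. norm (case (x, y) of (x, w) \<Rightarrow> f x * cnj (f (x - w))))"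
      using f by (simp add: norm_mult refl(2))
    show "AE x in lborel. integrable lborel (\<lambda>y. case (x, y) of (x, w) \<Rightarrow> f x * cnj (f (x - w)))"
      using integral_lborel_reflect(1)[OF f] by auto
  qed measurable
qed

lemma fourier_integral_autocorrelation:
  fixes f :: "'a::euclidean_space \<Rightarrow> complex"
  assumes f: "integrable lborel f"
  shows "integrable lborel (autocorrelation f)"
    and "of_real ((2 * pi) powr (- real DIM('a) / 2)) * fourier_integral (autocorrelation f) k
       = of_real ((cmod (fourier_integral f k))\<^sup>2)"
proof -
  show "integrable lborel (autocorrelation f)"
    using lborel_pair.integrable_snd[OF autocorrelation_integrable_pair[OF f]]
    by (simp add: autocorrelation_def[abs_def])
  let ?S = "LINT x|lborel. cis (- (k \<bullet> x)) * f x"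
  have "integrable (lborel \<Otimes>\<^sub>M lborel) (\<lambda>z. cis (- (k \<bullet> snd z)) * (case z of (x, w) \<Rightarrow> f x * cnj (f (x - w))))"
    by (rule integrable_unimodular_mult[OF autocorrelation_integrable_pair[OF f]]) auto
  then have int: "integrable (lborel \<Otimes>\<^sub>M lborel) (\<lambda>(x, w). cis (- (k \<bullet> w)) * (f x * cnj (f (x - w))))"
    by (simp add: case_prod_unfold)
  have inner: "(LINT w|lborel. cis (- (k \<bullet> w)) * (f x * cnj (f (x - w)))) = cis (- (k \<bullet> x)) * f x * cnj ?S" for x
  proof -
    have cint: "integrable lborel (\<lambda>y. cnj (cis (- (k \<bullet> y)) * f y))"
      by (rule integrable_cnj) (rule integrable_cis_mult(2)[OF f])
    have "cis (- (k \<bullet> w)) * (f x * cnj (f (x - w))) =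
        (cis (- (k \<bullet> x)) * f x) * cnj (cis (- (k \<bullet> (x - w))) * f (x - w))" for w
    proof -
      have "cis (- (k \<bullet> w)) = cis (- (k \<bullet> x)) * cnj (cis (- (k \<bullet> (x - w))))"
        by (simp add: cis_cnj cis_mult inner_diff_right)
      then show ?thesis by simp
    qed
    then have "(LINT w|lborel. cis (- (k \<bullet> w)) * (f x * cnj (f (x - w)))) =
        (cis (- (k \<bullet> x)) * f x) * (LINT w|lborel. cnj (cis (- (k \<bullet> (x - w))) * f (x - w)))"
      by (simp only: integral_mult_right_zero)
    also have "(LINT w|lborel. cnj (cis (- (k \<bullet> (x - w))) * f (x - w))) = (LINT y|lborel. cnj (cis (- (k \<bullet> y)) * f y))"
      by (rule integral_lborel_reflect(2)[OF cint])
    also have "\<dots> = cnj ?S" by (rule Bochner_Integration.integral_cnj)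
    finally show ?thesis .
  qed
  have "(LINT w|lborel. cis (- (k \<bullet> w)) * autocorrelation f w) =
      (LINT w|lborel. LINT x|lborel. cis (- (k \<bullet> w)) * (f x * cnj (f (x - w))))"
    by (simp add: autocorrelation_def)
  also have "\<dots> = (LINT x|lborel. LINT w|lborel. cis (- (k \<bullet> w)) * (f x * cnj (f (x - w))))"
    by (rule lborel_pair.Fubini_integral[OF int])
  also have "\<dots> = ?S * cnj ?S" unfolding inner by simp
  also have "\<dots> = of_real ((cmod ?S)\<^sup>2)" by (rule complex_norm_square[symmetric])
  finally show "of_real ((2 * pi) powr (- real DIM('a) / 2)) * fourier_integral (autocorrelation f) k
       = of_real ((cmod (fourier_integral f k))\<^sup>2)"
    by (simp add: fourier_integral_def norm_mult power_mult_distrib power2_eq_square)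
qed

text \<open>
  Boundedness of \<open>f\<close> reduces continuity of the autocorrelation at the origin to continuity of
  translations in \<open>L\<^sup>1\<close>.
\<close>
lemma autocorrelation_bound:
  fixes f :: "'a::euclidean_space \<Rightarrow> complex"
  assumes f: "integrable lborel f" and B: "\<And>x. cmod (f x) \<le> B"
  shows "cmod (autocorrelation f w) \<le> B * (LINT x|lborel. cmod (f x))"
    and "h \<longlonglongrightarrow> 0 \<Longrightarrow> (\<lambda>n. autocorrelation f (h n)) \<longlonglongrightarrow> autocorrelation f 0"
proof -
  have prod: "integrable lborel (\<lambda>x. f x * cnj (g x))" 
    "cmod (LINT x|lborel. f x * cnj (g x)) \<le> B * (LINT x|lborel. cmod (g x))"
    if g: "integrable lborel g" for g
  proof -
    have [measurable]: "f \<in> borel_measurable borel" "g \<in> borel_measurable borel"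
      using f g borel_measurable_integrable by fastforce+
    have le: "cmod (f x * cnj (g x)) \<le> B * cmod (g x)" for x
      using mult_right_mono[OF B[of x], of "cmod (g x)"] by (simp add: norm_mult)
    have intB: "integrable lborel (\<lambda>x. B * cmod (g x))" using g by simp
    have "norm (f x * cnj (g x)) \<le> norm (B * cmod (g x))" for x
      using le[of x] abs_ge_self[of "B * cmod (g x)"] by simp
    then show int: "integrable lborel (\<lambda>x. f x * cnj (g x))"
      by (intro Bochner_Integration.integrable_bound[OF intB]) auto
    have "cmod (LINT x|lborel. f x * cnj (g x)) \<le> (LINT x|lborel. cmod (f x * cnj (g x)))"
      by (rule integral_norm_bound)
    also have "\<dots> \<le> (LINT x|lborel. B * cmod (g x))"
      using int le intB by (intro integral_mono) auto
    finally show "cmod (LINT x|lborel. f x * cnj (g x)) \<le> B * (LINT x|lborel. cmod (g x))" by simp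
  qed
  have sh: "integrable lborel (\<lambda>x. f (x - w))" for w
    using integrable_lborel_shift[OF f, of "-w"] by simp
  show "cmod (autocorrelation f w) \<le> B * (LINT x|lborel. cmod (f x))"
    using prod(2)[OF sh[of w]] integral_lborel_shift[OF integrable_norm[OF f], of "-w"]
    by (simp add: autocorrelation_def)
  assume h: "h \<longlonglongrightarrow> 0"
  have "(\<lambda>n. LINT x|lborel. cmod (f (x - h n) - f x)) \<longlonglongrightarrow> 0"
    using L1_translation_tendsto[OF f tendsto_minus[OF h, simplified]] by simp
  then have lim: "(\<lambda>n. B * (LINT x|lborel. cmod (f (x - h n) - f x))) \<longlonglongrightarrow> 0"
    by (rule tendsto_mult_right_zero)
  have "(\<lambda>n. autocorrelation f (h n) - autocorrelation f 0) \<longlonglongrightarrow> 0"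
  proof (rule Lim_null_comparison[OF _ lim], rule always_eventually, rule allI)
    fix n
    have "autocorrelation f (h n) - autocorrelation f 0 =
        (LINT x|lborel. f x * cnj (f (x - h n) - f x))"
      using prod(1)[OF sh[of "h n"]] prod(1)[OF f]
      by (simp add: autocorrelation_def right_diff_distrib)
    then show "norm (autocorrelation f (h n) - autocorrelation f 0) \<le> B * (LINT x|lborel. cmod (f (x - h n) - f x))"
      using prod(2)[of "\<lambda>x. f (x - h n) - f x"] sh f by simp
  qed
  then show "(\<lambda>n. autocorrelation f (h n)) \<longlonglongrightarrow> autocorrelation f 0" by (simp add: LIM_zero_iff)
qed

lemma bounded_integrable_L2:
  assumes f: "integrable lborel f" and B: "\<And>x. cmod (f x) \<le> B"
  shows "f \<in> L2"
proof -
  have [measurable]: "f \<in> borel_measurable borel" using f borel_measurable_integrable by fastforce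
  have "integrable lborel (\<lambda>x. (cmod (f x))\<^sup>2)"
  proof (rule Bochner_Integration.integrable_bound)
    show "integrable lborel (\<lambda>x. B * cmod (f x))" using f by simp
    have "norm ((cmod (f x))\<^sup>2) \<le> norm (B * cmod (f x))" for x
      using mult_right_mono[OF B[of x], of "cmod (f x)"] abs_ge_self[of "B * cmod (f x)"]
      by (simp add: power2_eq_square)
    then show "AE x in lborel. norm ((cmod (f x))\<^sup>2) \<le> norm (B * cmod (f x))" by simp
  qed simp
  then show ?thesis by (simp add: L2_def)
qed

text \<open>
  Weighting \<open>|f\<^sup>^|\<^sup>2\<close> by a Gaussian and moving the transform onto that Gaussian turns the integral into
  an average of the autocorrelation of \<open>f\<close> near the origin, whose value there is \<open>\<parallel>f\<parallel>\<^sup>2\<close>.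
\<close>
lemma gaussian_regularized_plancherel:
  fixes f :: "'a::euclidean_space \<Rightarrow> complex"
  assumes f: "integrable lborel f" and B: "\<And>x. cmod (f x) \<le> B" and t: "t > 0"
  defines "c \<equiv> (2 * pi) powr (- real DIM('a) / 2)"
  shows "(\<integral>\<^sup>+k. ennreal ((cmod (fourier_integral f k))\<^sup>2 * exp (- t\<^sup>2 * (norm k)\<^sup>2 / 2)) \<partial>lborel) =
     ennreal (Re (LINT z|lborel. autocorrelation f (t *\<^sub>R z) * of_real (c * exp (- (norm z)\<^sup>2 / 2))))"
proof -
  let ?h = "autocorrelation f"
  let ?G = "\<lambda>x::'a. exp (- t\<^sup>2 * (norm x)\<^sup>2 / 2)"
  have [measurable]: "f \<in> borel_measurable borel" using f borel_measurable_integrable by fastforce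
  note h = fourier_integral_autocorrelation[OF f]
  note G = fourier_integral_gaussian[OF t, where 'a='a]
  let ?C = "(c * (LINT x|lborel. cmod (f x)))\<^sup>2"
  have bound: "(cmod (fourier_integral f k))\<^sup>2 \<le> ?C" for k
    unfolding c_def by (intro power_mono fourier_integral_bound) auto
  have Gr: "integrable lborel ?G" using integrable_Re[OF G(1)] by simp
  have int: "integrable lborel (\<lambda>k. (cmod (fourier_integral f k))\<^sup>2 * ?G k)"
  proof (rule Bochner_Integration.integrable_bound)
    show "integrable lborel (\<lambda>k. ?C * ?G k)" using Gr by simp
    show "AE k in lborel. norm ((cmod (fourier_integral f k))\<^sup>2 * ?G k) \<le> norm (?C * ?G k)"
      using bound by (auto simp: abs_mult intro!: mult_right_mono)
  qed simp
  have "complex_of_real (LINT k|lborel. (cmod (fourier_integral f k))\<^sup>2 * ?G k) =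
      (LINT k|lborel. complex_of_real ((cmod (fourier_integral f k))\<^sup>2) * of_real (?G k))"
    by (simp flip: integral_complex_of_real)
  also have "\<dots> = (LINT k|lborel. of_real c * (fourier_integral ?h k * of_real (?G k)))"
    unfolding h(2)[symmetric] c_def by (simp add: mult.assoc)
  also have "\<dots> = of_real c * (LINT k|lborel. fourier_integral ?h k * of_real (?G k))"
    by (rule integral_mult_right_zero)
  also have "(LINT k|lborel. fourier_integral ?h k * of_real (?G k)) =
      (LINT w|lborel. ?h w * of_real (exp (- (norm w)\<^sup>2 / (2 * t\<^sup>2)) / t ^ DIM('a)))" (is "_ = (LINT w|lborel. ?I w)")
    using fourier_integral_multiplication[OF h(1) G(1)] by (simp only: G(2))
  also have "of_real c * \<dots> = (LINT z|lborel. ?h (t *\<^sub>R z) * of_real (c * exp (- (norm z)\<^sup>2 / 2)))"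
  proof -
    have "integrable lborel ?I"
    proof (rule Bochner_Integration.integrable_bound)
      show "integrable lborel (\<lambda>w. ?h w * of_real (1 / t ^ DIM('a)))" using h(1) by simp
      show "AE w in lborel. norm (?I w) \<le> norm (?h w * of_real (1 / t ^ DIM('a)))"
      proof (rule AE_I2)
        fix w :: 'a
        have "exp (- (norm w)\<^sup>2 / (2 * t\<^sup>2)) / t ^ DIM('a) \<le> 1 / t ^ DIM('a)"
          using t by (intro divide_right_mono) auto
        then show "norm (?I w) \<le> norm (?h w * of_real (1 / t ^ DIM('a)))"
          using t by (simp only: norm_mult norm_of_real) (intro mult_left_mono, auto)
      qed
      have [measurable]: "?h \<in> borel_measurable borel" using h(1) borel_measurable_integrable by fastforce
      show "?I \<in> borel_measurable lborel" by measurable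
    qed
    from integral_lborel_affine[OF this, of t 0] t
    have "(LINT w|lborel. ?I w) = (t ^ DIM('a)) *\<^sub>R (LINT z|lborel. ?I (0 + t *\<^sub>R z))" by simp
    also have "\<dots> = (LINT z|lborel. of_real (t ^ DIM('a)) * ?I (0 + t *\<^sub>R z))"
      by (simp only: scaleR_conv_of_real integral_mult_right_zero)
    finally have eq: "(LINT w|lborel. ?I w) = (LINT z|lborel. of_real (t ^ DIM('a)) * ?I (0 + t *\<^sub>R z))" .
    have "of_real c * (of_real (t ^ DIM('a)) * ?I (0 + t *\<^sub>R z)) = ?h (t *\<^sub>R z) * of_real (c * exp (- (norm z)\<^sup>2 / 2))" for z
      using t by (simp add: power_mult_distrib)
    then show ?thesis unfolding eq by (simp only: integral_mult_right_zero[symmetric])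
  qed
  finally have "complex_of_real (LINT k|lborel. (cmod (fourier_integral f k))\<^sup>2 * ?G k) =
     (LINT z|lborel. ?h (t *\<^sub>R z) * of_real (c * exp (- (norm z)\<^sup>2 / 2)))" .
  from arg_cong[OF this, of Re]
  have "(LINT k|lborel. (cmod (fourier_integral f k))\<^sup>2 * ?G k) =
     Re (LINT z|lborel. ?h (t *\<^sub>R z) * of_real (c * exp (- (norm z)\<^sup>2 / 2)))"
    by (simp only: Re_complex_of_real)
  then show ?thesis by (subst nn_integral_eq_integral[OF int]) auto
qed

lemma plancherel_bounded:
  fixes f :: "'a::euclidean_space \<Rightarrow> complex"
  assumes f: "integrable lborel f" and B: "\<And>x. cmod (f x) \<le> B"
  shows "(\<integral>\<^sup>+k. ennreal ((cmod (fourier_integral f k))\<^sup>2) \<partial>lborel) = ennreal ((L2norm f)\<^sup>2)"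
proof -
  let ?h = "autocorrelation f"
  let ?g = "\<lambda>z::'a. (2 * pi) powr (- real DIM('a) / 2) * exp (- (norm z)\<^sup>2 / 2)"
  let ?t = "\<lambda>n. 1 / real (Suc n)"
  let ?L = "\<lambda>n k. (cmod (fourier_integral f k))\<^sup>2 * exp (- (?t n)\<^sup>2 * (norm k)\<^sup>2 / 2)"
  have [measurable]: "f \<in> borel_measurable borel" using f borel_measurable_integrable by fastforce
  have h_meas [measurable]: "?h \<in> borel_measurable borel"
    using fourier_integral_autocorrelation(1)[OF f] borel_measurable_integrable by fastforce
  have t0: "?t \<longlonglongrightarrow> 0" by (rule LIMSEQ_Suc[OF lim_1_over_n])
  have 1: "(\<lambda>n. \<integral>\<^sup>+k. ennreal (?L n k) \<partial>lborel) \<longlonglongrightarrow> (\<integral>\<^sup>+k. ennreal ((cmod (fourier_integral f k))\<^sup>2) \<partial>lborel)"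
  proof (rule nn_integral_LIMSEQ)
    show "incseq (\<lambda>n k. ennreal (?L n k))"
      unfolding incseq_def le_fun_def
      by (intro allI impI ennreal_leI mult_left_mono)
         (auto intro!: divide_right_mono mult_right_mono power_mono divide_left_mono)
    fix k
    have "(\<lambda>n. ?L n k) \<longlonglongrightarrow> (cmod (fourier_integral f k))\<^sup>2 * exp (- 0\<^sup>2 * (norm k)\<^sup>2 / 2)"
      by (intro tendsto_intros t0) simp
    then show "(\<lambda>n. ennreal (?L n k)) \<longlonglongrightarrow> ennreal ((cmod (fourier_integral f k))\<^sup>2)"
      by (intro tendsto_ennrealI) simp
  qed measurable
  have "(\<lambda>n. LINT z|lborel. ?h (?t n *\<^sub>R z) * of_real (?g z)) \<longlonglongrightarrow> (LINT z|lborel. ?h 0 * of_real (?g z))"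
  proof (rule integral_dominated_convergence)
    show "integrable lborel (\<lambda>z. (B * (LINT x|lborel. cmod (f x))) * ?g z)"
      by (intro integrable_mult_right integrable_gaussian(1))
    show "AE z in lborel. (\<lambda>n. ?h (?t n *\<^sub>R z) * of_real (?g z)) \<longlonglongrightarrow> ?h 0 * of_real (?g z)"
    proof (rule AE_I2)
      fix z :: 'a
      have "(\<lambda>n. ?t n *\<^sub>R z) \<longlonglongrightarrow> 0" using tendsto_scaleR[OF t0 tendsto_const] by simp
      then show "(\<lambda>n. ?h (?t n *\<^sub>R z) * of_real (?g z)) \<longlonglongrightarrow> ?h 0 * of_real (?g z)"
        by (intro tendsto_mult_right autocorrelation_bound(2)[OF f B])
    qed
    show "AE z in lborel. norm (?h (?t n *\<^sub>R z) * of_real (?g z)) \<le> (B * (LINT x|lborel. cmod (f x))) * ?g z" for n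
      using autocorrelation_bound(1)[OF f B] by (auto simp: norm_mult simp del: of_real_mult intro!: mult_right_mono)
  qed (measurable)
  then have "(\<lambda>n. ennreal (Re (LINT z|lborel. ?h (?t n *\<^sub>R z) * of_real (?g z)))) \<longlonglongrightarrow>
      ennreal (Re (LINT z|lborel. ?h 0 * of_real (?g z)))"
    by (intro tendsto_ennrealI tendsto_Re)
  also have "(LINT z|lborel. ?h 0 * of_real (?g z)) = ?h 0"
  proof -
    have "(LINT z|lborel. complex_of_real (?g z)) = 1"
      by (simp only: integral_complex_of_real integrable_gaussian(2)) simp
    then show ?thesis by (simp only: integral_mult_right_zero) simp
  qed
  also have "?h 0 = of_real ((L2norm f)\<^sup>2)"
    by (simp add: autocorrelation_def L2norm_square complex_norm_square[symmetric] del: of_real_power)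
  finally have 2: "(\<lambda>n. \<integral>\<^sup>+k. ennreal (?L n k) \<partial>lborel) \<longlonglongrightarrow> ennreal ((L2norm f)\<^sup>2)"
    using gaussian_regularized_plancherel[OF f B, of "?t _"] by simp
  show ?thesis by (rule LIMSEQ_unique[OF 1 2])
qed

lemma L2_dominated_convergence:
  fixes g :: "'a::euclidean_space \<Rightarrow> complex"
  assumes [measurable]: "\<And>n. f n \<in> borel_measurable borel" "g \<in> borel_measurable borel"
    and lim: "AE x in lborel. (\<lambda>n. f n x) \<longlonglongrightarrow> g x"
    and le: "\<And>n. AE x in lborel. cmod (f n x) \<le> cmod (F x)" and F: "F \<in> L2"
  shows "(\<lambda>n. L2norm (\<lambda>x. f n x - g x)) \<longlonglongrightarrow> 0"
proof -
  have "AE x in lborel. \<forall>n. cmod (f n x) \<le> cmod (F x)" using le by (simp add: AE_all_countable)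
  with lim have both: "AE x in lborel. (\<lambda>n. f n x) \<longlonglongrightarrow> g x \<and> (\<forall>n. cmod (f n x) \<le> cmod (F x)) \<and> cmod (g x) \<le> cmod (F x)"
  proof eventually_elim
    case (elim x)
    then have "cmod (g x) \<le> cmod (F x)" by (intro LIMSEQ_le_const2[OF tendsto_norm[of _ "g x"]]) auto
    with elim show ?case by blast
  qed
  have "(\<lambda>n. LINT x|lborel. (cmod (f n x - g x))\<^sup>2) \<longlonglongrightarrow> (LINT x|(lborel::'a measure). (0::real))"
  proof (rule integral_dominated_convergence[where w="\<lambda>x. 4 * (cmod (F x))\<^sup>2"])
    show "AE x in lborel. (\<lambda>n. (cmod (f n x - g x))\<^sup>2) \<longlonglongrightarrow> 0"
      using both by eventually_elim (auto intro!: tendsto_eq_intros simp: LIM_zero_iff)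
    show "AE x in lborel. norm ((cmod (f n x - g x))\<^sup>2) \<le> 4 * (cmod (F x))\<^sup>2" for n
      using both
    proof eventually_elim
      case (elim x)
      have "cmod (f n x - g x) \<le> cmod (F x) + cmod (F x)"
        using elim norm_triangle_ineq4[of "f n x" "g x"] by (meson add_mono order_trans)
      then have "(cmod (f n x - g x))\<^sup>2 \<le> (2 * cmod (F x))\<^sup>2" by (intro power_mono) auto
      then show ?case by (simp add: power_mult_distrib)
    qed
  qed (use L2_integrable[OF F] in auto)
  then have "(\<lambda>n. sqrt (LINT x|lborel. (cmod (f n x - g x))\<^sup>2)) \<longlonglongrightarrow> sqrt 0"
    by (intro tendsto_real_sqrt) simp
  then show ?thesis by (simp add: L2norm_def)
qed

text \<open>
  Truncating \<open>f\<close> at height \<open>n\<close> converges in \<open>L\<^sup>1\<close>, so the transforms converge pointwise, and Fatou's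
  lemma gives one inequality for every such \<open>f\<close>. Applied to the part cut off, that inequality shows
  that the transforms also converge in \<open>L\<^sup>2\<close>, which gives equality.
\<close>
lemma plancherel_L1_L2:
  fixes f :: "'a::euclidean_space \<Rightarrow> complex"
  assumes "integrable lborel f" "f \<in> L2"
  shows "fourier_integral f \<in> L2" "L2norm (fourier_integral f) = L2norm f"
proof -
  define cut :: "('a \<Rightarrow> complex) \<Rightarrow> nat \<Rightarrow> 'a \<Rightarrow> complex" where
    "cut f n x = (if cmod (f x) \<le> real n then f x else 0)" for f n x
  have meas: "f \<in> borel_measurable borel" if "integrable lborel f" for f :: "'a \<Rightarrow> complex"
    using that borel_measurable_integrable by fastforce
  have cut_meas: "cut f n \<in> borel_measurable borel" if "f \<in> borel_measurable borel" for f n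
    unfolding cut_def[abs_def] using that by measurable
  have cut_int: "integrable lborel (cut f n)" if "integrable lborel f" for f n
    by (rule Bochner_Integration.integrable_bound[OF that]) (use cut_meas[OF meas[OF that]] in \<open>auto simp: cut_def\<close>)
  have cut_bound: "cmod (cut f n x) \<le> real n" for f n x by (auto simp: cut_def)
  have cut_le: "cmod (cut f n x) \<le> cmod (f x)" for f n x by (auto simp: cut_def)
  have cut_L2: "cut f n \<in> L2" if "integrable lborel f" for f n
    by (rule bounded_integrable_L2[OF cut_int[OF that] cut_bound])
  have cut_lim: "(\<lambda>n. cut f n x) \<longlonglongrightarrow> f x" for f x
  proof (rule tendsto_eventually)
    obtain N where "cmod (f x) \<le> real N" using real_arch_simple by blast
    then show "\<forall>\<^sub>F n in sequentially. cut f n x = f x"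
      unfolding eventually_sequentially by (intro exI[of _ N]) (auto simp: cut_def)
  qed
  have cut_norm: "L2norm (cut f n) \<le> L2norm f" if "integrable lborel f" "f \<in> L2" for f n
    using L2_bounded(2)[OF that(2) cut_meas[OF meas[OF that(1)]], of n 1] cut_le[of f n] by simp
  have upper: "(\<integral>\<^sup>+k. ennreal ((cmod (fourier_integral f k))\<^sup>2) \<partial>lborel) \<le> ennreal ((L2norm f)\<^sup>2)"
    if f: "integrable lborel f" "f \<in> L2" for f :: "'a \<Rightarrow> complex"
  proof (rule nn_integral_Fatou_bound[where b="\<lambda>n. (L2norm f)\<^sup>2"])
    note [measurable] = cut_meas[OF meas[OF f(1)]]
    show "(\<lambda>k. ennreal ((cmod (fourier_integral (cut f n) k))\<^sup>2)) \<in> borel_measurable lborel" for n by measurable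
    have "(\<lambda>n. fourier_integral (cut f n) k) \<longlonglongrightarrow> fourier_integral f k" for k
      unfolding fourier_integral_def
    proof (intro tendsto_mult_left integral_dominated_convergence[where w="\<lambda>x. cmod (f x)"])
      show "AE x in lborel. (\<lambda>n. cis (- (k \<bullet> x)) * cut f n x) \<longlonglongrightarrow> cis (- (k \<bullet> x)) * f x"
        by (intro AE_I2 tendsto_mult_left cut_lim)
    qed (use f cut_le meas[OF f(1)] in \<open>auto simp: norm_mult\<close>)
    then show "AE k in lborel. (\<lambda>n. ennreal ((cmod (fourier_integral (cut f n) k))\<^sup>2)) \<longlonglongrightarrow> ennreal ((cmod (fourier_integral f k))\<^sup>2)"
      by (intro AE_I2 tendsto_ennrealI tendsto_power tendsto_norm)
    show "(\<integral>\<^sup>+k. ennreal ((cmod (fourier_integral (cut f n) k))\<^sup>2) \<partial>lborel) \<le> ennreal ((L2norm f)\<^sup>2)" for n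
      unfolding plancherel_bounded[OF cut_int[OF f(1)] cut_bound]
      by (intro ennreal_leI power_mono cut_norm f) auto
  qed auto
  have ft_meas: "fourier_integral g \<in> borel_measurable borel" if "integrable lborel g" for g :: "'a \<Rightarrow> complex"
    using meas[OF that] by measurable
  have ft_L2: "fourier_integral f \<in> L2" and ft_le: "L2norm (fourier_integral f) \<le> L2norm f"
    if f: "integrable lborel f" "f \<in> L2" for f :: "'a \<Rightarrow> complex"
    using L2_I[OF ft_meas[OF f(1)] upper[OF f]] L2norm_le_I[OF ft_meas[OF f(1)] upper[OF f]] by auto
  show ft: "fourier_integral f \<in> L2" by (rule ft_L2[OF assms])
  have cut_tends: "(\<lambda>n. L2norm (\<lambda>x. cut f n x - f x)) \<longlonglongrightarrow> 0"
    by (rule L2_dominated_convergence[OF _ _ _ _ assms(2)])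
       (use cut_meas[OF meas[OF assms(1)]] meas[OF assms(1)] cut_lim cut_le in auto)
  have "(\<lambda>n. L2norm (fourier_integral (cut f n))) \<longlonglongrightarrow> L2norm (fourier_integral f)"
  proof (rule L2norm_tendsto[OF ft_L2 ft])
    show "(\<lambda>n. L2norm (\<lambda>k. fourier_integral (cut f n) k - fourier_integral f k)) \<longlonglongrightarrow> 0"
    proof (rule Lim_null_comparison[OF _ cut_tends], rule always_eventually, rule allI)
      fix n
      have "L2norm (fourier_integral (\<lambda>x. cut f n x - f x)) \<le> L2norm (\<lambda>x. cut f n x - f x)"
        using cut_int[OF assms(1)] cut_L2[OF assms(1)] assms by (intro ft_le L2_diff) auto
      also have "fourier_integral (\<lambda>x. cut f n x - f x) = (\<lambda>k. fourier_integral (cut f n) k - fourier_integral f k)"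
        by (rule ext) (rule fourier_integral_diff[OF cut_int[OF assms(1)] assms(1)])
      finally show "norm (L2norm (\<lambda>k. fourier_integral (cut f n) k - fourier_integral f k)) \<le> L2norm (\<lambda>x. cut f n x - f x)"
        by simp
    qed
  qed (use cut_int cut_L2 assms in auto)
  moreover have "L2norm (fourier_integral (cut f n)) = L2norm (cut f n)" for n
  proof -
    have "ennreal ((L2norm (fourier_integral (cut f n)))\<^sup>2) = ennreal ((L2norm (cut f n))\<^sup>2)"
      using plancherel_bounded[OF cut_int[OF assms(1)] cut_bound, of n]
      by (subst nn_integral_L2[OF ft_L2[OF cut_int[OF assms(1)] cut_L2[OF assms(1)]], symmetric])
    then show ?thesis by simp
  qed
  moreover have "(\<lambda>n. L2norm (cut f n)) \<longlonglongrightarrow> L2norm f"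
    by (rule L2norm_tendsto[OF cut_L2[OF assms(1)] assms(2) cut_tends])
  ultimately show "L2norm (fourier_integral f) = L2norm f" using LIMSEQ_unique by simp
qed

section \<open>The Fourier transform of square-integrable functions\<close>

definition ball_cut :: "('a::euclidean_space \<Rightarrow> complex) \<Rightarrow> real \<Rightarrow> 'a \<Rightarrow> complex" where
  "ball_cut u R x = indicator (cball 0 R) x * u x"

lemma truncated_fourier_eq: "truncated_fourier u R = fourier_integral (ball_cut u R)"
proof
  fix k
  have "indicat_real (cball 0 R) x *\<^sub>R (cis (- (k \<bullet> x)) * u x) = cis (- (k \<bullet> x)) * ball_cut u R x" for x
    by (simp add: ball_cut_def indicator_def)
  then show "truncated_fourier u R k = fourier_integral (ball_cut u R) k"
    unfolding truncated_fourier_def fourier_integral_def set_lebesgue_integral_def by (simp only:)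
qed

lemma LIMSEQ_null_le:
  fixes f g :: "nat \<Rightarrow> real"
  assumes "\<And>n. 0 \<le> f n" "\<And>n. f n \<le> g n" "g \<longlonglongrightarrow> 0"
  shows "f \<longlonglongrightarrow> 0"
  by (rule Lim_null_comparison[OF _ assms(3)]) (use assms in auto)

lemma L2_indicator_set:
  fixes A :: "'a::euclidean_space set"
  assumes "A \<in> sets borel" "emeasure lborel A < \<infinity>"
  shows "indicator A \<in> L2" "(L2norm (indicator A))\<^sup>2 = measure lborel A"
proof -
  have eq: "(cmod (indicator A x))\<^sup>2 = indicat_real A x" for x by (simp add: indicator_def)
  have "integrable lborel (\<lambda>x. (cmod (indicator A x))\<^sup>2)" unfolding eq using assms by auto
  then show "indicator A \<in> L2" using assms by (simp add: L2_def)
  show "(L2norm (indicator A))\<^sup>2 = measure lborel A" unfolding L2norm_square eq using assms by simp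
qed

lemma L2_set_integrable:
  assumes "u \<in> L2" "A \<in> sets borel" "emeasure lborel A < \<infinity>"
  shows "integrable lborel (\<lambda>x. indicator A x * u x)"
    "(LINT x|lborel. cmod (indicator A x * u x)) \<le> sqrt (measure lborel A) * L2norm u"
proof -
  note [measurable] = L2_measurable[OF assms(1)] assms(2)
  note I = L2_indicator_set[OF assms(2,3)]
  note CS = Cauchy_Schwarz_L2[OF I(1) assms(1)]
  show "integrable lborel (\<lambda>x. indicator A x * u x)"
    by (rule Bochner_Integration.integrable_bound[OF CS(1)]) (auto simp: norm_mult)
  have "L2norm (indicator A) = sqrt (measure lborel A)"
    unfolding I(2)[symmetric] by simp
  then show "(LINT x|lborel. cmod (indicator A x * u x)) \<le> sqrt (measure lborel A) * L2norm u"
    using CS(2) by (simp add: norm_mult)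
qed

lemma emeasure_cball_finite: "emeasure lborel (cball (c::'a::euclidean_space) r) < \<infinity>"
  using emeasure_bounded_finite[OF bounded_cball] by auto

text \<open>
  These truncations are the integrable approximations in the definition of the transform.
\<close>
lemma ball_cut_props:
  fixes u :: "'a::euclidean_space \<Rightarrow> complex"
  assumes u: "u \<in> L2"
  shows "integrable lborel (ball_cut u R)" "ball_cut u R \<in> L2"
    and "filterlim X at_top sequentially \<Longrightarrow> (\<lambda>n. L2norm (\<lambda>x. ball_cut u (X n) x - u x)) \<longlonglongrightarrow> 0"
proof -
  show "integrable lborel (ball_cut u R)"
    unfolding ball_cut_def[abs_def] by (rule L2_set_integrable(1)[OF u _ emeasure_cball_finite]) simp
  show L: "ball_cut u R \<in> L2" for R
    unfolding ball_cut_def[abs_def] by (rule L2_indicator(1)[OF u]) simp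
  assume X: "filterlim X at_top sequentially"
  show "(\<lambda>n. L2norm (\<lambda>x. ball_cut u (X n) x - u x)) \<longlonglongrightarrow> 0"
  proof (rule L2_dominated_convergence[OF _ _ _ _ u])
    show "AE x in lborel. (\<lambda>n. ball_cut u (X n) x) \<longlonglongrightarrow> u x"
    proof (rule AE_I2)
      fix x :: 'a
      have "\<forall>\<^sub>F n in sequentially. norm x \<le> X n" using X filterlim_at_top by blast
      then have "\<forall>\<^sub>F n in sequentially. ball_cut u (X n) x = u x"
        by eventually_elim (auto simp: ball_cut_def)
      then show "(\<lambda>n. ball_cut u (X n) x) \<longlonglongrightarrow> u x" by (rule tendsto_eventually)
    qed
    show "AE x in lborel. cmod (ball_cut u (X n) x) \<le> cmod (u x)" for n
      by (auto simp: ball_cut_def indicator_def)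
  qed (rule L2_measurable[OF L] L2_measurable[OF u])+
qed

lemma plancherel_diff:
  assumes "integrable lborel f" "f \<in> L2" "integrable lborel g" "g \<in> L2"
  shows "L2norm (\<lambda>k. fourier_integral f k - fourier_integral g k) = L2norm (\<lambda>x. f x - g x)"
proof -
  have "(\<lambda>k. fourier_integral f k - fourier_integral g k) = fourier_integral (\<lambda>x. f x - g x)"
    by (rule ext) (rule fourier_integral_diff[OF assms(1,3), symmetric])
  then show ?thesis using plancherel_L1_L2(2)[of "\<lambda>x. f x - g x"] assms L2_diff(1)[OF assms(2,4)] by simp
qed

lemma L2_convergent_imp_Cauchy:
  assumes "\<And>n. f n \<in> L2" "g \<in> L2" "(\<lambda>n. L2norm (\<lambda>x. f n x - g x)) \<longlonglongrightarrow> 0" "0 < e"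
  shows "\<exists>M. \<forall>m\<ge>M. \<forall>n\<ge>M. L2norm (\<lambda>x. f m x - f n x) \<le> e"
proof -
  from order_tendstoD(2)[OF assms(3), of "e/2"] \<open>0 < e\<close> obtain M where
    M: "\<And>n. n \<ge> M \<Longrightarrow> L2norm (\<lambda>x. f n x - g x) < e/2" by (auto simp: eventually_sequentially)
  have "L2norm (\<lambda>x. f m x - f n x) \<le> e" if "m \<ge> M" "n \<ge> M" for m n
    using L2norm_triangle_diff[OF assms(1) assms(2) assms(1), of m n] M[OF that(1)] M[OF that(2)]
      L2norm_commute[of g "f n"] by simp
  then show ?thesis by blast
qed

text \<open>
  By the isometry for integrable functions the truncated transforms are a Cauchy family in \<open>L\<^sup>2\<close>. The
  limit along integer radii is the limit along all radii, because the error at radius \<open>R\<close> is bounded by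
  the norm of \<open>u\<close> outside that ball.
\<close>
lemma is_fourier_ex:
  assumes u: "u \<in> L2"
  shows "\<exists>g. is_fourier u g"
proof -
  note b = ball_cut_props[OF u]
  let ?F = "\<lambda>R. fourier_integral (ball_cut u R)"
  have F: "?F R \<in> L2" for R by (rule plancherel_L1_L2(1)[OF b(1,2)])
  have dist: "L2norm (\<lambda>k. ?F R k - ?F S k) = L2norm (\<lambda>x. ball_cut u R x - ball_cut u S x)" for R S
    by (rule plancherel_diff[OF b(1,2) b(1,2)])
  have "\<exists>M. \<forall>m\<ge>M. \<forall>n\<ge>M. L2norm (\<lambda>k. ?F (real m) k - ?F (real n) k) \<le> e" if "0 < e" for e
    unfolding dist by (rule L2_convergent_imp_Cauchy[OF b(2) u b(3)[OF filterlim_real_sequentially] that])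
  with F obtain g where g: "g \<in> L2" "(\<lambda>n. L2norm (\<lambda>k. ?F (real n) k - g k)) \<longlonglongrightarrow> 0"
    using L2_complete[of "\<lambda>n. ?F (real n)"] by blast
  have le: "L2norm (\<lambda>k. ?F R k - g k) \<le> L2norm (\<lambda>x. ball_cut u R x - u x)" for R
  proof -
    have "L2norm (\<lambda>k. ?F R k - g k) \<le> L2norm (\<lambda>x. ball_cut u R x - u x)
        + L2norm (\<lambda>x. ball_cut u (real n) x - u x) + L2norm (\<lambda>k. ?F (real n) k - g k)" for n
      using L2norm_triangle_diff[OF F F g(1), of R "real n"] dist[of R "real n"]
        L2norm_triangle_diff[OF b(2) u b(2), of R "real n"] L2norm_commute[of u "ball_cut u (real n)"] by simp
    moreover have "(\<lambda>n. L2norm (\<lambda>x. ball_cut u R x - u x)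
        + L2norm (\<lambda>x. ball_cut u (real n) x - u x) + L2norm (\<lambda>k. ?F (real n) k - g k)) \<longlonglongrightarrow>
        L2norm (\<lambda>x. ball_cut u R x - u x) + 0 + 0"
      by (intro tendsto_add tendsto_const g b(3) filterlim_real_sequentially)
    ultimately show ?thesis by (intro LIMSEQ_le_const) auto
  qed
  have "((\<lambda>R. \<integral>\<^sup>+ k. ennreal ((cmod (truncated_fourier u R k - g k))\<^sup>2) \<partial>lborel) \<longlongrightarrow> 0) at_top"
  proof (rule tendsto_at_topI_sequentially)
    fix X :: "nat \<Rightarrow> real" assume X: "filterlim X at_top sequentially"
    have "(\<lambda>n. L2norm (\<lambda>k. ?F (X n) k - g k)) \<longlonglongrightarrow> 0"
      by (rule Lim_null_comparison[OF _ b(3)[OF X]]) (use le in auto)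
    then have "(\<lambda>n. ennreal ((L2norm (\<lambda>k. ?F (X n) k - g k))\<^sup>2)) \<longlonglongrightarrow> ennreal (0\<^sup>2)"
      by (intro tendsto_ennrealI tendsto_power)
    then show "(\<lambda>n. \<integral>\<^sup>+ k. ennreal ((cmod (truncated_fourier u (X n) k - g k))\<^sup>2) \<partial>lborel) \<longlonglongrightarrow> 0"
      by (simp add: truncated_fourier_eq nn_integral_L2[OF L2_diff(1)[OF F g(1)]])
  qed
  then show ?thesis using g(1) unfolding is_fourier_def by blast
qed

lemma fourier_spec:
  assumes u: "u \<in> L2"
  shows "fourier u \<in> L2"
    "(\<lambda>n. L2norm (\<lambda>k. fourier_integral (ball_cut u (real n)) k - fourier u k)) \<longlonglongrightarrow> 0"
proof -
  have isf: "is_fourier u (fourier u)" unfolding fourier_def using someI_ex[OF is_fourier_ex[OF u]] .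
  show L: "fourier u \<in> L2" using isf by (simp add: is_fourier_def)
  note b = ball_cut_props[OF u]
  have "(\<lambda>n. \<integral>\<^sup>+ k. ennreal ((cmod (truncated_fourier u (real n) k - fourier u k))\<^sup>2) \<partial>lborel) \<longlonglongrightarrow> 0"
    using isf unfolding is_fourier_def by (auto intro: filterlim_compose[OF _ filterlim_real_sequentially])
  then have "(\<lambda>n. ennreal ((L2norm (\<lambda>k. fourier_integral (ball_cut u (real n)) k - fourier u k))\<^sup>2)) \<longlonglongrightarrow> ennreal 0"
    by (simp add: truncated_fourier_eq nn_integral_L2[OF L2_diff(1)[OF plancherel_L1_L2(1)[OF b(1,2)] L]])
  then have "(\<lambda>n. (L2norm (\<lambda>k. fourier_integral (ball_cut u (real n)) k - fourier u k))\<^sup>2) \<longlonglongrightarrow> 0"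
    by (subst (asm) tendsto_ennreal_iff) auto
  from tendsto_real_sqrt[OF this]
  show "(\<lambda>n. L2norm (\<lambda>k. fourier_integral (ball_cut u (real n)) k - fourier u k)) \<longlonglongrightarrow> 0" by simp
qed

text \<open>
  Balls may be replaced by any approximation in \<open>L\<^sup>2\<close> by integrable functions. This and the next
  lemma serve to identify transforms, by passing to the limit in identities for Fourier integrals.
\<close>
lemma fourier_limit:
  assumes u: "u \<in> L2" and f: "\<And>n. integrable lborel (f n)" "\<And>n. f n \<in> L2"
    and lim: "(\<lambda>n. L2norm (\<lambda>x. f n x - u x)) \<longlonglongrightarrow> 0"
  shows "(\<lambda>n. L2norm (\<lambda>k. fourier_integral (f n) k - fourier u k)) \<longlonglongrightarrow> 0"
proof -
  note b = ball_cut_props[OF u]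
  note s = fourier_spec[OF u]
  let ?b = "\<lambda>n. ball_cut u (real n)"
  have "(\<lambda>n. L2norm (\<lambda>x. f n x - u x) + L2norm (\<lambda>x. ?b n x - u x) + L2norm (\<lambda>k. fourier_integral (?b n) k - fourier u k)) \<longlonglongrightarrow> 0 + 0 + 0"
    by (intro tendsto_add lim b(3) s filterlim_real_sequentially)
  then have lim': "(\<lambda>n. L2norm (\<lambda>x. f n x - u x) + L2norm (\<lambda>x. ?b n x - u x) + L2norm (\<lambda>k. fourier_integral (?b n) k - fourier u k)) \<longlonglongrightarrow> 0"
    by simp
  show ?thesis
  proof (rule Lim_null_comparison[OF _ lim'], rule always_eventually, rule allI)
    fix n
    have "L2norm (\<lambda>k. fourier_integral (f n) k - fourier u k) \<le>
        L2norm (\<lambda>k. fourier_integral (f n) k - fourier_integral (?b n) k) + L2norm (\<lambda>k. fourier_integral (?b n) k - fourier u k)"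
      by (intro L2norm_triangle_diff plancherel_L1_L2(1) f b s)
    also have "L2norm (\<lambda>k. fourier_integral (f n) k - fourier_integral (?b n) k) = L2norm (\<lambda>x. f n x - ?b n x)"
      by (intro plancherel_diff f b)
    also have "\<dots> \<le> L2norm (\<lambda>x. f n x - u x) + L2norm (\<lambda>x. ?b n x - u x)"
      using L2norm_triangle_diff[OF f(2) u b(2), of n "real n"] L2norm_commute[of u "?b n"] by simp
    finally show "norm (L2norm (\<lambda>k. fourier_integral (f n) k - fourier u k)) \<le> L2norm (\<lambda>x. f n x - u x)
        + L2norm (\<lambda>x. ?b n x - u x) + L2norm (\<lambda>k. fourier_integral (?b n) k - fourier u k)" by simp
  qed
qed

lemma fourier_eqI:
  assumes "u \<in> L2" "g \<in> L2" "\<And>n. integrable lborel (f n)" "\<And>n. f n \<in> L2"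
    "(\<lambda>n. L2norm (\<lambda>x. f n x - u x)) \<longlonglongrightarrow> 0" "(\<lambda>n. L2norm (\<lambda>k. fourier_integral (f n) k - g k)) \<longlonglongrightarrow> 0"
  shows "AE k in lborel. fourier u k = g k"
  by (rule L2_limit_unique_AE[OF plancherel_L1_L2(1)[OF assms(3,4)] fourier_spec(1)[OF assms(1)] assms(2)
      fourier_limit[OF assms(1,3,4,5)] assms(6)])

lemma fourier_isometry:
  assumes u: "u \<in> L2" shows "L2norm (fourier u) = L2norm u"
proof -
  note b = ball_cut_props[OF u]
  have "(\<lambda>n. L2norm (fourier_integral (ball_cut u (real n)))) \<longlonglongrightarrow> L2norm (fourier u)"
    by (intro L2norm_tendsto plancherel_L1_L2(1) b fourier_spec u)
  moreover have "(\<lambda>n. L2norm (ball_cut u (real n))) \<longlonglongrightarrow> L2norm u"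
    by (intro L2norm_tendsto b u filterlim_real_sequentially)
  ultimately show ?thesis using plancherel_L1_L2(2)[OF b(1,2)] LIMSEQ_unique by simp
qed

lemma fourier_integrable:
  assumes "integrable lborel u" "u \<in> L2"
  shows "AE k in lborel. fourier u k = fourier_integral u k"
  by (rule fourier_eqI[OF assms(2) plancherel_L1_L2(1)[OF assms], where f="\<lambda>_. u"])
     (use assms in \<open>auto simp: L2norm_def\<close>)

lemma fourier_integral_linear:
  assumes "integrable lborel f" "integrable lborel g"
  shows "fourier_integral (\<lambda>x. a * f x + b * g x) k = a * fourier_integral f k + b * fourier_integral g k"
proof -
  note i = integrable_cis_mult(2)[OF assms(1), of k] integrable_cis_mult(2)[OF assms(2), of k]
  have "(LINT x|lborel. cis (- (k \<bullet> x)) * (a * f x + b * g x)) =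
      (LINT x|lborel. a * (cis (- (k \<bullet> x)) * f x) + b * (cis (- (k \<bullet> x)) * g x))"
    by (simp add: algebra_simps)
  also have "\<dots> = a * (LINT x|lborel. cis (- (k \<bullet> x)) * f x) + b * (LINT x|lborel. cis (- (k \<bullet> x)) * g x)"
    using i by simp
  finally show ?thesis by (simp add: fourier_integral_def algebra_simps)
qed

lemma L2norm_linear_diff_le:
  assumes "f \<in> L2" "g \<in> L2" "u \<in> L2" "w \<in> L2"
  shows "L2norm (\<lambda>x. (a * f x + b * g x) - (a * u x + b * w x)) \<le>
     cmod a * L2norm (\<lambda>x. f x - u x) + cmod b * L2norm (\<lambda>x. g x - w x)"
proof -
  have "(\<lambda>x. (a * f x + b * g x) - (a * u x + b * w x)) = (\<lambda>x. a * (f x - u x) + b * (g x - w x))"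
    by (simp add: algebra_simps)
  then show ?thesis
    using L2_add(2)[OF L2_cmult[OF L2_diff(1)[OF assms(1,3)], of a] L2_cmult[OF L2_diff(1)[OF assms(2,4)], of b]]
    by (simp add: L2norm_cmult)
qed

lemma fourier_linear:
  assumes u: "u \<in> L2" and w: "w \<in> L2"
  shows "AE k in lborel. fourier (\<lambda>x. a * u x + b * w x) k = a * fourier u k + b * fourier w k"
proof -
  note bu = ball_cut_props[OF u] note bw = ball_cut_props[OF w]
  note su = fourier_spec[OF u] note sw = fourier_spec[OF w]
  note Fu = plancherel_L1_L2(1)[OF bu(1,2)] note Fw = plancherel_L1_L2(1)[OF bw(1,2)]
  let ?f = "\<lambda>n x. a * ball_cut u (real n) x + b * ball_cut w (real n) x"
  have i: "integrable lborel (?f n)" for n using bu(1) bw(1) by simp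
  show ?thesis
  proof (rule fourier_eqI[where f="?f"])
    have "(\<lambda>n. cmod a * L2norm (\<lambda>x. ball_cut u (real n) x - u x) + cmod b * L2norm (\<lambda>x. ball_cut w (real n) x - w x)) \<longlonglongrightarrow> cmod a * 0 + cmod b * 0"
      by (intro tendsto_intros bu(3) bw(3) filterlim_real_sequentially)
    then have lim: "(\<lambda>n. cmod a * L2norm (\<lambda>x. ball_cut u (real n) x - u x) + cmod b * L2norm (\<lambda>x. ball_cut w (real n) x - w x)) \<longlonglongrightarrow> 0"
      by simp
    show "(\<lambda>n. L2norm (\<lambda>x. ?f n x - (a * u x + b * w x))) \<longlonglongrightarrow> 0"
      by (rule LIMSEQ_null_le[OF L2norm_nonneg L2norm_linear_diff_le[OF bu(2) bw(2) u w] lim])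
    have "(\<lambda>n. cmod a * L2norm (\<lambda>k. fourier_integral (ball_cut u (real n)) k - fourier u k)
       + cmod b * L2norm (\<lambda>k. fourier_integral (ball_cut w (real n)) k - fourier w k)) \<longlonglongrightarrow> cmod a * 0 + cmod b * 0"
      by (intro tendsto_intros su(2) sw(2))
    then have lim: "(\<lambda>n. cmod a * L2norm (\<lambda>k. fourier_integral (ball_cut u (real n)) k - fourier u k)
       + cmod b * L2norm (\<lambda>k. fourier_integral (ball_cut w (real n)) k - fourier w k)) \<longlonglongrightarrow> 0"
      by simp
    show "(\<lambda>n. L2norm (\<lambda>k. fourier_integral (?f n) k - (a * fourier u k + b * fourier w k))) \<longlonglongrightarrow> 0"
      unfolding fourier_integral_linear[OF bu(1) bw(1)]
      by (rule LIMSEQ_null_le[OF L2norm_nonneg L2norm_linear_diff_le[OF Fu Fw su(1) sw(1)] lim])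
  qed (intro i L2_add L2_cmult u w bu bw su sw)+
qed

lemma fourier_diff:
  assumes "u \<in> L2" "w \<in> L2"
  shows "AE k in lborel. fourier (\<lambda>x. u x - w x) k = fourier u k - fourier w k"
  using fourier_linear[OF assms, of 1 "-1"] by simp

lemma fourier_cmult:
  assumes "u \<in> L2"
  shows "AE k in lborel. fourier (\<lambda>x. a * u x) k = a * fourier u k"
  using fourier_linear[OF assms assms, of a 0] by simp

lemma fourier_diff_isometry:
  assumes "u \<in> L2" "w \<in> L2"
  shows "L2norm (\<lambda>k. fourier u k - fourier w k) = L2norm (\<lambda>x. u x - w x)"
proof -
  note d = L2_diff(1)[OF assms] note s = fourier_spec(1)[OF d]
  have "L2norm (\<lambda>k. fourier u k - fourier w k) = L2norm (fourier (\<lambda>x. u x - w x))"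
    by (rule L2_cong_AE(2)[OF s L2_measurable[OF L2_diff(1)[OF fourier_spec(1)[OF assms(1)] fourier_spec(1)[OF assms(2)]]]])
       (use fourier_diff[OF assms] in eventually_elim, simp)
  then show ?thesis using fourier_isometry[OF d] by simp
qed

lemma fourier_modulate:
  assumes u: "u \<in> L2"
  shows "AE k in lborel. fourier (\<lambda>x. cis (- (l \<bullet> x)) * u x) k = fourier u (k + l)"
proof -
  note b = ball_cut_props[OF u] note s = fourier_spec[OF u]
  let ?m = "\<lambda>f x. cis (- (l \<bullet> x)) * f x"
  have m: "?m f \<in> L2" if "f \<in> L2" for f by (rule L2_mult(1)[OF that, of _ 1]) auto
  show ?thesis
  proof (rule fourier_eqI[where f="\<lambda>n. ?m (ball_cut u (real n))"])
    have "(\<lambda>x. ?m (ball_cut u (real n)) x - ?m u x) = ?m (\<lambda>x. ball_cut u (real n) x - u x)" for n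
      by (simp add: right_diff_distrib)
    then show "(\<lambda>n. L2norm (\<lambda>x. ?m (ball_cut u (real n)) x - ?m u x)) \<longlonglongrightarrow> 0"
      using b(3)[OF filterlim_real_sequentially] L2norm_unimodular[of "\<lambda>x. cis (- (l \<bullet> x))"] by simp
    show "(\<lambda>n. L2norm (\<lambda>k. fourier_integral (?m (ball_cut u (real n))) k - fourier u (k + l))) \<longlonglongrightarrow> 0"
      unfolding fourier_integral_modulate
      using s(2) L2_shift(2)[OF L2_diff(1)[OF plancherel_L1_L2(1)[OF b(1,2)] s(1)], of _ l] by simp
    show "integrable lborel (?m (ball_cut u (real n)))" for n by (rule integrable_cis_mult(2)[OF b(1)])
  qed (use m u b L2_shift(1)[OF s(1)] in auto)
qed

lemma fourier_translate:
  assumes u: "u \<in> L2"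
  shows "AE k in lborel. fourier (\<lambda>x. u (x - y)) k = cis (- (k \<bullet> y)) * fourier u k"
proof -
  note b = ball_cut_props[OF u] note s = fourier_spec[OF u]
  have cm: "(\<lambda>k. cis (- (k \<bullet> y))) \<in> borel_measurable borel" by measurable
  show ?thesis
  proof (rule fourier_eqI[where f="\<lambda>n x. ball_cut u (real n) (x - y)"])
    show "(\<lambda>x. u (x - y)) \<in> L2" "\<And>n. (\<lambda>x. ball_cut u (real n) (x - y)) \<in> L2"
      using L2_shift(1)[OF u, of "-y"] L2_shift(1)[OF b(2), of _ "-y"] by simp_all
    show "\<And>n. integrable lborel (\<lambda>x. ball_cut u (real n) (x - y))"
      using integrable_lborel_shift[OF b(1), of _ "-y"] by simp
    show "(\<lambda>k. cis (- (k \<bullet> y)) * fourier u k) \<in> L2"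
      by (rule L2_mult(1)[OF s(1) cm, of 1]) simp
    show "(\<lambda>n. L2norm (\<lambda>x. ball_cut u (real n) (x - y) - u (x - y))) \<longlonglongrightarrow> 0"
      using b(3)[OF filterlim_real_sequentially] L2_shift(2)[OF L2_diff(1)[OF b(2) u], of _ "-y"] by simp
    have "fourier_integral (\<lambda>x. ball_cut u (real n) (x - y)) k - cis (- (k \<bullet> y)) * fourier u k =
        cis (- (k \<bullet> y)) * (fourier_integral (ball_cut u (real n)) k - fourier u k)" for n k
      by (simp add: fourier_integral_translate[OF b(1)] right_diff_distrib)
    then show "(\<lambda>n. L2norm (\<lambda>k. fourier_integral (\<lambda>x. ball_cut u (real n) (x - y)) k - cis (- (k \<bullet> y)) * fourier u k)) \<longlonglongrightarrow> 0"
      using s(2) L2norm_unimodular[of "\<lambda>k. cis (- (k \<bullet> y))"] by simp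
  qed
qed

lemma L2_product_integrable:
  assumes "u \<in> L2" "w \<in> L2"
  shows "integrable lborel (\<lambda>x. u x * cnj (w x))"
proof -
  note [measurable] = L2_measurable[OF assms(1)] L2_measurable[OF assms(2)]
  show ?thesis
    by (rule Bochner_Integration.integrable_bound[OF Cauchy_Schwarz_L2(1)[OF assms]]) (auto simp: norm_mult)
qed

lemma L2norm_polarization:
  assumes "u \<in> L2" "w \<in> L2"
  shows "2 * Re (LINT x|lborel. u x * cnj (w x)) = (L2norm (\<lambda>x. u x + w x))\<^sup>2 - (L2norm u)\<^sup>2 - (L2norm w)\<^sup>2"
proof -
  note I = L2_product_integrable[OF assms] L2_integrable[OF assms(1)] L2_integrable[OF assms(2)]
  have "(cmod (u x + w x))\<^sup>2 = (cmod (u x))\<^sup>2 + (cmod (w x))\<^sup>2 + 2 * Re (u x * cnj (w x))" for x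
    unfolding cmod_power2 by (simp add: power2_eq_square algebra_simps)
  then have "(L2norm (\<lambda>x. u x + w x))\<^sup>2 = (LINT x|lborel. (cmod (u x))\<^sup>2 + (cmod (w x))\<^sup>2 + 2 * Re (u x * cnj (w x)))"
    by (simp add: L2norm_square)
  also have "\<dots> = (L2norm u)\<^sup>2 + (L2norm w)\<^sup>2 + 2 * (LINT x|lborel. Re (u x * cnj (w x)))"
    unfolding L2norm_square using I(2,3) integrable_Re[OF I(1)]
    by (simp del: times_complex.sel)
  also have "(LINT x|lborel. Re (u x * cnj (w x))) = Re (LINT x|lborel. u x * cnj (w x))"
    by (rule integral_Re[OF I(1)])
  finally show ?thesis by simp
qed

text \<open>
  The isometry gives the real part of the identity by polarization, and multiplying one factor by \<open>\<i>\<close>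
  gives the imaginary part.
\<close>
lemma parseval:
  assumes u: "u \<in> L2" and w: "w \<in> L2"
  shows "(LINT k|lborel. fourier u k * cnj (fourier w k)) = (LINT x|lborel. u x * cnj (w x))"
proof -
  have re: "Re (LINT k|lborel. fourier u k * cnj (c * fourier w k)) = Re (LINT x|lborel. u x * cnj (c * w x))" for c
  proof -
    note cw = L2_cmult[OF w, of c] note cfw = L2_cmult[OF fourier_spec(1)[OF w], of c]
    note sum = L2_add(1)[OF u cw]
    have "L2norm (\<lambda>k. fourier u k + c * fourier w k) = L2norm (fourier (\<lambda>x. u x + c * w x))"
      by (rule L2_cong_AE(2)[OF fourier_spec(1)[OF sum] L2_measurable[OF L2_add(1)[OF fourier_spec(1)[OF u] cfw]]])
         (use fourier_linear[OF u w, of 1 c] in eventually_elim, simp)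
    then show ?thesis
      using L2norm_polarization[OF u cw] L2norm_polarization[OF fourier_spec(1)[OF u] cfw]
        fourier_isometry[OF u] fourier_isometry[OF w] fourier_isometry[OF sum] by (simp add: L2norm_cmult)
  qed
  have scal: "(LINT x|lborel. f x * cnj (c * g x)) = cnj c * (LINT x|lborel. f x * cnj (g x))" for f g :: "'a \<Rightarrow> complex" and c
  proof -
    have "f x * cnj (c * g x) = cnj c * (f x * cnj (g x))" for x by simp
    then show ?thesis by (simp only: integral_mult_right_zero)
  qed
  show ?thesis using re[of 1] re[of \<i>] unfolding scal by (intro complex_eqI) auto
qed

section \<open>Large values of functions in the Sobolev space of order one half\<close>

definition half_energy :: "('a::euclidean_space \<Rightarrow> complex) \<Rightarrow> real" where
  "half_energy u = (LINT k|lborel. norm k * (cmod (fourier u k))\<^sup>2)"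

lemma half_energy_nonneg [simp]: "0 \<le> half_energy u"
  unfolding half_energy_def by (rule integral_nonneg_AE) auto

lemma fourier_measurable: "u \<in> L2 \<Longrightarrow> fourier u \<in> borel_measurable borel"
  by (rule L2_measurable[OF fourier_spec(1)])

lemma H_half_L2: "u \<in> H_half \<Longrightarrow> u \<in> L2"
  by (simp add: H_half_def)

lemma H_half_integrable:
  assumes "u \<in> H_half" shows "integrable lborel (\<lambda>k. norm k * (cmod (fourier u k))\<^sup>2)"
proof (rule Bochner_Integration.integrable_bound)
  show "integrable lborel (\<lambda>k. sqrt (1 + (norm k)\<^sup>2) * (cmod (fourier u k))\<^sup>2)"
    using assms by (simp add: H_half_def)
  note [measurable] = fourier_measurable[OF H_half_L2[OF assms]]
  show "(\<lambda>k. norm k * (cmod (fourier u k))\<^sup>2) \<in> borel_measurable lborel" by measurable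
  show "AE k in lborel. norm (norm k * (cmod (fourier u k))\<^sup>2) \<le> norm (sqrt (1 + (norm k)\<^sup>2) * (cmod (fourier u k))\<^sup>2)"
    by (auto simp: abs_mult real_le_rsqrt intro!: mult_right_mono)
qed

lemma H_half_I:
  assumes u: "u \<in> L2" and int: "integrable lborel (\<lambda>k. norm k * (cmod (fourier u k))\<^sup>2)"
  shows "u \<in> H_half"
proof -
  have "integrable lborel (\<lambda>k. sqrt (1 + (norm k)\<^sup>2) * (cmod (fourier u k))\<^sup>2)"
  proof (rule Bochner_Integration.integrable_bound)
    show "integrable lborel (\<lambda>k. (cmod (fourier u k))\<^sup>2 + norm k * (cmod (fourier u k))\<^sup>2)"
      using L2_integrable[OF fourier_spec(1)[OF u]] int by simp
    note [measurable] = fourier_measurable[OF u]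
    show "(\<lambda>k. sqrt (1 + (norm k)\<^sup>2) * (cmod (fourier u k))\<^sup>2) \<in> borel_measurable lborel" by measurable
    have "sqrt (1 + (norm k)\<^sup>2) * (cmod (fourier u k))\<^sup>2 \<le> (cmod (fourier u k))\<^sup>2 + norm k * (cmod (fourier u k))\<^sup>2" for k
    proof -
      have "sqrt (1 + (norm k)\<^sup>2) \<le> 1 + norm k" by (rule real_le_lsqrt) (auto simp: power2_sum)
      from mult_right_mono[OF this, of "(cmod (fourier u k))\<^sup>2"] show ?thesis by (simp add: algebra_simps)
    qed
    then show "AE k in lborel. norm (sqrt (1 + (norm k)\<^sup>2) * (cmod (fourier u k))\<^sup>2) \<le>
        norm ((cmod (fourier u k))\<^sup>2 + norm k * (cmod (fourier u k))\<^sup>2)" by simp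
  qed
  then show ?thesis using u by (simp add: H_half_def)
qed

lemma high_frequency_mass:
  assumes u: "u \<in> H_half" and R: "R > 0"
  shows "(\<lambda>k. indicator (- cball 0 R) k * fourier u k) \<in> L2"
    "L2norm (\<lambda>k. indicator (- cball 0 R) k * fourier u k) \<le> sqrt (half_energy u / R)"
proof -
  let ?h = "\<lambda>k. indicator (- cball 0 R) k * fourier u k"
  show h: "?h \<in> L2" by (rule L2_indicator(1)[OF fourier_spec(1)[OF H_half_L2[OF u]]]) simp
  have "(L2norm ?h)\<^sup>2 \<le> (LINT k|lborel. (norm k * (cmod (fourier u k))\<^sup>2) / R)"
    unfolding L2norm_square
  proof (rule integral_mono)
    show "(cmod (?h k))\<^sup>2 \<le> (norm k * (cmod (fourier u k))\<^sup>2) / R" for k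
    proof (cases "norm k \<le> R")
      case False
      then have "R * (cmod (fourier u k))\<^sup>2 \<le> norm k * (cmod (fourier u k))\<^sup>2" by (intro mult_right_mono) auto
      then show ?thesis using R False by (simp add: field_simps)
    qed (use R in auto)
  qed (use L2_integrable[OF h] H_half_integrable[OF u] in auto)
  also have "\<dots> = half_energy u / R" by (simp add: half_energy_def)
  finally show "L2norm ?h \<le> sqrt (half_energy u / R)" by (rule real_le_rsqrt)
qed

text \<open>
  Pair \<open>u\<close> with the part \<open>w\<close> of \<open>u\<close> where \<open>|u| > t\<close> and split frequencies at \<open>R\<close>. At high
  frequencies the energy of \<open>u\<close> is small. At low ones \<open>|w\<^sup>^|\<close> is at most a multiple of
  \<open>\<parallel>w\<parallel>\<^sub>1 \<le> \<parallel>w\<parallel>\<^sup>2 / t\<close>, which the hypothesis makes small enough to be absorbed.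
\<close>
lemma large_values_mass:
  fixes u :: "'a::euclidean_space \<Rightarrow> complex"
  assumes u: "u \<in> H_half" and t: "t > 0" and R: "R > 0"
    and small: "(2 * pi) powr (- real DIM('a) / 2) * (sqrt (measure lborel (cball (0::'a) R)) * L2norm u) / t \<le> 1 / 2"
  defines "w \<equiv> \<lambda>x. indicator {x. t < cmod (u x)} x * u x"
  shows "w \<in> L2" "(L2norm w)\<^sup>2 \<le> 4 * half_energy u / R"
proof -
  let ?c = "(2 * pi) powr (- real DIM('a) / 2)"
  let ?B = "cball (0::'a) R"
  note uL = H_half_L2[OF u] note F = fourier_spec(1)[OF uL]
  note [measurable] = L2_measurable[OF uL]
  have A: "{x. t < cmod (u x)} \<in> sets borel" by measurable
  show w: "w \<in> L2" unfolding w_def by (rule L2_indicator(1)[OF uL A])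
  note Fw = fourier_spec(1)[OF w]
  have le: "cmod (w x) \<le> (cmod (w x))\<^sup>2 / t" for x
  proof (cases "t < cmod (u x)")
    case True
    then have "t * cmod (w x) \<le> cmod (w x) * cmod (w x)" by (intro mult_right_mono) (auto simp: w_def)
    then show ?thesis using t by (simp add: field_simps power2_eq_square)
  qed (simp add: w_def)
  have int2: "integrable lborel (\<lambda>x. (cmod (w x))\<^sup>2 / t)" using L2_integrable[OF w] by simp
  have int: "integrable lborel w"
    by (rule Bochner_Integration.integrable_bound[OF int2])
       (use le L2_measurable[OF w] t in \<open>auto intro: order_trans[OF le abs_ge_self]\<close>)
  have w1: "(LINT x|lborel. cmod (w x)) \<le> (L2norm w)\<^sup>2 / t"
    using integral_mono[OF integrable_norm[OF int] int2 le] by (simp add: L2norm_square)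
  have bound: "AE k in lborel. cmod (fourier w k) \<le> ?c * (L2norm w)\<^sup>2 / t"
    using fourier_integrable[OF int w]
  proof eventually_elim
    case (elim k)
    have "cmod (fourier w k) \<le> ?c * (LINT x|lborel. cmod (w x))" unfolding elim by (rule fourier_integral_bound)
    also have "\<dots> \<le> ?c * ((L2norm w)\<^sup>2 / t)" by (intro mult_left_mono w1) auto
    finally show ?case by simp
  qed
  define K where "K = ?c * (L2norm w)\<^sup>2 / t"
  have K0: "K \<ge> 0" using t by (simp add: K_def)
  have bound: "AE k in lborel. cmod (fourier w k) \<le> K" using bound by (simp add: K_def)
  have finB: "emeasure lborel ?B < \<infinity>" by (rule emeasure_cball_finite)
  have Bm: "?B \<in> sets borel" by simp
  note lowF = L2_set_integrable[OF F Bm finB]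
  note highF = high_frequency_mass[OF u R]
  note CS = Cauchy_Schwarz_L2[OF highF(1) Fw]
  let ?low = "\<lambda>k. cmod (indicator ?B k * fourier u k)"
  have "complex_of_real ((L2norm w)\<^sup>2) = (LINT x|lborel. complex_of_real ((cmod (w x))\<^sup>2))"
    unfolding L2norm_square by (rule integral_complex_of_real[symmetric])
  also have "\<dots> = (LINT x|lborel. u x * cnj (w x))"
  proof (rule Bochner_Integration.integral_cong)
    fix x
    show "complex_of_real ((cmod (w x))\<^sup>2) = u x * cnj (w x)"
      unfolding complex_norm_square by (simp add: w_def indicator_def)
  qed simp
  also have "\<dots> = (LINT k|lborel. fourier u k * cnj (fourier w k))" by (rule parseval[OF uL w, symmetric])
  finally have "complex_of_real ((L2norm w)\<^sup>2) = (LINT k|lborel. fourier u k * cnj (fourier w k))" .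
  from arg_cong[OF this, of cmod]
  have "(L2norm w)\<^sup>2 = cmod (LINT k|lborel. fourier u k * cnj (fourier w k))"
    by (simp only: norm_of_real abs_power2)
  also have "\<dots> \<le> (LINT k|lborel. cmod (fourier u k * cnj (fourier w k)))" by (rule integral_norm_bound)
  also have "\<dots> \<le> (LINT k|lborel. ?low k * K + cmod (indicator (- ?B) k * fourier u k) * cmod (fourier w k))"
  proof (rule integral_mono_AE)
    show "AE k in lborel. cmod (fourier u k * cnj (fourier w k)) \<le>
        ?low k * K + cmod (indicator (- ?B) k * fourier u k) * cmod (fourier w k)"
      using bound
    proof eventually_elim
      case (elim k)
      from mult_left_mono[OF this, of "cmod (fourier u k)"] show ?case
        by (cases "k \<in> ?B") (auto simp: norm_mult indicator_def)
    qed
  qed (use L2_product_integrable[OF F Fw] in simp,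
      rule Bochner_Integration.integrable_add[OF integrable_mult_left[OF integrable_norm[OF lowF(1)]] CS(1)])
  also have "\<dots> = (LINT k|lborel. ?low k) * K
      + (LINT k|lborel. cmod (indicator (- ?B) k * fourier u k) * cmod (fourier w k))"
    using integrable_mult_left[OF integrable_norm[OF lowF(1)], of K] CS(1)
    by (subst Bochner_Integration.integral_add) (simp_all only: integral_mult_left_zero)
  also have "\<dots> \<le> (sqrt (measure lborel ?B) * L2norm u) * K + sqrt (half_energy u / R) * L2norm w"
  proof (rule add_mono)
    show "(LINT k|lborel. ?low k) * K \<le> (sqrt (measure lborel ?B) * L2norm u) * K"
      using lowF(2) K0 unfolding fourier_isometry[OF uL] by (intro mult_right_mono)
    have "(LINT k|lborel. cmod (indicator (- ?B) k * fourier u k) * cmod (fourier w k)) \<le>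
        L2norm (\<lambda>k. indicator (- ?B) k * fourier u k) * L2norm w"
      using CS(2) by (simp add: fourier_isometry[OF w])
    also have "\<dots> \<le> sqrt (half_energy u / R) * L2norm w" by (intro mult_right_mono highF(2)) auto
    finally show "(LINT k|lborel. cmod (indicator (- ?B) k * fourier u k) * cmod (fourier w k)) \<le> sqrt (half_energy u / R) * L2norm w" .
  qed
  also have "(sqrt (measure lborel ?B) * L2norm u) * K =
      (?c * (sqrt (measure lborel ?B) * L2norm u) / t) * (L2norm w)\<^sup>2" by (simp add: K_def)
  also have "\<dots> \<le> 1 / 2 * (L2norm w)\<^sup>2" by (intro mult_right_mono small) auto
  finally have "L2norm w * L2norm w \<le> (2 * sqrt (half_energy u / R)) * L2norm w" by (simp add: power2_eq_square)
  then have "L2norm w \<le> 2 * sqrt (half_energy u / R)"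
    using L2norm_nonneg[of w] R by (cases "L2norm w = 0") (auto simp: mult_le_cancel_right)
  then have "(L2norm w)\<^sup>2 \<le> (2 * sqrt (half_energy u / R))\<^sup>2" by (intro power_mono) auto
  then show "(L2norm w)\<^sup>2 \<le> 4 * half_energy u / R" using R by (simp add: power_mult_distrib)
qed

text \<open>
  Taking \<open>R\<close> proportional to \<open>t\<^bsup>2/N\<^esup>\<close> makes the volume of the frequency ball proportional to \<open>t\<^sup>2\<close>, so
  that the smallness condition becomes independent of \<open>t\<close>.
\<close>
lemma large_values_mass_uniform:
  fixes s :: real
  assumes s: "s \<ge> 0"
  obtains \<theta> where "\<theta> > 0" "\<And>(u :: 'a::euclidean_space \<Rightarrow> complex) t. u \<in> H_half \<Longrightarrow> L2norm u \<le> s \<Longrightarrow> t > 0 \<Longrightarrow>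
     (L2norm (\<lambda>x. indicator {x. t < cmod (u x)} x * u x))\<^sup>2 \<le> 4 * half_energy u / (\<theta> * t powr (2 / DIM('a)))"
proof -
  let ?c = "(2 * pi) powr (- real DIM('a) / 2)"
  let ?V = "unit_ball_vol (real DIM('a))"
  have V: "?V > 0" by simp
  have c: "?c > 0" by simp
  (* the +1 keeps the denominator positive when s = 0 *)
  define q where "q = 1 / (2 * ?c * sqrt ?V * (s + 1))"
  have q: "q > 0" using V c s by (simp add: q_def)
  define \<theta> where "\<theta> = root DIM('a) (q\<^sup>2)"
  have \<theta>: "\<theta> > 0" "\<theta> ^ DIM('a) = q\<^sup>2" using q by (auto simp: \<theta>_def)
  show ?thesis
  proof (rule that[OF \<theta>(1)])
    fix u :: "'a \<Rightarrow> complex" and t :: real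
    assume u: "u \<in> H_half" and us: "L2norm u \<le> s" and t: "t > 0"
    let ?R = "\<theta> * t powr (2 / DIM('a))"
    have R: "?R > 0" using \<theta> t by simp
    have "(t powr (2 / DIM('a))) ^ DIM('a) = t\<^sup>2" using t by (simp add: powr_power)
    then have RN: "?R ^ DIM('a) = (q * t)\<^sup>2" using \<theta> by (simp add: power_mult_distrib)
    have "measure lborel (cball (0::'a) ?R) = ?V * (q * t)\<^sup>2"
      using content_cball[of ?R "0::'a"] R RN by simp
    then have "sqrt (measure lborel (cball (0::'a) ?R)) = sqrt ?V * (q * t)"
      using q t by (simp add: real_sqrt_mult)
    then have "?c * (sqrt (measure lborel (cball (0::'a) ?R)) * L2norm u) / t = ?c * sqrt ?V * q * L2norm u"
      using t by simp
    also have "\<dots> \<le> ?c * sqrt ?V * q * (s + 1)" using us c V q by (intro mult_left_mono) auto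
    also have "\<dots> = 1 / 2" using c less_imp_neq[OF V, symmetric] s by (simp add: q_def)
    finally show "(L2norm (\<lambda>x. indicator {x. t < cmod (u x)} x * u x))\<^sup>2 \<le> 4 * half_energy u / ?R"
      by (rule large_values_mass(2)[OF u t R])
  qed
qed

lemma ennreal_term_le_suminf: "f j \<le> (\<Sum>j. f j :: ennreal)"
  using sum_le_suminf[OF summableI, of "{j}" f] by simp

text \<open>The set where \<open>|u| > T\<close> is split into dyadic layers. Their contributions form a geometric series
  with ratio \<open>2\<close> to the power \<open>p - 2 - 2/N\<close>, which is less than \<open>1\<close>.\<close>
lemma Lp_tail_uniform:
  fixes s p :: real
  assumes s: "s \<ge> 0" and p: "2 < p" "p < 2 + 2 / DIM('a::euclidean_space)"
  obtains C where "C \<ge> 0" "\<And>(u :: 'a \<Rightarrow> complex) T. u \<in> H_half \<Longrightarrow> L2norm u \<le> s \<Longrightarrow> T > 0 \<Longrightarrow>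
     (\<integral>\<^sup>+x. ennreal (indicator {x. T < cmod (u x)} x * cmod (u x) powr p) \<partial>lborel)
       \<le> ennreal (C * T powr (p - 2 - 2 / DIM('a)) * half_energy u)"
proof -
  let ?N = "real DIM('a)"
  define \<sigma> where "\<sigma> = p - 2 - 2 / ?N"
  have \<sigma>: "\<sigma> < 0" using p by (simp add: \<sigma>_def)
  define r where "r = 2 powr \<sigma>"
  have r: "0 < r" "r < 1" using \<sigma> by (auto simp: r_def powr_less_one)
  obtain \<theta> where \<theta>: "\<theta> > 0" "\<And>(u :: 'a \<Rightarrow> complex) t. u \<in> H_half \<Longrightarrow> L2norm u \<le> s \<Longrightarrow> t > 0 \<Longrightarrow>
     (L2norm (\<lambda>x. indicator {x. t < cmod (u x)} x * u x))\<^sup>2 \<le> 4 * half_energy u / (\<theta> * t powr (2 / ?N))"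
    using large_values_mass_uniform[OF s, where 'a='a] by blast
  define K where "K = 2 powr (p - 2) * 4 / \<theta>"
  have K: "K \<ge> 0" using \<theta>(1) by (simp add: K_def)
  show ?thesis
  proof (rule that)
    show "K / (1 - r) \<ge> 0" using K r by simp
    fix u :: "'a \<Rightarrow> complex" and T :: real
    assume u: "u \<in> H_half" and us: "L2norm u \<le> s" and T: "T > 0"
    note [measurable] = L2_measurable[OF H_half_L2[OF u]]
    let ?t = "\<lambda>j::nat. 2 ^ j * T"
    let ?w = "\<lambda>j x. indicator {x. ?t j < cmod (u x)} x * u x"
    let ?f = "\<lambda>j x. (2 * ?t j) powr (p - 2) * (cmod (?w j x))\<^sup>2"
    have t: "?t j > 0" for j using T by simp
    have w: "?w j \<in> L2" for j by (rule L2_indicator(1)[OF H_half_L2[OF u]]) measurable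
    have pt: "ennreal (indicator {x. T < cmod (u x)} x * cmod (u x) powr p) \<le> (\<Sum>j. ennreal (?f j x))" for x
    proof (cases "T < cmod (u x)")
      case True
      obtain n :: nat where "cmod (u x) / T < 2 ^ n" using real_arch_pow[of 2 "cmod (u x) / T"] by auto
      then have "cmod (u x) < ?t n" using T by (simp add: field_simps)
      then have "cmod (u x) \<le> 2 * ?t n" using t[of n] by linarith
      define j where "j = (LEAST j. cmod (u x) \<le> 2 * ?t j)"
      have j: "cmod (u x) \<le> 2 * ?t j" unfolding j_def by (rule LeastI) fact
      have lower: "?t j < cmod (u x)"
      proof (cases j)
        case (Suc i)
        then have "\<not> cmod (u x) \<le> 2 * ?t i" unfolding j_def by (metis not_less_Least lessI)
        then show ?thesis using Suc by simp
      qed (use True in simp)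
      have pos: "cmod (u x) > 0" using True T by linarith
      have "cmod (u x) powr p = cmod (u x) powr (p - 2) * (cmod (u x))\<^sup>2"
        using pos by (simp add: powr_diff)
      also have "\<dots> \<le> (2 * ?t j) powr (p - 2) * (cmod (u x))\<^sup>2"
        using p j pos by (intro mult_right_mono powr_mono2) auto
      finally have "indicator {x. T < cmod (u x)} x * cmod (u x) powr p \<le> ?f j x" using lower True by simp
      then have "ennreal (indicator {x. T < cmod (u x)} x * cmod (u x) powr p) \<le> ennreal (?f j x)" by (rule ennreal_leI)
      also have "\<dots> \<le> (\<Sum>j. ennreal (?f j x))"
        by (rule ennreal_term_le_suminf)
      finally show ?thesis .
    qed simp
    have summand: "(\<integral>\<^sup>+x. ennreal (?f j x) \<partial>lborel) \<le> ennreal (K * T powr \<sigma> * half_energy u * r ^ j)" for j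
    proof -
      have "(\<integral>\<^sup>+x. ennreal (?f j x) \<partial>lborel) = ennreal ((2 * ?t j) powr (p - 2)) * (\<integral>\<^sup>+x. ennreal ((cmod (?w j x))\<^sup>2) \<partial>lborel)"
        by (subst nn_integral_cmult[symmetric]) (auto simp: ennreal_mult)
      also have "\<dots> = ennreal ((2 * ?t j) powr (p - 2) * (L2norm (?w j))\<^sup>2)"
        by (simp only: nn_integral_L2[OF w] ennreal_mult' powr_ge_zero)
      also have "\<dots> \<le> ennreal ((2 * ?t j) powr (p - 2) * (4 * half_energy u / (\<theta> * ?t j powr (2 / ?N))))"
        by (intro ennreal_leI mult_left_mono \<theta>(2) u us t) auto
      also have "(2 * ?t j) powr (p - 2) * (4 * half_energy u / (\<theta> * ?t j powr (2 / ?N))) =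
          K * half_energy u * (?t j powr (p - 2) / ?t j powr (2 / ?N))"
        using T by (simp add: K_def powr_mult)
      also have "?t j powr (p - 2) / ?t j powr (2 / ?N) = ?t j powr \<sigma>"
        by (simp only: \<sigma>_def powr_diff[of _ "p - 2"])
      also have "?t j powr \<sigma> = r ^ j * T powr \<sigma>"
      proof -
        have "(2 ^ j) powr \<sigma> = r ^ j"
          unfolding r_def powr_realpow[symmetric, OF zero_less_numeral] powr_powr powr_power
          by (simp add: powr_power mult.commute)
        then show ?thesis using T by (simp add: powr_mult)
      qed
      finally show ?thesis by (simp only: mult_ac)
    qed
    have "(\<integral>\<^sup>+x. ennreal (indicator {x. T < cmod (u x)} x * cmod (u x) powr p) \<partial>lborel) \<le>
        (\<integral>\<^sup>+x. (\<Sum>j. ennreal (?f j x)) \<partial>lborel)" by (intro nn_integral_mono pt)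
    also have "\<dots> = (\<Sum>j. \<integral>\<^sup>+x. ennreal (?f j x) \<partial>lborel)" by (rule nn_integral_suminf) measurable
    also have "\<dots> \<le> (\<Sum>j. ennreal (K * T powr \<sigma> * half_energy u * r ^ j))"
      by (intro suminf_le summableI summand)
    also have "\<dots> = ennreal (\<Sum>j. K * T powr \<sigma> * half_energy u * r ^ j)"
      using K r by (intro suminf_ennreal2 summable_mult summable_geometric) auto
    also have "(\<Sum>j. K * T powr \<sigma> * half_energy u * r ^ j) = K * T powr \<sigma> * half_energy u * (1 / (1 - r))"
      using r by (subst suminf_mult) (auto simp: suminf_geometric)
    finally show "(\<integral>\<^sup>+x. ennreal (indicator {x. T < cmod (u x)} x * cmod (u x) powr p) \<partial>lborel)
       \<le> ennreal (K / (1 - r) * T powr (p - 2 - 2 / ?N) * half_energy u)"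
      by (simp add: \<sigma>_def)
  qed
qed

lemma Lp_bound:
  fixes u :: "'a::euclidean_space \<Rightarrow> complex"
  assumes u: "u \<in> L2" and p: "2 < p" and T: "T > 0" and D: "D \<ge> 0"
    and tail: "(\<integral>\<^sup>+x. ennreal (indicator {x. T < cmod (u x)} x * cmod (u x) powr p) \<partial>lborel) \<le> ennreal D"
  shows "integrable lborel (\<lambda>x. cmod (u x) powr p)"
    "(LINT x|lborel. cmod (u x) powr p) \<le> T powr (p - 2) * (L2norm u)\<^sup>2 + D"
proof -
  note [measurable] = L2_measurable[OF u]
  let ?i = "\<lambda>x. indicator {x. T < cmod (u x)} x * cmod (u x) powr p"
  have pt: "cmod (u x) powr p \<le> T powr (p - 2) * (cmod (u x))\<^sup>2 + ?i x" for x
  proof (cases "T < cmod (u x)")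
    case False
    show ?thesis
    proof (cases "u x = 0")
      case False
      then have "cmod (u x) powr p = cmod (u x) powr (p - 2) * (cmod (u x))\<^sup>2"
        by (simp add: powr_diff)
      also have "\<dots> \<le> T powr (p - 2) * (cmod (u x))\<^sup>2"
        using p \<open>\<not> T < cmod (u x)\<close> by (intro mult_right_mono powr_mono2) auto
      finally show ?thesis using \<open>\<not> T < cmod (u x)\<close> by simp
    qed simp
  qed simp
  have "(\<integral>\<^sup>+x. ennreal (cmod (u x) powr p) \<partial>lborel) \<le> (\<integral>\<^sup>+x. ennreal (T powr (p - 2) * (cmod (u x))\<^sup>2) + ennreal (?i x) \<partial>lborel)"
    using pt by (intro nn_integral_mono) (simp flip: ennreal_plus add: ennreal_leI)
  also have "\<dots> = (\<integral>\<^sup>+x. ennreal (T powr (p - 2) * (cmod (u x))\<^sup>2) \<partial>lborel) + (\<integral>\<^sup>+x. ennreal (?i x) \<partial>lborel)"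
    by (rule nn_integral_add) measurable
  also have "(\<integral>\<^sup>+x. ennreal (T powr (p - 2) * (cmod (u x))\<^sup>2) \<partial>lborel) = ennreal (T powr (p - 2) * (L2norm u)\<^sup>2)"
    using L2_integrable[OF u] by (subst nn_integral_eq_integral) (auto simp: L2norm_square)
  also have "\<dots> + (\<integral>\<^sup>+x. ennreal (?i x) \<partial>lborel) \<le> ennreal (T powr (p - 2) * (L2norm u)\<^sup>2) + ennreal D"
    by (intro add_left_mono tail)
  also have "\<dots> = ennreal (T powr (p - 2) * (L2norm u)\<^sup>2 + D)" using D by (simp flip: ennreal_plus)
  finally have le: "(\<integral>\<^sup>+x. ennreal (cmod (u x) powr p) \<partial>lborel) \<le> ennreal (T powr (p - 2) * (L2norm u)\<^sup>2 + D)" .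
  show int: "integrable lborel (\<lambda>x. cmod (u x) powr p)"
    by (rule integrableI_nonneg) (auto intro: le_less_trans[OF le])
  show "(LINT x|lborel. cmod (u x) powr p) \<le> T powr (p - 2) * (L2norm u)\<^sup>2 + D"
    using le D by (subst (asm) nn_integral_eq_integral[OF int]) (auto simp: ennreal_le_iff simp del: ennreal_plus)
qed

section \<open>Compactness of tight sequences with bounded energy\<close>

lemma cis_diff_bound: "cmod (cis a - cis b) \<le> \<bar>a - b\<bar>"
proof -
  have "cmod (iexp (a - b) - 1) \<le> \<bar>a - b\<bar>" using iexp_approx1[of "a - b" 0] by simp
  moreover have "cis a - cis b = cis b * (iexp (a - b) - 1)"
    unfolding cis_conv_exp[symmetric] by (simp add: right_diff_distrib cis_mult)
  ultimately show ?thesis by (simp add: norm_mult)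
qed

lemma truncated_fourier_bound:
  fixes w :: "'a::euclidean_space \<Rightarrow> complex"
  assumes w: "w \<in> L2" and s: "L2norm w \<le> s"
  defines "B \<equiv> \<lambda>j. (2 * pi) powr (- real DIM('a) / 2) * (sqrt (measure lborel (cball (0::'a) j)) * s)"
  shows "cmod (fourier_integral (ball_cut w j) k) \<le> B j"
    and "j \<ge> 0 \<Longrightarrow> cmod (fourier_integral (ball_cut w j) k - fourier_integral (ball_cut w j) l) \<le> j * norm (k - l) * B j"
proof -
  let ?c = "(2 * pi) powr (- real DIM('a) / 2)"
  note b = ball_cut_props[OF w]
  have "(LINT x|lborel. cmod (ball_cut w j x)) \<le> sqrt (measure lborel (cball (0::'a) j)) * L2norm w"
    unfolding ball_cut_def by (rule L2_set_integrable(2)[OF w _ emeasure_cball_finite]) simp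
  also have "\<dots> \<le> sqrt (measure lborel (cball (0::'a) j)) * s" by (intro mult_left_mono s) auto
  finally have L1: "(LINT x|lborel. cmod (ball_cut w j x)) \<le> sqrt (measure lborel (cball (0::'a) j)) * s" .
  have "cmod (fourier_integral (ball_cut w j) k) \<le> ?c * (LINT x|lborel. cmod (ball_cut w j x))"
    by (rule fourier_integral_bound)
  also have "\<dots> \<le> B j" unfolding B_def by (intro mult_left_mono L1) auto
  finally show "cmod (fourier_integral (ball_cut w j) k) \<le> B j" .
  assume j: "j \<ge> 0"
  note i = integrable_cis_mult(2)[OF b(1), of _ j]
  have "(LINT x|lborel. cis (- (k \<bullet> x)) * ball_cut w j x) - (LINT x|lborel. cis (- (l \<bullet> x)) * ball_cut w j x) =
     (LINT x|lborel. cis (- (k \<bullet> x)) * ball_cut w j x - cis (- (l \<bullet> x)) * ball_cut w j x)"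
    using i by simp
  then have "cmod (fourier_integral (ball_cut w j) k - fourier_integral (ball_cut w j) l) =
     ?c * cmod (LINT x|lborel. cis (- (k \<bullet> x)) * ball_cut w j x - cis (- (l \<bullet> x)) * ball_cut w j x)"
    unfolding fourier_integral_def right_diff_distrib[symmetric] by (simp add: norm_mult)
  also have "\<dots> \<le> ?c * (LINT x|lborel. (j * norm (k - l)) * cmod (ball_cut w j x))"
  proof (intro mult_left_mono order_trans[OF integral_norm_bound] integral_mono)
    fix x
    show "cmod (cis (- (k \<bullet> x)) * ball_cut w j x - cis (- (l \<bullet> x)) * ball_cut w j x) \<le> (j * norm (k - l)) * cmod (ball_cut w j x)"
    proof (cases "norm x \<le> j")
      case True
      have "cmod (cis (- (k \<bullet> x)) - cis (- (l \<bullet> x))) \<le> \<bar>- (k \<bullet> x) - (- (l \<bullet> x))\<bar>" by (rule cis_diff_bound)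
      also have "\<dots> = \<bar>(k - l) \<bullet> x\<bar>" by (simp add: inner_diff_left)
      also have "\<dots> \<le> norm (k - l) * norm x" by (rule Cauchy_Schwarz_ineq2)
      also have "\<dots> \<le> norm (k - l) * j" using True by (intro mult_left_mono) auto
      finally have "cmod (cis (- (k \<bullet> x)) - cis (- (l \<bullet> x))) * cmod (ball_cut w j x) \<le> (j * norm (k - l)) * cmod (ball_cut w j x)"
        by (intro mult_right_mono) (auto simp: mult.commute)
      then show ?thesis by (simp add: norm_mult left_diff_distrib[symmetric])
    qed (simp add: ball_cut_def)
  qed (use i b(1) in auto)
  also have "\<dots> = (j * norm (k - l)) * (?c * (LINT x|lborel. cmod (ball_cut w j x)))" by simp
  also have "\<dots> \<le> (j * norm (k - l)) * B j"
    unfolding B_def using j by (intro mult_left_mono L1) auto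
  finally show "cmod (fourier_integral (ball_cut w j) k - fourier_integral (ball_cut w j) l) \<le> j * norm (k - l) * B j" .
qed

lemma equi_Lipschitz_convergent:
  fixes f :: "nat \<Rightarrow> 'a::metric_space \<Rightarrow> 'b::banach"
  assumes dense: "\<And>X. open X \<Longrightarrow> X \<noteq> {} \<Longrightarrow> \<exists>d\<in>D. d \<in> X"
    and conv: "\<And>d. d \<in> D \<Longrightarrow> convergent (\<lambda>n. f n d)"
    and Lip: "\<And>n x y. norm (f n x - f n y) \<le> K * dist x y"
  shows "convergent (\<lambda>n. f n x)"
proof -
  have "Cauchy (\<lambda>n. f n x)"
  proof (rule CauchyI)
    fix e :: real assume e: "e > 0"
    define \<delta> where "\<delta> = e / (3 * (\<bar>K\<bar> + 1))"
    have \<delta>: "\<delta> > 0" using e by (simp add: \<delta>_def add_nonneg_pos)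
    obtain d where d: "d \<in> D" "dist x d < \<delta>" using dense[of "ball x \<delta>"] \<delta> by auto
    have "K * dist x d \<le> (\<bar>K\<bar> + 1) * \<delta>" using d(2) by (intro mult_mono) auto
    also have "\<dots> = e / 3" by (simp add: \<delta>_def field_simps add_nonneg_pos)
    finally have close: "norm (f n x - f n d) \<le> e / 3" for n using Lip[of n x d] by simp
    obtain M where M: "\<And>m n. m \<ge> M \<Longrightarrow> n \<ge> M \<Longrightarrow> norm (f m d - f n d) < e / 3"
      using CauchyD[OF convergent_Cauchy[OF conv[OF d(1)]], of "e/3"] e by auto
    have "norm (f m x - f n x) < e" if "m \<ge> M" "n \<ge> M" for m n
    proof -
      have "norm (f m x - f n x) \<le> norm (f m x - f m d) + norm (f m d - f n d) + norm (f n x - f n d)"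
        using norm_triangle_ineq4[of "(f m x - f m d) + (f m d - f n d)" "f n x - f n d"]
          norm_triangle_ineq[of "f m x - f m d" "f m d - f n d"] by simp
      then show ?thesis using close[of m] close[of n] M[OF that] by simp
    qed
    then show "\<exists>M. \<forall>m\<ge>M. \<forall>n\<ge>M. norm (f m x - f n x) < e" by blast
  qed
  then show ?thesis by (rule Cauchy_convergent)
qed

lemma L2norm_indicator_split:
  assumes f: "f \<in> L2" and A: "A \<in> sets borel"
  shows "L2norm f \<le> L2norm (\<lambda>x. indicator A x * f x) + L2norm (\<lambda>x. indicator (- A) x * f x)"
proof -
  have "- A \<in> sets borel" using A by simp
  from L2_add(2)[OF L2_indicator(1)[OF f A] L2_indicator(1)[OF f this]]
  moreover have "(\<lambda>x. indicator A x * f x + indicator (- A) x * f x) = f" by (auto simp: indicator_def fun_eq_iff)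
  ultimately show ?thesis by simp
qed

text \<open>
  The transforms of the truncations of \<open>w n\<close> to a ball are uniformly Lipschitz, so a diagonal
  subsequence converges everywhere, hence in \<open>L\<^sup>2\<close> of every ball by dominated convergence.
  Tightness controls the truncation and the energy controls the high frequencies, so the transforms
  of \<open>w n\<close> form a Cauchy sequence in \<open>L\<^sup>2\<close>, and Plancherel's theorem carries this back to \<open>w n\<close>.
\<close>
lemma tight_sequence_precompact:
  fixes w :: "nat \<Rightarrow> 'a::euclidean_space \<Rightarrow> complex"
  assumes w: "\<And>n. w n \<in> H_half" and s: "\<And>n. L2norm (w n) \<le> s" and M: "\<And>n. half_energy (w n) \<le> M"
    and tight: "\<And>e. e > 0 \<Longrightarrow> \<exists>(j::nat) n0. \<forall>n\<ge>n0. L2norm (\<lambda>x. w n x - ball_cut (w n) (real j) x) \<le> e"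
  obtains r u where "strict_mono (r :: nat \<Rightarrow> nat)" "u \<in> L2" "(\<lambda>n. L2norm (\<lambda>x. w (r n) x - u x)) \<longlonglongrightarrow> 0"
proof -
  define B where "B j = (2 * pi) powr (- real DIM('a) / 2) * (sqrt (measure lborel (cball (0::'a) (real j))) * s)" for j :: nat
  define Z where "Z n j = fourier_integral (ball_cut (w n) (real j))" for n and j :: nat
  note wL = H_half_L2[OF w]
  have Zb: "cmod (Z n j k) \<le> B j" for n j k
    unfolding Z_def B_def by (rule truncated_fourier_bound(1)[OF wL s])
  have ZL: "cmod (Z n j k - Z n j l) \<le> real j * norm (k - l) * B j" for n j k l
    unfolding Z_def B_def by (rule truncated_fourier_bound(2)[OF wL s]) simp
  have B0: "0 \<le> B j" for j using order_trans[OF norm_ge_zero Zb[of 0 j 0]] .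
  obtain D :: "'a set" where D: "countable D" "\<And>X. open X \<Longrightarrow> X \<noteq> {} \<Longrightarrow> \<exists>d\<in>D. d \<in> X"
    by (rule countable_dense_setE) blast
  have "countable ((UNIV::nat set) \<times> D)" using D(1) by simp
  moreover have "cmod (Z n (fst q) (snd q) / of_real (B (fst q) + 1)) \<le> 1" for q n
  proof -
    have "0 < B (fst q) + 1" using B0[of "fst q"] by simp
    moreover have "cmod (Z n (fst q) (snd q)) \<le> B (fst q) + 1" using Zb[of n "fst q" "snd q"] by simp
    ultimately show ?thesis by (simp only: norm_divide norm_of_real abs_of_pos divide_le_eq_1_pos)
  qed
  ultimately obtain r :: "nat \<Rightarrow> nat" where r: "strict_mono r"
    "\<And>q. q \<in> (UNIV::nat set) \<times> D \<Longrightarrow> \<exists>l. (\<lambda>n. Z (r n) (fst q) (snd q) / of_real (B (fst q) + 1)) \<longlonglongrightarrow> l"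
    by (rule function_convergent_subsequence[of "UNIV \<times> D" "\<lambda>n q. Z n (fst q) (snd q) / of_real (B (fst q) + 1)" 1]) blast
  have conv: "convergent (\<lambda>n. Z (r n) j k)" for j k
  proof (rule equi_Lipschitz_convergent[OF D(2)])
    fix d assume "d \<in> D"
    then obtain l where "(\<lambda>n. Z (r n) j d / of_real (B j + 1)) \<longlonglongrightarrow> l" using r(2)[of "(j, d)"] by auto
    then have "(\<lambda>n. Z (r n) j d / of_real (B j + 1) * of_real (B j + 1)) \<longlonglongrightarrow> l * of_real (B j + 1)"
      by (intro tendsto_mult_right)
    moreover have "complex_of_real (B j + 1) \<noteq> 0" using B0[of j] by (simp only: of_real_eq_0_iff)
    ultimately show "convergent (\<lambda>n. Z (r n) j d)" by (auto simp: convergent_def)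
  next
    show "norm (Z (r n) j x - Z (r n) j y) \<le> (real j * B j) * dist x y" for n x y
      using ZL[of "r n" j x y] by (simp add: dist_norm mult_ac)
  qed
  define z where "z j k = lim (\<lambda>n. Z (r n) j k)" for j k
  have lim: "(\<lambda>n. Z (r n) j k) \<longlonglongrightarrow> z j k" for j k
    using conv[of j k] by (simp add: z_def convergent_LIMSEQ_iff)
  have Zm [measurable]: "Z n j \<in> borel_measurable borel" for n j
    unfolding Z_def by (intro fourier_integral_measurable L2_measurable[OF ball_cut_props(2)[OF wL]])
  have zm [measurable]: "z j \<in> borel_measurable borel" for j
    by (rule borel_measurable_LIMSEQ_metric[OF Zm lim])
  have ZL2: "Z n j \<in> L2" for n j
    unfolding Z_def by (intro plancherel_L1_L2(1) ball_cut_props wL)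
  have ball [measurable]: "cball (0::'a) R \<in> sets borel" for R by simp
  let ?i = "\<lambda>R. indicator (cball 0 R) :: 'a \<Rightarrow> complex"
  have loc: "(\<lambda>n. L2norm (\<lambda>k. ?i R k * Z (r n) j k - ?i R k * z j k)) \<longlonglongrightarrow> 0" for R j
  proof (rule L2_dominated_convergence[where F="\<lambda>k. of_real (B j) * ?i R k"])
    show "(\<lambda>k. of_real (B j) * ?i R k) \<in> L2"
      by (rule L2_cmult[OF L2_indicator_set(1)[OF _ emeasure_cball_finite]]) simp
    show "AE k in lborel. cmod (?i R k * Z (r n) j k) \<le> cmod (of_real (B j) * ?i R k)" for n
      using Zb[of "r n" j] B0[of j] by (auto simp: norm_mult indicator_def)
    show "AE k in lborel. (\<lambda>n. ?i R k * Z (r n) j k) \<longlonglongrightarrow> ?i R k * z j k"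
      by (intro AE_I2 tendsto_mult_left lim)
  qed (intro borel_measurable_times borel_measurable_indicator Zm zm ball)+
  have iZ: "(\<lambda>k. ?i R k * f k) \<in> L2" if "f \<in> L2" for f R by (rule L2_indicator(1)[OF that]) simp
  have iz: "(\<lambda>k. ?i R k * z j k) \<in> L2" for R j
  proof (rule L2_bounded(1)[of "?i R" _ "B j"])
    show "?i R \<in> L2" by (rule L2_indicator_set(1)[OF _ emeasure_cball_finite]) simp
    have "cmod (z j k) \<le> B j" for k using LIMSEQ_le_const2[OF tendsto_norm[OF lim]] Zb by blast
    then show "AE k in lborel. cmod (?i R k * z j k) \<le> B j * cmod (?i R k)" by (auto simp: indicator_def)
  qed (intro borel_measurable_times borel_measurable_indicator Zm zm ball)+
  have Fdiff: "L2norm (\<lambda>k. fourier (w n) k - Z n j k) = L2norm (\<lambda>x. w n x - ball_cut (w n) (real j) x)" for n j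
  proof -
    note b = ball_cut_props(1,2)[OF wL[of n], of "real j"]
    have "L2norm (\<lambda>k. fourier (w n) k - Z n j k) = L2norm (\<lambda>k. fourier (w n) k - fourier (ball_cut (w n) (real j)) k)"
      by (rule L2_cong_AE(2)[OF L2_diff(1)[OF fourier_spec(1)[OF wL] fourier_spec(1)[OF b(2)]]
             L2_measurable[OF L2_diff(1)[OF fourier_spec(1)[OF wL] ZL2]]])
         (use fourier_integrable[OF b(1,2)] in eventually_elim, simp add: Z_def)
    then show ?thesis using fourier_diff_isometry[OF wL b(2)] by simp
  qed
  have "\<exists>K. \<forall>m\<ge>K. \<forall>n\<ge>K. L2norm (\<lambda>x. w (r m) x - w (r n) x) \<le> e" if e: "e > 0" for e
  proof -
    have M0: "M \<ge> 0" using order_trans[OF half_energy_nonneg M[of 0]] .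
    (* frequencies above R carry norm at most e/8 *)
    define R where "R = (M + 1) / (e/8)\<^sup>2"
    have R: "R > 0" using M0 e by (simp add: R_def)
    have "M / R \<le> (e/8)\<^sup>2" using M0 e by (simp add: R_def field_simps)
    then have MR: "sqrt (M / R) \<le> e/8" using e by (intro real_le_lsqrt) auto
    obtain j n0 where j: "\<And>n. n \<ge> n0 \<Longrightarrow> L2norm (\<lambda>x. w n x - ball_cut (w n) (real j) x) \<le> e/8"
      using tight[of "e/8"] e by (metis divide_pos_pos zero_less_numeral)
    obtain K where K: "\<And>m n. m \<ge> K \<Longrightarrow> n \<ge> K \<Longrightarrow>
        L2norm (\<lambda>k. ?i R k * Z (r m) j k - ?i R k * Z (r n) j k) \<le> e/8"
      using L2_convergent_imp_Cauchy[OF iZ[OF ZL2] iz loc, of "e/8" R j] e by auto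
    have "L2norm (\<lambda>x. w (r m) x - w (r n) x) \<le> e" if mn: "m \<ge> max K n0" "n \<ge> max K n0" for m n
    proof -
      let ?F = "\<lambda>n. fourier (w (r n))"
      let ?Z = "\<lambda>n. Z (r n) j"
      have F: "?F n \<in> L2" for n by (rule fourier_spec(1)[OF wL])
      have FZ: "L2norm (\<lambda>k. ?i R k * ?F n k - ?i R k * ?Z n k) \<le> e/8" if "n \<ge> n0" for n
      proof -
        have "L2norm (\<lambda>k. ?i R k * (?F n k - ?Z n k)) \<le> L2norm (\<lambda>k. ?F n k - ?Z n k)"
          by (rule L2_indicator(2)[OF L2_diff(1)[OF F ZL2]]) simp
        also have "\<dots> \<le> e/8" unfolding Fdiff using j seq_suble[OF r(1), of n] that by simp
        finally show ?thesis by (simp add: right_diff_distrib)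
      qed
      have "L2norm (\<lambda>k. ?i R k * ?F m k - ?i R k * ?F n k) \<le>
          L2norm (\<lambda>k. ?i R k * ?F m k - ?i R k * ?Z m k) + (L2norm (\<lambda>k. ?i R k * ?Z m k - ?i R k * ?Z n k)
            + L2norm (\<lambda>k. ?i R k * ?Z n k - ?i R k * ?F n k))"
        using L2norm_triangle_diff[OF iZ[OF F[of m], of R] iZ[OF ZL2[of "r m" j], of R] iZ[OF F[of n], of R]]
          L2norm_triangle_diff[OF iZ[OF ZL2[of "r m" j], of R] iZ[OF ZL2[of "r n" j], of R] iZ[OF F[of n], of R]] by linarith
      also have "\<dots> \<le> e/8 + (e/8 + e/8)"
        using FZ[of m] FZ[of n] K[of m n] mn L2norm_commute[of "\<lambda>k. ?i R k * ?Z n k"] by (intro add_mono) auto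
      finally have low: "L2norm (\<lambda>k. ?i R k * (?F m k - ?F n k)) \<le> e/8 + (e/8 + e/8)"
        by (simp add: right_diff_distrib)
      have h: "L2norm (\<lambda>k. indicator (- cball 0 R) k * ?F n k) \<le> e/8" for n
      proof -
        have "sqrt (half_energy (w (r n)) / R) \<le> sqrt (M / R)" using M R by (simp add: divide_right_mono)
        then show ?thesis using high_frequency_mass(2)[OF w R, of "r n"] MR by linarith
      qed
      have high: "L2norm (\<lambda>k. indicator (- cball 0 R) k * (?F m k - ?F n k)) \<le> e/8 + e/8"
        using L2_diff(2)[OF high_frequency_mass(1)[OF w R, of "r m"] high_frequency_mass(1)[OF w R, of "r n"]] h[of m] h[of n]
        by (simp add: right_diff_distrib)
      have "L2norm (\<lambda>x. w (r m) x - w (r n) x) = L2norm (\<lambda>k. ?F m k - ?F n k)"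
        by (rule fourier_diff_isometry[OF wL wL, symmetric])
      also have "\<dots> \<le> e" using L2norm_indicator_split[OF L2_diff(1)[OF F[of m] F[of n]], of "cball 0 R"] low high e by simp
      finally show ?thesis .
    qed
    then show ?thesis by blast
  qed
  with L2_complete[of "\<lambda>n. w (r n)"] wL r(1) that show ?thesis by blast
qed

section \<open>The quadratic form and the scaling of the energy\<close>

definition drift_symbol :: "real \<Rightarrow> 'a::euclidean_space \<Rightarrow> 'a \<Rightarrow> real" where
  "drift_symbol m v k = sqrt ((norm k)\<^sup>2 + m\<^sup>2) - v \<bullet> k"

definition drift_form :: "real \<Rightarrow> 'a::euclidean_space \<Rightarrow> ('a \<Rightarrow> complex) \<Rightarrow> real" where
  "drift_form m v u = (LINT k|lborel. drift_symbol m v k * (cmod (fourier u k))\<^sup>2)"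

lemma drift_symbol_measurable [measurable]: "drift_symbol m v \<in> borel_measurable borel"
  unfolding drift_symbol_def[abs_def] by measurable

text \<open>
  The symbol is comparable to \<open>|k|\<close>, up to \<open>|m|\<close> from above, since \<open>|v| < 1\<close>. It is Lipschitz because
  \<open>sqrt (|k|\<^sup>2 + m\<^sup>2)\<close> is the norm of the pair \<open>(k, m)\<close>.
\<close>
lemma drift_symbol_bounds:
  assumes v: "norm v < 1"
  shows "(1 - norm v) * norm k \<le> drift_symbol m v k" "0 \<le> drift_symbol m v k"
    "drift_symbol m v k \<le> 2 * norm k + \<bar>m\<bar>"
    "drift_symbol m v (k - l) \<le> drift_symbol m v k + 2 * norm l"
proof -
  have cs: "\<bar>v \<bullet> x\<bar> \<le> norm v * norm x" for x by (rule Cauchy_Schwarz_ineq2)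
  have vle: "norm v * norm x \<le> norm x" for x :: 'a using v mult_right_mono[of "norm v" 1 "norm x"] by simp
  have eq: "sqrt ((norm x)\<^sup>2 + m\<^sup>2) = norm (x, m)" for x :: 'a by (simp add: norm_Pair)
  have "norm k \<le> sqrt ((norm k)\<^sup>2 + m\<^sup>2)" by (rule real_le_rsqrt) simp
  then show 1: "(1 - norm v) * norm k \<le> drift_symbol m v k"
    using cs[of k] unfolding drift_symbol_def left_diff_distrib by linarith
  show "0 \<le> drift_symbol m v k" using order_trans[OF _ 1, of 0] v by simp
  have "norm (k, m) \<le> norm k + \<bar>m\<bar>" using norm_Pair_le[of k m] by simp
  then show "drift_symbol m v k \<le> 2 * norm k + \<bar>m\<bar>"
    using cs[of k] vle[of k] unfolding drift_symbol_def eq by linarith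
  have "norm (k - l, m) \<le> norm (k, m) + norm (l, 0::real)"
    using norm_triangle_ineq4[of "(k, m)" "(l, 0::real)"] by simp
  then show "drift_symbol m v (k - l) \<le> drift_symbol m v k + 2 * norm l"
    using cs[of l] vle[of l] unfolding drift_symbol_def eq by (simp add: inner_diff_right norm_Pair)
qed

lemma drift_form_integrable:
  assumes v: "norm v < 1" and u: "u \<in> H_half"
  shows "integrable lborel (\<lambda>k. drift_symbol m v k * (cmod (fourier u k))\<^sup>2)"
proof (rule Bochner_Integration.integrable_bound)
  note uL = H_half_L2[OF u]
  note [measurable] = fourier_measurable[OF uL]
  show "integrable lborel (\<lambda>k. 2 * (norm k * (cmod (fourier u k))\<^sup>2) + \<bar>m\<bar> * (cmod (fourier u k))\<^sup>2)"
    using H_half_integrable[OF u] L2_integrable[OF fourier_spec(1)[OF uL]] by simp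
  show "(\<lambda>k. drift_symbol m v k * (cmod (fourier u k))\<^sup>2) \<in> borel_measurable lborel" by measurable
  have "norm (drift_symbol m v k * (cmod (fourier u k))\<^sup>2) \<le> 2 * (norm k * (cmod (fourier u k))\<^sup>2) + \<bar>m\<bar> * (cmod (fourier u k))\<^sup>2" for k
    using mult_right_mono[OF drift_symbol_bounds(3)[OF v, of m k], of "(cmod (fourier u k))\<^sup>2"]
      drift_symbol_bounds(2)[OF v, of m k] by (simp add: abs_mult algebra_simps)
  then show "AE k in lborel. norm (drift_symbol m v k * (cmod (fourier u k))\<^sup>2) \<le>
      norm (2 * (norm k * (cmod (fourier u k))\<^sup>2) + \<bar>m\<bar> * (cmod (fourier u k))\<^sup>2)"
    by (auto intro: order_trans[OF _ abs_ge_self])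
qed

lemma drift_form_ge:
  assumes v: "norm v < 1" and u: "u \<in> H_half"
  shows "(1 - norm v) * half_energy u \<le> drift_form m v u" "0 \<le> drift_form m v u"
proof -
  have "(1 - norm v) * half_energy u = (LINT k|lborel. ((1 - norm v) * norm k) * (cmod (fourier u k))\<^sup>2)"
    by (simp add: half_energy_def mult.assoc)
  also have "\<dots> \<le> drift_form m v u" unfolding drift_form_def
  proof (rule integral_mono)
    show "integrable lborel (\<lambda>k. ((1 - norm v) * norm k) * (cmod (fourier u k))\<^sup>2)"
      using H_half_integrable[OF u] by (simp add: mult.assoc)
  qed (use drift_form_integrable[OF v u] drift_symbol_bounds(1)[OF v] in \<open>auto intro!: mult_right_mono\<close>)
  finally show 1: "(1 - norm v) * half_energy u \<le> drift_form m v u" .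
  show "0 \<le> drift_form m v u" using order_trans[OF _ 1, of 0] v by simp
qed

lemma kinetic_form_eq:
  assumes v: "norm v < 1" and u: "u \<in> H_half"
  shows "kinetic_form m v u = drift_form m v u - m * (L2norm u)\<^sup>2"
proof -
  note F = L2_integrable[OF fourier_spec(1)[OF H_half_L2[OF u]]]
  have "kinetic_form m v u = (LINT k|lborel. drift_symbol m v k * (cmod (fourier u k))\<^sup>2 - m * (cmod (fourier u k))\<^sup>2)"
    unfolding kinetic_form_def drift_symbol_def by (simp add: left_diff_distrib algebra_simps)
  also have "\<dots> = drift_form m v u - m * (L2norm (fourier u))\<^sup>2"
    using drift_form_integrable[OF v u] F by (simp add: drift_form_def L2norm_square)
  finally show ?thesis by (simp add: fourier_isometry[OF H_half_L2[OF u]])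
qed

lemma Lq_norm_powr:
  assumes "q > 0" shows "(Lq_norm q u) powr q = (LINT x|lborel. norm (u x) powr q)"
proof -
  have "0 \<le> (LINT x|lborel. norm (u x) powr q)" by (rule integral_nonneg_AE) auto
  then show ?thesis using assms by (simp add: Lq_norm_def powr_powr)
qed

lemma Lq_norm_2: "(Lq_norm 2 u)\<^sup>2 = (L2norm u)\<^sup>2"
proof -
  have "(Lq_norm 2 u)\<^sup>2 = (Lq_norm 2 u) powr 2" by (simp add: Lq_norm_def)
  then show ?thesis by (simp add: Lq_norm_powr L2norm_square)
qed

lemma S_mass_iff: "u \<in> S_mass a \<longleftrightarrow> u \<in> W_half \<and> (L2norm u)\<^sup>2 = a"
  by (simp add: S_mass_def Lq_norm_2)

lemma E_energy_eq:
  assumes v: "norm v < 1" and u: "u \<in> H_half" and p: "p > 0"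
  shows "E_energy m v p u = drift_form m v u / 2 - m * (L2norm u)\<^sup>2 / 2
     - (LINT x|lborel. cmod (u x) powr p) / p - log_term u / 2"
  using p by (simp add: E_energy_def kinetic_form_eq[OF v u] Lq_norm_powr diff_divide_distrib)

lemma log_term_eq:
  assumes u: "u \<in> W_half"
  shows "integrable lborel (\<lambda>x. (cmod (u x))\<^sup>2 * (ln ((cmod (u x))\<^sup>2) - 1))"
    "log_term u = (LINT x|lborel. (cmod (u x))\<^sup>2 * ln ((cmod (u x))\<^sup>2)) - (L2norm u)\<^sup>2"
proof -
  have I: "integrable lborel (\<lambda>x. (cmod (u x))\<^sup>2 * ln ((cmod (u x))\<^sup>2))" "integrable lborel (\<lambda>x. (cmod (u x))\<^sup>2)"
    using u L2_integrable by (auto simp: W_half_def H_half_def)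
  show "integrable lborel (\<lambda>x. (cmod (u x))\<^sup>2 * (ln ((cmod (u x))\<^sup>2) - 1))"
    using Bochner_Integration.integrable_diff[OF I] by (simp add: right_diff_distrib)
  show "log_term u = (LINT x|lborel. (cmod (u x))\<^sup>2 * ln ((cmod (u x))\<^sup>2)) - (L2norm u)\<^sup>2"
    using Bochner_Integration.integral_diff[OF I] by (simp add: log_term_def right_diff_distrib L2norm_square)
qed

lemma W_half_scale:
  assumes w: "w \<in> W_half" and c: "c > 0"
  shows "(\<lambda>x. of_real c * w x) \<in> W_half"
    "norm v < 1 \<Longrightarrow> drift_form m v (\<lambda>x. of_real c * w x) = c\<^sup>2 * drift_form m v w"
    "log_term (\<lambda>x. of_real c * w x) = c\<^sup>2 * log_term w + c\<^sup>2 * ln (c\<^sup>2) * (L2norm w)\<^sup>2"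
    "(LINT x|lborel. cmod (of_real c * w x) powr q) = c powr q * (LINT x|lborel. cmod (w x) powr q)"
    "L2norm (\<lambda>x. of_real c * w x) = c * L2norm w"
proof -
  have wH: "w \<in> H_half" using w by (simp add: W_half_def)
  note wL = H_half_L2[OF wH] note cwL = L2_cmult[OF wL, of "of_real c"]
  note [measurable] = fourier_measurable[OF wL] fourier_measurable[OF cwL]
  have F: "AE k in lborel. (cmod (fourier (\<lambda>x. of_real c * w x) k))\<^sup>2 = c\<^sup>2 * (cmod (fourier w k))\<^sup>2"
    using fourier_cmult[OF wL, of "of_real c"] by eventually_elim (use c in \<open>simp add: norm_mult power_mult_distrib\<close>)
  have "integrable lborel (\<lambda>k. norm k * (cmod (fourier (\<lambda>x. of_real c * w x) k))\<^sup>2)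
      \<longleftrightarrow> integrable lborel (\<lambda>k. c\<^sup>2 * (norm k * (cmod (fourier w k))\<^sup>2))"
    by (rule integrable_cong_AE) (measurable, use F in eventually_elim, simp)
  with H_half_integrable[OF wH] have H: "(\<lambda>x. of_real c * w x) \<in> H_half" by (intro H_half_I cwL) simp
  have pt: "(cmod (of_real c * w x))\<^sup>2 * ln ((cmod (of_real c * w x))\<^sup>2) =
      c\<^sup>2 * ((cmod (w x))\<^sup>2 * ln ((cmod (w x))\<^sup>2)) + c\<^sup>2 * ln (c\<^sup>2) * (cmod (w x))\<^sup>2" for x
  proof (cases "w x = 0")
    case False
    then have "ln ((cmod (of_real c * w x))\<^sup>2) = ln (c\<^sup>2) + ln ((cmod (w x))\<^sup>2)"
      using c by (simp add: norm_mult power_mult_distrib ln_mult)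
    then show ?thesis using c by (simp add: norm_mult power_mult_distrib algebra_simps)
  qed simp
  have I: "integrable lborel (\<lambda>x. (cmod (w x))\<^sup>2 * ln ((cmod (w x))\<^sup>2))" "integrable lborel (\<lambda>x. (cmod (w x))\<^sup>2)"
    using w L2_integrable[OF wL] by (auto simp: W_half_def)
  show W: "(\<lambda>x. of_real c * w x) \<in> W_half"
    using H I by (simp add: W_half_def pt)
  show n: "L2norm (\<lambda>x. of_real c * w x) = c * L2norm w" using c by (simp add: L2norm_cmult)
  show "log_term (\<lambda>x. of_real c * w x) = c\<^sup>2 * log_term w + c\<^sup>2 * ln (c\<^sup>2) * (L2norm w)\<^sup>2"
    unfolding log_term_eq(2)[OF W] log_term_eq(2)[OF w] n pt using I
    by (simp add: L2norm_square[of w] algebra_simps power_mult_distrib)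
  show "(LINT x|lborel. cmod (of_real c * w x) powr q) = c powr q * (LINT x|lborel. cmod (w x) powr q)"
    using c by (simp add: norm_mult powr_mult)
  show "drift_form m v (\<lambda>x. of_real c * w x) = c\<^sup>2 * drift_form m v w" if "norm v < 1"
  proof -
    have "drift_form m v (\<lambda>x. of_real c * w x) = (LINT k|lborel. c\<^sup>2 * (drift_symbol m v k * (cmod (fourier w k))\<^sup>2))"
      unfolding drift_form_def by (rule integral_cong_AE) (measurable, use F in eventually_elim, simp)
    then show ?thesis by (simp add: drift_form_def)
  qed
qed

text \<open>
  Multiply \<open>w\<close> by \<open>c \<ge> 1\<close> to reach mass \<open>a\<close>. The quadratic terms scale by \<open>c\<^sup>2\<close>, the power term by more,
  which only lowers the energy, and the logarithm adds \<open>- c\<^sup>2 log c\<^sup>2\<close> times half of the mass of \<open>w\<close>.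
  This last term makes the bound strictly better than proportional to the mass.
\<close>
lemma energy_lower_bound_by_scaling:
  assumes v: "norm v < 1" and p: "p > 2" and w: "w \<in> W_half"
    and b: "0 < (L2norm w)\<^sup>2" "(L2norm w)\<^sup>2 \<le> a"
    and d: "\<And>\<phi>. \<phi> \<in> S_mass a \<Longrightarrow> d \<le> E_energy m v p \<phi>"
  shows "(L2norm w)\<^sup>2 / a * d + (L2norm w)\<^sup>2 / 2 * ln (a / (L2norm w)\<^sup>2) \<le> E_energy m v p w"
proof -
  let ?b = "(L2norm w)\<^sup>2"
  have a: "a > 0" using b by linarith
  define c where "c = sqrt (a / ?b)"
  have c: "c > 0" "c\<^sup>2 = a / ?b" "c \<ge> 1" 
  proof -
    have q: "0 < a / ?b" "1 \<le> a / ?b" using a b by (simp only: divide_pos_pos, simp only: le_divide_eq_1_pos)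
    show "c > 0" "c\<^sup>2 = a / ?b" "c \<ge> 1" unfolding c_def using q by (simp_all only: real_sqrt_gt_zero real_sqrt_pow2 less_imp_le real_sqrt_ge_1_iff)
  qed
  note s = W_half_scale[OF w c(1)]
  have wH: "w \<in> H_half" using w by (simp add: W_half_def)
  have "(\<lambda>x. of_real c * w x) \<in> S_mass a"
    using s(1) s(5) c b by (simp add: S_mass_iff power_mult_distrib)
  from d[OF this] have "d \<le> drift_form m v (\<lambda>x. of_real c * w x) / 2 - m * (L2norm (\<lambda>x. of_real c * w x))\<^sup>2 / 2
     - (LINT x|lborel. cmod (of_real c * w x) powr p) / p - log_term (\<lambda>x. of_real c * w x) / 2"
    using s(1) p by (subst (asm) E_energy_eq[OF v]) (auto simp: W_half_def)
  also have "\<dots> = c\<^sup>2 * drift_form m v w / 2 - m * (c\<^sup>2 * ?b) / 2 - c powr p * (LINT x|lborel. cmod (w x) powr p) / p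
     - (c\<^sup>2 * log_term w + c\<^sup>2 * ln (c\<^sup>2) * ?b) / 2"
    unfolding s(2)[OF v] s(3-5) by (simp add: power_mult_distrib)
  also have "\<dots> \<le> c\<^sup>2 * drift_form m v w / 2 - m * (c\<^sup>2 * ?b) / 2 - c\<^sup>2 * (LINT x|lborel. cmod (w x) powr p) / p
     - (c\<^sup>2 * log_term w + c\<^sup>2 * ln (c\<^sup>2) * ?b) / 2"
  proof -
    have "c powr 2 \<le> c powr p" using c p by (intro powr_mono) auto
    then have "c\<^sup>2 \<le> c powr p" using c(1) by simp
    moreover have "0 \<le> (LINT x|lborel. cmod (w x) powr p)" by (rule integral_nonneg_AE) auto
    ultimately have "c\<^sup>2 * (LINT x|lborel. cmod (w x) powr p) / p \<le> c powr p * (LINT x|lborel. cmod (w x) powr p) / p"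
      using p by (intro divide_right_mono mult_right_mono) auto
    then show ?thesis by simp
  qed
  also have "\<dots> = c\<^sup>2 * (E_energy m v p w - ?b / 2 * ln (c\<^sup>2))"
    using p by (subst E_energy_eq[OF v wH]) (auto simp: algebra_simps)
  finally have "d \<le> a / ?b * (E_energy m v p w - ?b / 2 * ln (a / ?b))" unfolding c(2) .
  then have "?b / a * d \<le> ?b / a * (a / ?b * (E_energy m v p w - ?b / 2 * ln (a / ?b)))"
    by (rule mult_left_mono) (use a in simp)
  also have "\<dots> = E_energy m v p w - ?b / 2 * ln (a / ?b)"
  proof -
    have "?b / a * (a / ?b * X) = X" for X using a b(1) by simp
    then show ?thesis .
  qed
  finally show ?thesis by simp
qed

section \<open>Localization with translates of a cutoff\<close>

definition localize :: "('a::euclidean_space \<Rightarrow> real) \<Rightarrow> ('a \<Rightarrow> complex) \<Rightarrow> 'a \<Rightarrow> 'a \<Rightarrow> complex" where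
  "localize \<eta> u y x = of_real (\<eta> (x - y)) * u x"

definition cutoff :: "('a::euclidean_space \<Rightarrow> real) \<Rightarrow> real \<Rightarrow> bool" where
  "cutoff \<eta> L \<longleftrightarrow> \<eta> \<in> borel_measurable borel \<and> (\<forall>x. 0 \<le> \<eta> x \<and> \<eta> x \<le> 1) \<and> (\<forall>x. L < norm x \<longrightarrow> \<eta> x = 0)"

lemma cutoffD:
  assumes "cutoff \<eta> L"
  shows "\<eta> \<in> borel_measurable borel" "0 \<le> \<eta> x" "\<eta> x \<le> 1" "L < norm x \<Longrightarrow> \<eta> x = 0"
  using assms by (auto simp: cutoff_def)

lemma cutoff_integrable:
  fixes \<eta> :: "'a::euclidean_space \<Rightarrow> real"
  assumes \<eta>: "cutoff \<eta> L" and f: "f \<in> borel_measurable borel" "f 0 = 0" "\<And>s. 0 \<le> s \<Longrightarrow> s \<le> 1 \<Longrightarrow> \<bar>f s\<bar> \<le> C"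
  shows "integrable lborel (\<lambda>x. f (\<eta> x) :: real)"
proof (rule Bochner_Integration.integrable_bound)
  show "integrable lborel (\<lambda>x. C * indicator (cball (0::'a) L) x)"
    using emeasure_cball_finite[of 0 L] by (intro integrable_mult_right integrable_real_indicator) auto
  have "\<bar>f (\<eta> x)\<bar> \<le> \<bar>C * indicator (cball 0 L) x\<bar>" for x
    using f(2) f(3)[of "\<eta> x"] cutoffD(2-4)[OF \<eta>, of x] by (cases "norm x \<le> L") auto
  then show "AE x in lborel. norm (f (\<eta> x)) \<le> norm (C * indicator (cball (0::'a) L) x)" by simp
qed (use f(1) cutoffD(1)[OF \<eta>] in measurable)

lemma cutoff_L2:
  assumes \<eta>: "cutoff \<eta> L"
  shows "(\<lambda>x. complex_of_real (\<eta> x)) \<in> L2" "integrable lborel (\<lambda>x. complex_of_real (\<eta> x))"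
    "(L2norm (\<lambda>x. complex_of_real (\<eta> x)))\<^sup>2 = (LINT x|lborel. (\<eta> x)\<^sup>2)"
proof -
  have "integrable lborel (\<lambda>x. (\<eta> x)\<^sup>2)"
    by (rule cutoff_integrable[OF \<eta>, where C=1]) (auto simp: power_le_one)
  then show "(\<lambda>x. complex_of_real (\<eta> x)) \<in> L2"
    using cutoffD(1)[OF \<eta>] by (simp add: L2_def)
  have "integrable lborel \<eta>" by (rule cutoff_integrable[OF \<eta>, where C=1 and f="\<lambda>s. s"]) auto
  then show "integrable lborel (\<lambda>x. complex_of_real (\<eta> x))" by simp
  show "(L2norm (\<lambda>x. complex_of_real (\<eta> x)))\<^sup>2 = (LINT x|lborel. (\<eta> x)\<^sup>2)" by (simp add: L2norm_square)
qed

lemma localize_L2: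
  fixes u :: "'a::euclidean_space \<Rightarrow> complex"
  assumes u: "u \<in> L2" and \<eta>: "cutoff \<eta> L"
  shows "localize \<eta> u y \<in> L2" "integrable lborel (localize \<eta> u y)"
proof -
  have m: "(\<lambda>x. complex_of_real (\<eta> (x - y))) \<in> borel_measurable borel" using cutoffD(1)[OF \<eta>] by measurable
  show "localize \<eta> u y \<in> L2" unfolding localize_def[abs_def]
    by (rule L2_mult(1)[OF u m, of 1]) (use cutoffD[OF \<eta>] in auto)
  have \<eta>y: "(\<lambda>x. complex_of_real (\<eta> (x - y))) \<in> L2" using L2_shift(1)[OF cutoff_L2(1)[OF \<eta>], of "-y"] by simp
  have "integrable lborel (\<lambda>x. u x * cnj (complex_of_real (\<eta> (x - y))))"
    by (rule L2_product_integrable[OF u \<eta>y])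
  then show "integrable lborel (localize \<eta> u y)" unfolding localize_def[abs_def] by (simp add: mult.commute)
qed

text \<open>
  For a fixed frequency \<open>k\<close>, the transform of \<open>\<eta>(\<cdot> - y) u\<close> at \<open>k\<close> is, as a function of \<open>y\<close>, the
  reflected Fourier integral of \<open>l \<mapsto> u\<^sup>^(k + l) cnj \<eta>\<^sup>^(l)\<close>, to which Plancherel's theorem applies.
\<close>
lemma localized_transform_mass:
  fixes u :: "'a::euclidean_space \<Rightarrow> complex"
  assumes u: "u \<in> L2" and \<eta>: "cutoff \<eta> L"
  defines "X \<equiv> fourier_integral (\<lambda>x. complex_of_real (\<eta> x))"
  shows "(\<integral>\<^sup>+y. ennreal ((cmod (fourier_integral (localize \<eta> u y) k))\<^sup>2) \<partial>lborel) =
     (\<integral>\<^sup>+l. ennreal ((cmod (fourier u (k + l)))\<^sup>2 * (cmod (X l))\<^sup>2) \<partial>lborel)"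
proof -
  let ?c = "complex_of_real ((2 * pi) powr (- real DIM('a) / 2))"
  let ?\<eta> = "\<lambda>y x. complex_of_real (\<eta> (x - y))"
  note \<eta>L = cutoff_L2[OF \<eta>]
  have X: "X \<in> L2" unfolding X_def by (rule plancherel_L1_L2(1)[OF \<eta>L(2,1)])
  obtain C where C: "\<And>l. cmod (X l) \<le> C" unfolding X_def using fourier_integral_bound by blast
  let ?f = "\<lambda>x. cis (- (k \<bullet> x)) * u x"
  have f: "?f \<in> L2" by (rule L2_mult(1)[OF u, of _ 1]) auto
  have Ff: "AE l in lborel. fourier ?f l = fourier u (l + k)" by (rule fourier_modulate[OF u])
  have uk: "(\<lambda>l. fourier u (l + k)) \<in> L2" by (rule L2_shift(1)[OF fourier_spec(1)[OF u]])
  define G where "G l = fourier u (l + k) * cnj (X l)" for l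
  have Gint: "integrable lborel G" unfolding G_def[abs_def] by (rule L2_product_integrable[OF uk X])
  have "(\<lambda>l. cnj (X l)) \<in> borel_measurable borel" using L2_measurable[OF X] by measurable
  from L2_mult(1)[OF uk this, of C] C have GL: "G \<in> L2" by (simp add: G_def[abs_def] mult.commute)
  have key: "fourier_integral (localize \<eta> u y) k = fourier_integral G (- y)" for y
  proof -
    have \<eta>y: "?\<eta> y \<in> L2" "integrable lborel (?\<eta> y)"
      using L2_shift(1)[OF \<eta>L(1), of "-y"] integrable_lborel_shift[OF \<eta>L(2), of "-y"] by simp_all
    have F\<eta>: "AE l in lborel. fourier (?\<eta> y) l = cis (- (l \<bullet> y)) * X l"
      using fourier_integrable[OF \<eta>y(2,1)] fourier_integral_translate[OF \<eta>L(2), of y] by (simp add: X_def)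
    have "fourier_integral (localize \<eta> u y) k = ?c * (LINT x|lborel. ?f x * cnj (?\<eta> y x))"
      by (simp add: fourier_integral_def localize_def mult_ac)
    also have "(LINT x|lborel. ?f x * cnj (?\<eta> y x)) = (LINT l|lborel. fourier ?f l * cnj (fourier (?\<eta> y) l))"
      by (rule parseval[OF f \<eta>y(1), symmetric])
    also have "\<dots> = (LINT l|lborel. cis (- ((- y) \<bullet> l)) * G l)"
    proof (rule integral_cong_AE)
      note [measurable] = fourier_measurable[OF f] fourier_measurable[OF \<eta>y(1)] L2_measurable[OF GL]
      show "(\<lambda>l. fourier ?f l * cnj (fourier (?\<eta> y) l)) \<in> borel_measurable lborel" by measurable
      show "(\<lambda>l. cis (- ((- y) \<bullet> l)) * G l) \<in> borel_measurable lborel" by measurable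
      show "AE l in lborel. fourier ?f l * cnj (fourier (?\<eta> y) l) = cis (- ((- y) \<bullet> l)) * G l"
        using Ff F\<eta> by eventually_elim (simp add: G_def cis_cnj inner_commute mult_ac)
    qed
    finally show ?thesis by (simp add: fourier_integral_def)
  qed
  have [measurable]: "fourier_integral G \<in> borel_measurable borel"
    using L2_measurable[OF GL] by measurable
  have "(\<integral>\<^sup>+y. ennreal ((cmod (fourier_integral (localize \<eta> u y) k))\<^sup>2) \<partial>lborel) =
      (\<integral>\<^sup>+y. ennreal ((cmod (fourier_integral G y))\<^sup>2) \<partial>lborel)"
    unfolding key by (rule nn_integral_lborel_uminus) measurable
  also have "\<dots> = (\<integral>\<^sup>+l. ennreal ((cmod (G l))\<^sup>2) \<partial>lborel)"
    using nn_integral_L2[OF plancherel_L1_L2(1)[OF Gint GL]] nn_integral_L2[OF GL] plancherel_L1_L2(2)[OF Gint GL] by simp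
  finally show ?thesis by (simp add: G_def norm_mult power_mult_distrib add.commute)
qed

lemma localized_transform_measurable:
  fixes u :: "'a::euclidean_space \<Rightarrow> complex"
  assumes u: "u \<in> borel_measurable borel" and \<eta>: "\<eta> \<in> borel_measurable borel"
  shows "(\<lambda>(y, k). fourier_integral (localize \<eta> u y) k) \<in> borel_measurable (borel \<Otimes>\<^sub>M borel)"
proof -
  note [measurable] = u \<eta>
  have "(\<lambda>z. LINT x|lborel. cis (- (snd z \<bullet> x)) * (of_real (\<eta> (x - fst z)) * u x)) \<in> borel_measurable (borel \<Otimes>\<^sub>M borel)"
    by (intro lborel.borel_measurable_lebesgue_integral) measurable
  then show ?thesis unfolding fourier_integral_def localize_def case_prod_unfold by measurable
qed

text \<open>
  Averaged over the positions of the cutoff, localization convolves \<open>|u\<^sup>^|\<^sup>2\<close> with \<open>|\<eta>\<^sup>^|\<^sup>2\<close>. The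
  symbol is Lipschitz, so this costs no more than the first moment of \<open>|\<eta>\<^sup>^|\<^sup>2\<close>.
\<close>
lemma localized_drift_average:
  fixes u :: "'a::euclidean_space \<Rightarrow> complex"
  assumes v: "norm v < 1" and u: "u \<in> H_half" and \<eta>: "cutoff \<eta> L"
    and I: "(\<integral>\<^sup>+l. ennreal (norm l * (cmod (fourier_integral (\<lambda>x. complex_of_real (\<eta> x)) l))\<^sup>2) \<partial>lborel) \<le> ennreal J"
    and J: "J \<ge> 0"
  shows "(\<integral>\<^sup>+y. \<integral>\<^sup>+k. ennreal (drift_symbol m v k * (cmod (fourier_integral (localize \<eta> u y) k))\<^sup>2) \<partial>lborel \<partial>lborel)
    \<le> ennreal ((LINT x|lborel. (\<eta> x)\<^sup>2) * drift_form m v u + 2 * (L2norm u)\<^sup>2 * J)"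
proof -
  define X where "X = fourier_integral (\<lambda>x. complex_of_real (\<eta> x))"
  note uL = H_half_L2[OF u] note \<eta>L = cutoff_L2[OF \<eta>]
  let ?\<psi> = "drift_symbol m v"
  note \<psi>0 = drift_symbol_bounds(2)[OF v, of m]
  have XL: "X \<in> L2" unfolding X_def by (rule plancherel_L1_L2(1)[OF \<eta>L(2,1)])
  note [measurable] = L2_measurable[OF uL] cutoffD(1)[OF \<eta>] fourier_measurable[OF uL] L2_measurable[OF XL]
  note [measurable] = localized_transform_measurable[OF L2_measurable[OF uL] cutoffD(1)[OF \<eta>], unfolded case_prod_unfold]
  let ?F = "\<lambda>y k. fourier_integral (localize \<eta> u y) k"
  have "(\<integral>\<^sup>+y. \<integral>\<^sup>+k. ennreal (?\<psi> k * (cmod (?F y k))\<^sup>2) \<partial>lborel \<partial>lborel) =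
      (\<integral>\<^sup>+k. \<integral>\<^sup>+y. ennreal (?\<psi> k * (cmod (?F y k))\<^sup>2) \<partial>lborel \<partial>lborel)"
    by (rule lborel_pair.Fubini'[symmetric]) (simp add: case_prod_unfold, measurable)
  also have "\<dots> = (\<integral>\<^sup>+k. ennreal (?\<psi> k) * (\<integral>\<^sup>+l. ennreal ((cmod (fourier u (k + l)))\<^sup>2 * (cmod (X l))\<^sup>2) \<partial>lborel) \<partial>lborel)"
  proof (rule nn_integral_cong)
    fix k
    have m: "(\<lambda>y. ?F y k) \<in> borel_measurable borel"
      using localized_transform_measurable[OF L2_measurable[OF uL] cutoffD(1)[OF \<eta>]] by measurable
    have "(\<integral>\<^sup>+y. ennreal (?\<psi> k * (cmod (?F y k))\<^sup>2) \<partial>lborel) = ennreal (?\<psi> k) * (\<integral>\<^sup>+y. ennreal ((cmod (?F y k))\<^sup>2) \<partial>lborel)"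
      by (subst nn_integral_cmult[symmetric]) (use m \<psi>0 in \<open>auto simp: ennreal_mult\<close>)
    then show "(\<integral>\<^sup>+y. ennreal (?\<psi> k * (cmod (?F y k))\<^sup>2) \<partial>lborel) =
        ennreal (?\<psi> k) * (\<integral>\<^sup>+l. ennreal ((cmod (fourier u (k + l)))\<^sup>2 * (cmod (X l))\<^sup>2) \<partial>lborel)"
      unfolding localized_transform_mass[OF uL \<eta>] X_def .
  qed
  also have "\<dots> = (\<integral>\<^sup>+k. \<integral>\<^sup>+l. ennreal (?\<psi> k * (cmod (fourier u (k + l)))\<^sup>2 * (cmod (X l))\<^sup>2) \<partial>lborel \<partial>lborel)"
    by (intro nn_integral_cong, subst nn_integral_cmult[symmetric]) (auto simp: ennreal_mult \<psi>0 mult.assoc)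
  also have "\<dots> = (\<integral>\<^sup>+l. \<integral>\<^sup>+k. ennreal (?\<psi> k * (cmod (fourier u (k + l)))\<^sup>2 * (cmod (X l))\<^sup>2) \<partial>lborel \<partial>lborel)"
    by (rule lborel_pair.Fubini'[symmetric]) (simp add: case_prod_unfold, measurable)
  also have "\<dots> = (\<integral>\<^sup>+l. \<integral>\<^sup>+k. ennreal (?\<psi> (k - l) * (cmod (fourier u k))\<^sup>2 * (cmod (X l))\<^sup>2) \<partial>lborel \<partial>lborel)"
  proof (rule nn_integral_cong)
    fix l
    show "(\<integral>\<^sup>+k. ennreal (?\<psi> k * (cmod (fourier u (k + l)))\<^sup>2 * (cmod (X l))\<^sup>2) \<partial>lborel) =
        (\<integral>\<^sup>+k. ennreal (?\<psi> (k - l) * (cmod (fourier u k))\<^sup>2 * (cmod (X l))\<^sup>2) \<partial>lborel)"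
      using nn_integral_lborel_shift[of "\<lambda>k. ennreal (?\<psi> (k - l) * (cmod (fourier u k))\<^sup>2 * (cmod (X l))\<^sup>2)" l] by simp
  qed
  also have "\<dots> \<le> (\<integral>\<^sup>+l. ennreal (drift_form m v u * (cmod (X l))\<^sup>2 + 2 * (L2norm u)\<^sup>2 * (norm l * (cmod (X l))\<^sup>2)) \<partial>lborel)"
  proof (rule nn_integral_mono)
    fix l
    let ?g = "\<lambda>k. (cmod (X l))\<^sup>2 * (?\<psi> k * (cmod (fourier u k))\<^sup>2) + 2 * norm l * (cmod (X l))\<^sup>2 * (cmod (fourier u k))\<^sup>2"
    note i = drift_form_integrable[OF v u, of m] L2_integrable[OF fourier_spec(1)[OF uL]]
    have gi: "integrable lborel ?g" using i by simp
    have "?\<psi> (k - l) * (cmod (fourier u k))\<^sup>2 * (cmod (X l))\<^sup>2 \<le> ?g k" for k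
    proof -
      have "?\<psi> (k - l) * ((cmod (fourier u k))\<^sup>2 * (cmod (X l))\<^sup>2) \<le> (?\<psi> k + 2 * norm l) * ((cmod (fourier u k))\<^sup>2 * (cmod (X l))\<^sup>2)"
        by (intro mult_right_mono drift_symbol_bounds(4)[OF v]) auto
      then show ?thesis by (simp add: algebra_simps)
    qed
    then have "(\<integral>\<^sup>+k. ennreal (?\<psi> (k - l) * (cmod (fourier u k))\<^sup>2 * (cmod (X l))\<^sup>2) \<partial>lborel) \<le> (\<integral>\<^sup>+k. ennreal (?g k) \<partial>lborel)"
      by (intro nn_integral_mono ennreal_leI)
    also have "\<dots> = ennreal (LINT k|lborel. ?g k)" by (rule nn_integral_eq_integral[OF gi]) (auto simp: \<psi>0)
    also have "(LINT k|lborel. ?g k) = (cmod (X l))\<^sup>2 * drift_form m v u + 2 * norm l * (cmod (X l))\<^sup>2 * (L2norm (fourier u))\<^sup>2"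
      using i by (simp add: drift_form_def L2norm_square)
    finally show "(\<integral>\<^sup>+k. ennreal (?\<psi> (k - l) * (cmod (fourier u k))\<^sup>2 * (cmod (X l))\<^sup>2) \<partial>lborel) \<le>
        ennreal (drift_form m v u * (cmod (X l))\<^sup>2 + 2 * (L2norm u)\<^sup>2 * (norm l * (cmod (X l))\<^sup>2))"
      by (simp add: fourier_isometry[OF uL] mult_ac)
  qed
  also have "\<dots> = ennreal (drift_form m v u) * (\<integral>\<^sup>+l. ennreal ((cmod (X l))\<^sup>2) \<partial>lborel)
      + ennreal (2 * (L2norm u)\<^sup>2) * (\<integral>\<^sup>+l. ennreal (norm l * (cmod (X l))\<^sup>2) \<partial>lborel)"
    using drift_form_ge(2)[OF v u]
    by (subst nn_integral_cmult[symmetric], simp, subst nn_integral_cmult[symmetric], simp,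
        subst nn_integral_add[symmetric]) (auto simp: ennreal_mult ennreal_plus)
  also have "\<dots> \<le> ennreal (drift_form m v u) * ennreal (LINT x|lborel. (\<eta> x)\<^sup>2) + ennreal (2 * (L2norm u)\<^sup>2) * ennreal J"
  proof (intro add_mono mult_left_mono)
    show "(\<integral>\<^sup>+l. ennreal ((cmod (X l))\<^sup>2) \<partial>lborel) \<le> ennreal (LINT x|lborel. (\<eta> x)\<^sup>2)"
      unfolding nn_integral_L2[OF XL] \<eta>L(3)[symmetric] unfolding X_def plancherel_L1_L2(2)[OF \<eta>L(2,1)] by simp
    show "(\<integral>\<^sup>+l. ennreal (norm l * (cmod (X l))\<^sup>2) \<partial>lborel) \<le> ennreal J" using I unfolding X_def .
  qed auto
  also have "\<dots> = ennreal ((LINT x|lborel. (\<eta> x)\<^sup>2) * drift_form m v u + 2 * (L2norm u)\<^sup>2 * J)"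
    using drift_form_ge(2)[OF v u] J by (simp add: ennreal_mult[symmetric] ennreal_plus[symmetric] mult.commute del: ennreal_plus)
  finally show ?thesis .
qed

section \<open>Cutoffs with small localization cost\<close>

definition plateau :: "real \<Rightarrow> 'a::euclidean_space \<Rightarrow> real" where
  "plateau L x = max 0 (min 1 (L + 1 - norm x))"

lemma plateau_cutoff: "cutoff (plateau L :: 'a::euclidean_space \<Rightarrow> real) (L + 1)"
  unfolding cutoff_def plateau_def[abs_def] by (auto simp: max_def min_def)

lemma plateau_lipschitz: "\<bar>plateau L x - plateau L y\<bar> \<le> norm (x - y)"
proof -
  have "\<bar>norm x - norm y\<bar> \<le> norm (x - y)" by (rule norm_triangle_ineq3)
  then show ?thesis unfolding plateau_def max_def min_def by (auto split: if_splits)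
qed

lemma plateau_eq: "norm x \<le> L \<Longrightarrow> plateau L x = 1" "L + 1 \<le> norm x \<Longrightarrow> plateau L x = 0"
  by (auto simp: plateau_def)

definition transition_shell :: "real \<Rightarrow> 'a::euclidean_space set" where
  "transition_shell L = cball 0 (L + 2) - cball 0 (L - 1)"

lemma transition_shell_measure:
  assumes L: "L \<ge> 1"
  shows "(transition_shell L :: 'a::euclidean_space set) \<in> sets borel" "emeasure lborel (transition_shell L :: 'a set) < \<infinity>"
    "measure lborel (transition_shell L :: 'a set) = unit_ball_vol DIM('a) * ((L + 2) ^ DIM('a) - (L - 1) ^ DIM('a))"
proof -
  show "(transition_shell L :: 'a set) \<in> sets borel" unfolding transition_shell_def by simp
  have "emeasure lborel (transition_shell L :: 'a set) \<le> emeasure lborel (cball (0::'a) (L + 2))"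
    unfolding transition_shell_def by (rule emeasure_mono) auto
  then show "emeasure lborel (transition_shell L :: 'a set) < \<infinity>"
    using emeasure_cball_finite le_less_trans by blast
  have "measure lborel (transition_shell L :: 'a set) = measure lborel (cball (0::'a) (L + 2)) - measure lborel (cball (0::'a) (L - 1))"
    unfolding transition_shell_def using emeasure_cball_finite[of "0::'a"]
    by (intro measure_Diff) (auto simp: less_top)
  then show "measure lborel (transition_shell L :: 'a set) = unit_ball_vol DIM('a) * ((L + 2) ^ DIM('a) - (L - 1) ^ DIM('a))"
    using L content_cball[of "L + 2" "0::'a"] content_cball[of "L - 1" "0::'a"] by (simp add: right_diff_distrib)
qed

lemma cis_difference_quotient:
  "(\<lambda>n. complex_of_real (real (Suc n)) * (cis (- (\<alpha> / real (Suc n))) - 1)) \<longlonglongrightarrow> - (\<i> * of_real \<alpha>)"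
proof -
  have bound: "cmod (cis x - 1 - \<i> * of_real x) \<le> x\<^sup>2" for x
  proof -
    have "cmod (iexp x - (1 + \<i> * of_real x)) \<le> \<bar>x\<bar>\<^sup>2 / 2"
      using iexp_approx1[of x 1] by (simp add: power2_eq_square)
    also have "\<dots> \<le> x\<^sup>2" by simp
    finally show ?thesis unfolding cis_conv_exp by (simp add: algebra_simps)
  qed
  have "(\<lambda>n. complex_of_real (real (Suc n)) * (cis (- (\<alpha> / real (Suc n))) - 1) - - (\<i> * of_real \<alpha>)) \<longlonglongrightarrow> 0"
  proof (rule Lim_null_comparison)
    have "(\<lambda>n. \<alpha>\<^sup>2 * (1 / real (Suc n))) \<longlonglongrightarrow> \<alpha>\<^sup>2 * 0" by (intro tendsto_intros LIMSEQ_Suc[OF lim_1_over_n])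
    then show "(\<lambda>n. \<alpha>\<^sup>2 * (1 / real (Suc n))) \<longlonglongrightarrow> 0" by simp
    have "norm (complex_of_real (real (Suc n)) * (cis (- (\<alpha> / real (Suc n))) - 1) - - (\<i> * of_real \<alpha>)) \<le> \<alpha>\<^sup>2 * (1 / real (Suc n))" for n
    proof -
      let ?N = "real (Suc n)"
      have "complex_of_real ?N * (cis (- (\<alpha> / ?N)) - 1) - - (\<i> * of_real \<alpha>) =
          of_real ?N * (cis (- (\<alpha> / ?N)) - 1 - \<i> * of_real (- (\<alpha> / ?N)))"
      proof -
        have "complex_of_real ?N * (\<i> * of_real (- (\<alpha> / ?N))) = - (\<i> * of_real (?N * (\<alpha> / ?N)))"
          unfolding of_real_mult of_real_minus by (simp only: mult.left_commute mult_minus_right)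
        also have "?N * (\<alpha> / ?N) = \<alpha>" by simp
        finally show ?thesis by (simp only: right_diff_distrib)
      qed
      then have "norm (complex_of_real ?N * (cis (- (\<alpha> / ?N)) - 1) - - (\<i> * of_real \<alpha>)) \<le> ?N * (- (\<alpha> / ?N))\<^sup>2"
        using mult_left_mono[OF bound[of "- (\<alpha> / ?N)"], of ?N] by (simp only: norm_mult norm_of_real) simp
      also have "?N * (- (\<alpha> / ?N))\<^sup>2 = \<alpha>\<^sup>2 * (1 / ?N)" by (simp add: power2_eq_square)
      finally show ?thesis .
    qed
    then show "\<forall>\<^sub>F n in sequentially. norm (complex_of_real (real (Suc n)) * (cis (- (\<alpha> / real (Suc n))) - 1) - - (\<i> * of_real \<alpha>)) \<le> \<alpha>\<^sup>2 * (1 / real (Suc n))"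
      by (intro always_eventually allI)
  qed
  then show ?thesis by (simp only: LIM_zero_iff)
qed

text \<open>
  The difference quotients of the cutoff in direction \<open>b\<close> are bounded by \<open>1\<close> and live in the transition
  shell; on the Fourier side they converge to multiplication by \<open>- \<i> (l \<bullet> b)\<close>, so Fatou's lemma applies.
\<close>
lemma plateau_directional_moment:
  fixes b :: "'a::euclidean_space"
  assumes L: "L \<ge> 1" and b: "b \<in> Basis"
  shows "(\<integral>\<^sup>+l. ennreal ((l \<bullet> b)\<^sup>2 * (cmod (fourier_integral (\<lambda>x::'a. complex_of_real (plateau L x)) l))\<^sup>2) \<partial>lborel)
     \<le> ennreal (measure lborel (transition_shell L :: 'a set))"
proof -
  let ?\<eta> = "\<lambda>x::'a. complex_of_real (plateau L x)"
  let ?X = "fourier_integral ?\<eta>"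
  let ?S = "transition_shell L :: 'a set"
  let ?N = "\<lambda>n. real (Suc n)"
  let ?h = "\<lambda>n. (1 / ?N n) *\<^sub>R b"
  let ?D = "\<lambda>n x. of_real (?N n) * ?\<eta> (x - ?h n) + (- of_real (?N n)) * ?\<eta> x"
  note \<eta>L = cutoff_L2[OF plateau_cutoff[where 'a='a and L=L]]
  note S = transition_shell_measure[OF L, where 'a='a]
  have sh: "(\<lambda>x. ?\<eta> (x - t)) \<in> L2" "integrable lborel (\<lambda>x. ?\<eta> (x - t))" for t
    using L2_shift(1)[OF \<eta>L(1), of "-t"] integrable_lborel_shift[OF \<eta>L(2), of "-t"] by simp_all
  have D: "?D n \<in> L2" "integrable lborel (?D n)" for n
    by (intro L2_add(1) L2_cmult sh \<eta>L) (intro Bochner_Integration.integrable_add integrable_mult_right sh \<eta>L)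
  have FD: "fourier_integral (?D n) l = of_real (?N n) * (cis (- ((l \<bullet> b) / ?N n)) - 1) * ?X l" for n l
    unfolding fourier_integral_linear[OF sh(2) \<eta>L(2)] fourier_integral_translate[OF \<eta>L(2)]
    by (simp add: algebra_simps)
  have Dle: "(cmod (?D n x))\<^sup>2 \<le> indicator ?S x" for n x
  proof -
    have nb: "norm (?h n) = 1 / ?N n" using b by simp
    have n1: "1 / ?N n \<le> 1" by simp
    have tri: "\<bar>norm (x - ?h n) - norm x\<bar> \<le> 1 / ?N n"
      using norm_triangle_ineq3[of "x - ?h n" x] nb by simp
    have Deq: "cmod (?D n x) = ?N n * \<bar>plateau L (x - ?h n) - plateau L x\<bar>"
    proof -
      have "?D n x = complex_of_real (?N n * (plateau L (x - ?h n) - plateau L x))"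
        by (simp only: of_real_mult of_real_diff right_diff_distrib mult_minus_left add_uminus_conv_diff)
      then show ?thesis by (simp only: norm_of_real abs_mult abs_of_nat)
    qed
    show ?thesis
    proof (cases "x \<in> ?S")
      case True
      have "\<bar>plateau L (x - ?h n) - plateau L x\<bar> \<le> 1 / ?N n"
        using plateau_lipschitz[of L "x - ?h n" x] nb by simp
      then have "?N n * \<bar>plateau L (x - ?h n) - plateau L x\<bar> \<le> ?N n * (1 / ?N n)"
        by (intro mult_left_mono) auto
      then have "cmod (?D n x) \<le> 1" unfolding Deq by simp
      then show ?thesis using True by (simp add: power_le_one)
    next
      case False
      then consider "norm x \<le> L - 1" | "norm x > L + 2" by (auto simp: transition_shell_def not_le)
      then have "plateau L (x - ?h n) = plateau L x"
      proof cases
        case 1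
        then have "norm (x - ?h n) \<le> L" "norm x \<le> L" using tri n1 by linarith+
        then show ?thesis by (simp add: plateau_eq(1))
      next
        case 2
        then have "norm (x - ?h n) \<ge> L + 1" "norm x \<ge> L + 1" using tri n1 by linarith+
        then show ?thesis by (simp add: plateau_eq(2))
      qed
      then show ?thesis unfolding Deq by simp
    qed
  qed
  show ?thesis
  proof (rule nn_integral_Fatou_bound[where b="\<lambda>_. measure lborel ?S"])
    show "(\<lambda>l. ennreal ((cmod (fourier_integral (?D n) l))\<^sup>2)) \<in> borel_measurable lborel" for n
      using fourier_integral_measurable[OF L2_measurable[OF D(1)]] by measurable
    show "AE l in lborel. (\<lambda>n. ennreal ((cmod (fourier_integral (?D n) l))\<^sup>2)) \<longlonglongrightarrow> ennreal ((l \<bullet> b)\<^sup>2 * (cmod (?X l))\<^sup>2)"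
    proof (intro AE_I2 tendsto_ennrealI)
      fix l
      have "(\<lambda>n. (cmod (fourier_integral (?D n) l))\<^sup>2) \<longlonglongrightarrow> (cmod (- (\<i> * of_real (l \<bullet> b)) * ?X l))\<^sup>2"
        unfolding FD by (intro tendsto_power tendsto_norm tendsto_mult_right cis_difference_quotient)
      then show "(\<lambda>n. (cmod (fourier_integral (?D n) l))\<^sup>2) \<longlonglongrightarrow> (l \<bullet> b)\<^sup>2 * (cmod (?X l))\<^sup>2"
        by (simp add: norm_mult power_mult_distrib)
    qed
    fix n
    have "(\<integral>\<^sup>+l. ennreal ((cmod (fourier_integral (?D n) l))\<^sup>2) \<partial>lborel) = (\<integral>\<^sup>+x. ennreal ((cmod (?D n x))\<^sup>2) \<partial>lborel)"
      by (simp only: nn_integral_L2[OF plancherel_L1_L2(1)[OF D(2,1)]] nn_integral_L2[OF D(1)] plancherel_L1_L2(2)[OF D(2,1)])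
    also have "\<dots> \<le> (\<integral>\<^sup>+x. ennreal (indicator ?S x) \<partial>lborel)" by (intro nn_integral_mono ennreal_leI Dle)
    also have "\<dots> = emeasure lborel ?S" using S(1) by (simp add: ennreal_indicator)
    also have "\<dots> = ennreal (measure lborel ?S)" using S(2) by (simp add: emeasure_eq_ennreal_measure)
    finally show "(\<integral>\<^sup>+l. ennreal ((cmod (fourier_integral (?D n) l))\<^sup>2) \<partial>lborel) \<le> ennreal (measure lborel ?S)" .
  qed simp
qed

text \<open>
  Young's inequality \<open>|l| \<le> e/2 + |l|\<^sup>2 / (2 e)\<close> trades the first moment for the mass and the second
  moment. The latter is the sum of the directional ones.
\<close>
lemma plateau_moment:
  assumes L: "L \<ge> 1" and e: "e > 0"
  shows "(\<integral>\<^sup>+l. ennreal (norm l * (cmod (fourier_integral (\<lambda>x::'a::euclidean_space. complex_of_real (plateau L x)) l))\<^sup>2) \<partial>lborel)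
     \<le> ennreal (e / 2 * (LINT x::'a|lborel. (plateau L x)\<^sup>2) + DIM('a) * measure lborel (transition_shell L :: 'a set) / (2 * e))"
proof -
  let ?X = "fourier_integral (\<lambda>x::'a. complex_of_real (plateau L x))"
  let ?d = "measure lborel (transition_shell L :: 'a set)"
  let ?c = "LINT x::'a|lborel. (plateau L x)\<^sup>2"
  note \<eta>L = cutoff_L2[OF plateau_cutoff[where 'a='a and L=L]]
  have XL: "?X \<in> L2" by (rule plancherel_L1_L2(1)[OF \<eta>L(2,1)])
  note [measurable] = L2_measurable[OF XL]
  have X2: "(\<integral>\<^sup>+l. ennreal ((cmod (?X l))\<^sup>2) \<partial>lborel) = ennreal ?c"
    unfolding nn_integral_L2[OF XL] plancherel_L1_L2(2)[OF \<eta>L(2,1)] \<eta>L(3) ..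
  have c0: "?c \<ge> 0" by (rule integral_nonneg_AE) auto
  have pt: "norm l * (cmod (?X l))\<^sup>2 \<le> e / 2 * (cmod (?X l))\<^sup>2 + 1 / (2 * e) * (\<Sum>b\<in>Basis. (l \<bullet> b)\<^sup>2 * (cmod (?X l))\<^sup>2)" for l
  proof -
    have "0 \<le> (norm l - e)\<^sup>2" by simp
    then have "2 * e * norm l \<le> e * e + (norm l)\<^sup>2" by (simp add: power2_diff power2_eq_square algebra_simps)
    then have "norm l \<le> e / 2 + (norm l)\<^sup>2 / (2 * e)" using e by (simp add: field_simps)
    then have "norm l * (cmod (?X l))\<^sup>2 \<le> (e / 2 + (norm l)\<^sup>2 / (2 * e)) * (cmod (?X l))\<^sup>2" by (rule mult_right_mono) simp
    then show ?thesis by (simp add: norm_eq_sum_Basis sum_distrib_right[symmetric] distrib_right)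
  qed
  have "(\<integral>\<^sup>+l. ennreal (norm l * (cmod (?X l))\<^sup>2) \<partial>lborel) \<le>
     (\<integral>\<^sup>+l. ennreal (e / 2) * ennreal ((cmod (?X l))\<^sup>2) + ennreal (1 / (2 * e)) * (\<Sum>b\<in>Basis. ennreal ((l \<bullet> b)\<^sup>2 * (cmod (?X l))\<^sup>2)) \<partial>lborel)"
    using pt e by (intro nn_integral_mono)
      (simp add: sum_ennreal ennreal_mult[symmetric] ennreal_plus[symmetric] sum_nonneg ennreal_leI del: ennreal_plus)
  also have "\<dots> = ennreal (e / 2) * ennreal ?c + ennreal (1 / (2 * e)) * (\<Sum>b\<in>Basis. \<integral>\<^sup>+l. ennreal ((l \<bullet> b)\<^sup>2 * (cmod (?X l))\<^sup>2) \<partial>lborel)"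
    by (subst nn_integral_add, simp, simp, subst nn_integral_cmult, simp, subst nn_integral_cmult, simp, subst nn_integral_sum, simp)
       (simp only: X2)
  also have "\<dots> \<le> ennreal (e / 2) * ennreal ?c + ennreal (1 / (2 * e)) * (\<Sum>b\<in>(Basis::'a set). ennreal ?d)"
    by (intro add_mono order_refl mult_left_mono sum_mono plateau_directional_moment[OF L]) auto
  also have "\<dots> = ennreal (e / 2 * ?c + 1 / (2 * e) * (\<Sum>b\<in>(Basis::'a set). ?d))"
  proof -
    have 1: "(\<Sum>b\<in>(Basis::'a set). ennreal ?d) = ennreal (\<Sum>b\<in>(Basis::'a set). ?d)" by (rule sum_ennreal) simp
    have nn: "0 \<le> (\<Sum>b\<in>(Basis::'a set). ?d)" by (rule sum_nonneg) simp
    have "ennreal (e / 2 * ?c + 1 / (2 * e) * (\<Sum>b\<in>(Basis::'a set). ?d)) =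
        ennreal (e / 2 * ?c) + ennreal (1 / (2 * e) * (\<Sum>b\<in>(Basis::'a set). ?d))"
      by (intro ennreal_plus mult_nonneg_nonneg nn c0) (use e in auto)
    also have "ennreal (e / 2 * ?c) = ennreal (e / 2) * ennreal ?c"
      by (intro ennreal_mult c0) (use e in auto)
    also have "ennreal (1 / (2 * e) * (\<Sum>b\<in>(Basis::'a set). ?d)) = ennreal (1 / (2 * e)) * ennreal (\<Sum>b\<in>(Basis::'a set). ?d)"
      by (intro ennreal_mult nn) (use e in auto)
    finally show ?thesis unfolding 1 by (rule sym)
  qed
  also have "e / 2 * ?c + 1 / (2 * e) * (\<Sum>b\<in>(Basis::'a set). ?d) = e / 2 * ?c + DIM('a) * ?d / (2 * e)" by simp
  finally show ?thesis .
qed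

lemma x_ln_x_bound:
  assumes "0 \<le> x" "x \<le> (1::real)"
  shows "- 1 \<le> x * ln x" "x * ln x \<le> 0"
proof -
  show "x * ln x \<le> 0"
  proof (cases "x = 0")
    case False
    then have "ln x \<le> 0" using assms by (simp add: ln_le_zero_iff)
    then show ?thesis using assms by (simp add: mult_nonneg_nonpos)
  qed simp
  show "- 1 \<le> x * ln x"
  proof (cases "x = 0")
    case False
    then have x: "x > 0" using assms by simp
    have "ln (1 / x) \<le> 1 / x - 1" using x by (intro ln_le_minus_one) auto
    then have "x * ln (1 / x) \<le> x * (1 / x - 1)" using x by (intro mult_left_mono) auto
    then show ?thesis using x by (simp add: ln_div right_diff_distrib)
  qed simp
qed

lemma shell_ratio_small:
  assumes e: "e > 0"
  obtains L where "L \<ge> 1" "measure lborel (transition_shell L :: 'a::euclidean_space set) \<le> e * (unit_ball_vol DIM('a) * L ^ DIM('a))"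
proof -
  let ?N = "DIM('a)"
  have "(\<lambda>n. (1 + 2 * (1 / real (Suc n))) ^ ?N - (1 - 1 / real (Suc n)) ^ ?N) \<longlonglongrightarrow> (1 + 2 * 0) ^ ?N - (1 - 0) ^ ?N"
    by (intro tendsto_intros LIMSEQ_Suc[OF lim_1_over_n])
  then have "(\<lambda>n. (1 + 2 * (1 / real (Suc n))) ^ ?N - (1 - 1 / real (Suc n)) ^ ?N) \<longlonglongrightarrow> 0" by simp
  from order_tendstoD(2)[OF this e] obtain n where
    n: "(1 + 2 * (1 / real (Suc n))) ^ ?N - (1 - 1 / real (Suc n)) ^ ?N < e" by (auto simp: eventually_sequentially)
  define L where "L = real (Suc n)"
  have L: "L \<ge> 1" by (simp add: L_def)
  have "(L + 2) ^ ?N - (L - 1) ^ ?N = L ^ ?N * ((1 + 2 * (1 / L)) ^ ?N - (1 - 1 / L) ^ ?N)"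
    using L unfolding right_diff_distrib power_mult_distrib[symmetric] by (simp add: distrib_left right_diff_distrib)
  also have "\<dots> \<le> L ^ ?N * e" using n L unfolding L_def[symmetric] by (intro mult_left_mono) auto
  finally have "unit_ball_vol ?N * ((L + 2) ^ ?N - (L - 1) ^ ?N) \<le> unit_ball_vol ?N * (L ^ ?N * e)"
    by (rule mult_left_mono) (simp add: unit_ball_vol_nonneg)
  then have "measure lborel (transition_shell L :: 'a set) \<le> e * (unit_ball_vol ?N * L ^ ?N)"
    using transition_shell_measure(3)[OF L, where 'a='a] by (simp add: mult_ac)
  with L that show ?thesis by blast
qed

text \<open>
  A long plateau with a transition of unit width: every error is controlled by the volume of the
  transition shell relative to that of the ball, which tends to \<open>0\<close>.
\<close>
lemma cheap_cutoff_exists: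
  fixes p :: real
  assumes p: "p > 2" and e: "0 < e" "e \<le> 1"
  obtains \<eta> :: "'a::euclidean_space \<Rightarrow> real" and L where "cutoff \<eta> L" "(LINT x|lborel. (\<eta> x)\<^sup>2) > 0"
    "(1 - e) * (LINT x|lborel. (\<eta> x)\<^sup>2) \<le> (LINT x|lborel. \<eta> x powr p)"
    "- (e * (LINT x|lborel. (\<eta> x)\<^sup>2)) \<le> (LINT x|lborel. (\<eta> x)\<^sup>2 * ln ((\<eta> x)\<^sup>2))"
    "(\<integral>\<^sup>+l. ennreal (norm l * (cmod (fourier_integral (\<lambda>x. complex_of_real (\<eta> x)) l))\<^sup>2) \<partial>lborel)
       \<le> ennreal (e * (LINT x|lborel. (\<eta> x)\<^sup>2))"
proof -
  let ?N = "real DIM('a)"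
  have N: "?N \<ge> 1" by (simp add: Suc_le_eq)
  (* the shell must be of order e^2, because the second moment is divided by e *)
  have e': "e * e / ?N > 0" using e N by simp
  obtain L where L: "L \<ge> 1" and small: "measure lborel (transition_shell L :: 'a set) \<le> e * e / ?N * (unit_ball_vol ?N * L ^ DIM('a))"
    using shell_ratio_small[OF e', where 'a='a] by blast
  let ?\<eta> = "plateau L :: 'a \<Rightarrow> real"
  let ?c = "LINT x|lborel. (?\<eta> x)\<^sup>2"
  let ?S = "transition_shell L :: 'a set"
  let ?d = "measure lborel ?S"
  note \<eta> = plateau_cutoff[where 'a='a and L=L]
  note S = transition_shell_measure[OF L, where 'a='a]
  note bd = cutoffD[OF \<eta>]
  have i2: "integrable lborel (\<lambda>x. (?\<eta> x)\<^sup>2)"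
    by (rule cutoff_integrable[OF \<eta>, where C=1]) (auto simp: power_le_one)
  have ip: "integrable lborel (\<lambda>x. ?\<eta> x powr p)"
    by (rule cutoff_integrable[OF \<eta>, where C=1]) (use p in \<open>auto simp: powr_le1\<close>)
  have il: "integrable lborel (\<lambda>x. (?\<eta> x)\<^sup>2 * ln ((?\<eta> x)\<^sup>2))"
  proof (rule cutoff_integrable[OF \<eta>, where C=1 and f="\<lambda>s. s\<^sup>2 * ln (s\<^sup>2)"])
    fix s :: real assume "0 \<le> s" "s \<le> 1"
    then show "\<bar>s\<^sup>2 * ln (s\<^sup>2)\<bar> \<le> 1" using x_ln_x_bound[of "s\<^sup>2"] by (simp add: power_le_one abs_le_iff)
  qed auto
  have iS: "integrable lborel (\<lambda>x. indicat_real ?S x)" using S by (intro integrable_real_indicator) auto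
  have dS: "(LINT x|lborel. indicat_real ?S x) = ?d" using S by simp
  have out: "?\<eta> x = 0 \<or> ?\<eta> x = 1" if "x \<notin> ?S" for x
    using that by (auto simp: transition_shell_def plateau_def)
  have vol: "unit_ball_vol ?N * L ^ DIM('a) \<le> ?c"
  proof -
    have "unit_ball_vol ?N * L ^ DIM('a) = (LINT x|lborel. indicat_real (cball (0::'a) L) x)"
      using content_cball[of L "0::'a"] L by simp
    also have "\<dots> \<le> ?c"
    proof (rule integral_mono[OF _ i2])
      show "integrable lborel (indicat_real (cball (0::'a) L))"
        using emeasure_cball_finite[of "0::'a" L] by (intro integrable_real_indicator) auto
      show "indicat_real (cball (0::'a) L) x \<le> (?\<eta> x)\<^sup>2" for x
        by (cases "norm x \<le> L") (auto simp: plateau_eq)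
    qed
    finally show ?thesis .
  qed
  have V: "unit_ball_vol ?N * L ^ DIM('a) > 0" using L by simp
  then have c: "?c > 0" using vol by linarith
  have de: "?d \<le> e * e / ?N * ?c" using small mult_left_mono[OF vol, of "e * e / ?N"] e' by linarith
  have "e * e / ?N \<le> e"
  proof -
    have "e \<le> ?N" using e N by linarith
    then have "e * e \<le> e * ?N" using e by (intro mult_left_mono) auto
    then show ?thesis using N by (simp add: field_simps)
  qed
  then have de1: "?d \<le> e * ?c" using de mult_right_mono[of "e * e / ?N" e ?c] c by linarith
  show ?thesis
  proof (rule that[OF \<eta> c])
    have "?c - (LINT x|lborel. ?\<eta> x powr p) = (LINT x|lborel. (?\<eta> x)\<^sup>2 - ?\<eta> x powr p)" using i2 ip by simp
    also have "\<dots> \<le> (LINT x|lborel. indicat_real ?S x)"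
    proof (rule integral_mono[OF _ iS])
      show "integrable lborel (\<lambda>x. (?\<eta> x)\<^sup>2 - ?\<eta> x powr p)" using i2 ip by simp
      fix x
      show "(?\<eta> x)\<^sup>2 - ?\<eta> x powr p \<le> indicat_real ?S x"
      proof (cases "x \<in> ?S")
        case True
        have "(?\<eta> x)\<^sup>2 \<le> 1" using bd(2,3)[of x] by (simp add: power_le_one)
        then show ?thesis using True powr_ge_zero[of "?\<eta> x" p] by (simp del: powr_ge_zero)
      qed (use out[of x] in auto)
    qed
    finally show "(1 - e) * ?c \<le> (LINT x|lborel. ?\<eta> x powr p)" using de1 dS by (simp add: left_diff_distrib)
    have "- (LINT x|lborel. (?\<eta> x)\<^sup>2 * ln ((?\<eta> x)\<^sup>2)) = (LINT x|lborel. - ((?\<eta> x)\<^sup>2 * ln ((?\<eta> x)\<^sup>2)))" by simp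
    also have "\<dots> \<le> (LINT x|lborel. indicat_real ?S x)"
    proof (rule integral_mono[OF _ iS])
      show "integrable lborel (\<lambda>x. - ((?\<eta> x)\<^sup>2 * ln ((?\<eta> x)\<^sup>2)))" using il by simp
      fix x
      show "- ((?\<eta> x)\<^sup>2 * ln ((?\<eta> x)\<^sup>2)) \<le> indicat_real ?S x"
      proof (cases "x \<in> ?S")
        case True
        have "- 1 \<le> (?\<eta> x)\<^sup>2 * ln ((?\<eta> x)\<^sup>2)" using bd(2,3)[of x] by (intro x_ln_x_bound) (auto simp: power_le_one)
        then show ?thesis using True by simp
      qed (use out[of x] in auto)
    qed
    finally show "- (e * ?c) \<le> (LINT x|lborel. (?\<eta> x)\<^sup>2 * ln ((?\<eta> x)\<^sup>2))" using de1 dS by linarith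
    have "?N * ?d \<le> e * e * ?c" using de N by (simp add: field_simps)
    then have "?N * ?d / (2 * e) \<le> e * e * ?c / (2 * e)" using e by (intro divide_right_mono) auto
    also have "\<dots> = e / 2 * ?c" using e by simp
    finally have "e / 2 * ?c + ?N * ?d / (2 * e) \<le> e * ?c" by linarith
    then show "(\<integral>\<^sup>+l. ennreal (norm l * (cmod (fourier_integral (\<lambda>x. complex_of_real (?\<eta> x)) l))\<^sup>2) \<partial>lborel) \<le> ennreal (e * ?c)"
      by (intro order_trans[OF plateau_moment[OF L e(1)]] ennreal_leI)
  qed
qed

text \<open>
  A cutoff with a finite first frequency moment lies in the space, and a multiple of it has mass \<open>a\<close>.
\<close>
lemma S_mass_nonempty:
  assumes a: "a > 0"
  shows "(S_mass a :: ('a::euclidean_space \<Rightarrow> complex) set) \<noteq> {}"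
proof -
  obtain \<eta> :: "'a \<Rightarrow> real" and L where \<eta>: "cutoff \<eta> L" "(LINT x|lborel. (\<eta> x)\<^sup>2) > 0"
    and m: "(\<integral>\<^sup>+l. ennreal (norm l * (cmod (fourier_integral (\<lambda>x. complex_of_real (\<eta> x)) l))\<^sup>2) \<partial>lborel)
       \<le> ennreal (1 * (LINT x|lborel. (\<eta> x)\<^sup>2))"
    by (rule cheap_cutoff_exists[of 3 1, where 'a='a]) auto
  let ?w = "\<lambda>x. complex_of_real (\<eta> x)"
  note \<eta>L = cutoff_L2[OF \<eta>(1)]
  note [measurable] = fourier_measurable[OF \<eta>L(1)] L2_measurable[OF plancherel_L1_L2(1)[OF \<eta>L(2,1)]]
  have "(\<integral>\<^sup>+k. ennreal (norm k * (cmod (fourier ?w k))\<^sup>2) \<partial>lborel) = (\<integral>\<^sup>+k. ennreal (norm k * (cmod (fourier_integral ?w k))\<^sup>2) \<partial>lborel)"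
    by (rule nn_integral_cong_AE) (use fourier_integrable[OF \<eta>L(2,1)] in eventually_elim, simp)
  also have "\<dots> < \<infinity>" by (rule le_less_trans[OF m]) simp
  finally have "integrable lborel (\<lambda>k. norm k * (cmod (fourier ?w k))\<^sup>2)"
    by (intro integrableI_nonneg) auto
  then have H: "?w \<in> H_half" by (rule H_half_I[OF \<eta>L(1)])
  have "integrable lborel (\<lambda>x. (\<eta> x)\<^sup>2 * ln ((\<eta> x)\<^sup>2))"
  proof (rule cutoff_integrable[OF \<eta>(1), where C=1 and f="\<lambda>s. s\<^sup>2 * ln (s\<^sup>2)"])
    fix s :: real assume "0 \<le> s" "s \<le> 1"
    then show "\<bar>s\<^sup>2 * ln (s\<^sup>2)\<bar> \<le> 1" using x_ln_x_bound[of "s\<^sup>2"] by (simp add: power_le_one abs_le_iff)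
  qed auto
  then have W: "?w \<in> W_half" using H by (simp add: W_half_def)
  have pos: "(L2norm ?w)\<^sup>2 > 0" using \<eta>(2) \<eta>L(3) by simp
  then have L0: "L2norm ?w \<noteq> 0" by auto
  have c: "sqrt a / L2norm ?w > 0" using a L0 L2norm_nonneg[of ?w] by (simp add: less_le)
  have "(\<lambda>x. of_real (sqrt a / L2norm ?w) * ?w x) \<in> S_mass a"
    unfolding S_mass_iff W_half_scale(5)[OF W c] using W_half_scale(1)[OF W c] L0 a by simp
  then show ?thesis by blast
qed

section \<open>Concentration of almost minimizers\<close>

lemma convolution_integral:
  fixes g h :: "'a::euclidean_space \<Rightarrow> real"
  assumes g: "integrable lborel g" and h: "integrable lborel h"
  shows "integrable lborel (\<lambda>y. LINT x|lborel. g (x - y) * h x)"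
    "(LINT y|lborel. LINT x|lborel. g (x - y) * h x) = (LINT x|lborel. g x) * (LINT x|lborel. h x)"
proof -
  have [measurable]: "g \<in> borel_measurable borel" "h \<in> borel_measurable borel"
    using g h borel_measurable_integrable by fastforce+
  have "integrable (lborel \<Otimes>\<^sub>M lborel) (\<lambda>z. g (fst z - snd z) * h (fst z))"
  proof (rule lborel_pair.Fubini_integrable)
    show "integrable lborel (\<lambda>x. LBINT y. norm (g (fst (x, y) - snd (x, y)) * h (fst (x, y))))"
      using integral_lborel_reflect(2)[OF integrable_norm[OF g]] h by (simp add: abs_mult)
    show "AE x in lborel. integrable lborel (\<lambda>y. g (fst (x, y) - snd (x, y)) * h (fst (x, y)))"
      using integral_lborel_reflect(1)[OF g] by simp
  qed measurable
  then have I: "integrable (lborel \<Otimes>\<^sub>M lborel) (\<lambda>(x, y). g (x - y) * h x)" by (simp add: case_prod_unfold)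
  show "integrable lborel (\<lambda>y. LINT x|lborel. g (x - y) * h x)"
    using lborel_pair.integrable_snd[OF I] .
  have "(LINT y|lborel. LINT x|lborel. g (x - y) * h x) = (LINT x|lborel. LINT y|lborel. g (x - y) * h x)"
    by (rule lborel_pair.Fubini_integral[OF I])
  also have "\<dots> = (LINT x|lborel. (LINT y|lborel. g y) * h x)"
    using integral_lborel_reflect(2)[OF g] by simp
  finally show "(LINT y|lborel. LINT x|lborel. g (x - y) * h x) = (LINT x|lborel. g x) * (LINT x|lborel. h x)" by simp
qed

lemma integrable_bounded_mult:
  fixes g h :: "'a::euclidean_space \<Rightarrow> real"
  assumes h: "integrable lborel h" and g: "g \<in> borel_measurable borel" "\<And>x. \<bar>g x\<bar> \<le> C"
  shows "integrable lborel (\<lambda>x. g x * h x)"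
proof (rule Bochner_Integration.integrable_bound)
  have C: "C \<ge> 0" using order_trans[OF abs_ge_zero g(2)] .
  show "integrable lborel (\<lambda>x. C * h x)" using h by simp
  show "(\<lambda>x. g x * h x) \<in> borel_measurable lborel" using g(1) borel_measurable_integrable[OF h] by measurable
  show "AE x in lborel. norm (g x * h x) \<le> norm (C * h x)"
    using g(2) C by (auto simp: abs_mult intro!: mult_right_mono)
qed

lemma localize_integrands:
  fixes u :: "'a::euclidean_space \<Rightarrow> complex"
  assumes \<eta>: "cutoff \<eta> L" and p: "p > 0"
  shows "(cmod (localize \<eta> u y x))\<^sup>2 = (\<eta> (x - y))\<^sup>2 * (cmod (u x))\<^sup>2"
    "cmod (localize \<eta> u y x) powr p = \<eta> (x - y) powr p * cmod (u x) powr p"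
    "(cmod (localize \<eta> u y x))\<^sup>2 * ln ((cmod (localize \<eta> u y x))\<^sup>2) =
      (\<eta> (x - y))\<^sup>2 * ((cmod (u x))\<^sup>2 * ln ((cmod (u x))\<^sup>2)) + ((\<eta> (x - y))\<^sup>2 * ln ((\<eta> (x - y))\<^sup>2)) * (cmod (u x))\<^sup>2"
proof -
  have n: "cmod (localize \<eta> u y x) = \<eta> (x - y) * cmod (u x)"
    using cutoffD(2)[OF \<eta>, of "x - y"] by (simp add: localize_def norm_mult)
  show sq: "(cmod (localize \<eta> u y x))\<^sup>2 = (\<eta> (x - y))\<^sup>2 * (cmod (u x))\<^sup>2"
    by (simp add: n power_mult_distrib)
  show "cmod (localize \<eta> u y x) powr p = \<eta> (x - y) powr p * cmod (u x) powr p"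
    using cutoffD(2)[OF \<eta>, of "x - y"] by (simp add: n powr_mult)
  show "(cmod (localize \<eta> u y x))\<^sup>2 * ln ((cmod (localize \<eta> u y x))\<^sup>2) =
      (\<eta> (x - y))\<^sup>2 * ((cmod (u x))\<^sup>2 * ln ((cmod (u x))\<^sup>2)) + ((\<eta> (x - y))\<^sup>2 * ln ((\<eta> (x - y))\<^sup>2)) * (cmod (u x))\<^sup>2"
  proof (cases "\<eta> (x - y) = 0 \<or> u x = 0")
    case False
    then have "ln ((\<eta> (x - y))\<^sup>2 * (cmod (u x))\<^sup>2) = ln ((\<eta> (x - y))\<^sup>2) + ln ((cmod (u x))\<^sup>2)"
      by (simp add: ln_mult)
    then show ?thesis unfolding sq by (simp only: distrib_left mult_ac)
  qed (auto simp: sq)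
qed

lemma cutoff_integrals:
  fixes \<eta> :: "'a::euclidean_space \<Rightarrow> real"
  assumes \<eta>: "cutoff \<eta> L" and p: "p > 0"
  shows "integrable lborel (\<lambda>x. (\<eta> x)\<^sup>2)" "integrable lborel (\<lambda>x. \<eta> x powr p)"
    "integrable lborel (\<lambda>x. (\<eta> x)\<^sup>2 * ln ((\<eta> x)\<^sup>2))" "\<bar>(\<eta> x)\<^sup>2 * ln ((\<eta> x)\<^sup>2)\<bar> \<le> 1"
proof -
  show "integrable lborel (\<lambda>x. (\<eta> x)\<^sup>2)"
    by (rule cutoff_integrable[OF \<eta>, where C=1]) (auto simp: power_le_one)
  show "integrable lborel (\<lambda>x. \<eta> x powr p)"
    by (rule cutoff_integrable[OF \<eta>, where C=1]) (use p in \<open>auto simp: powr_le1\<close>)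
  have b: "\<bar>s\<^sup>2 * ln (s\<^sup>2)\<bar> \<le> 1" if "0 \<le> s" "s \<le> 1" for s :: real
    using that x_ln_x_bound[of "s\<^sup>2"] by (simp add: power_le_one abs_le_iff)
  show "integrable lborel (\<lambda>x. (\<eta> x)\<^sup>2 * ln ((\<eta> x)\<^sup>2))"
    by (rule cutoff_integrable[OF \<eta>, where C=1 and f="\<lambda>s. s\<^sup>2 * ln (s\<^sup>2)"]) (use b in auto)
  show "\<bar>(\<eta> x)\<^sup>2 * ln ((\<eta> x)\<^sup>2)\<bar> \<le> 1" using b cutoffD(2,3)[OF \<eta>] by blast
qed

text \<open>All terms of the energy other than the quadratic form localize exactly, by Fubini's theorem.\<close>
lemma localized_energy_average:
  fixes u :: "'a::euclidean_space \<Rightarrow> complex"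
  assumes v: "norm v < 1" and p: "p > 2" and u: "u \<in> W_half" and up: "integrable lborel (\<lambda>x. cmod (u x) powr p)"
    and \<eta>: "cutoff \<eta> L" and J: "J \<ge> 0"
    and I: "(\<integral>\<^sup>+l. ennreal (norm l * (cmod (fourier_integral (\<lambda>x. complex_of_real (\<eta> x)) l))\<^sup>2) \<partial>lborel) \<le> ennreal J"
  obtains q where "integrable lborel q"
    "AE y in lborel. localize \<eta> u y \<in> W_half \<and> E_energy m v p (localize \<eta> u y) = q y"
    "(LINT y|lborel. q y) \<le> (LINT x|lborel. (\<eta> x)\<^sup>2) * E_energy m v p u + (L2norm u)\<^sup>2 * J
       + ((LINT x|lborel. (\<eta> x)\<^sup>2) - (LINT x|lborel. \<eta> x powr p)) * (LINT x|lborel. cmod (u x) powr p) / p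
       - (L2norm u)\<^sup>2 * (LINT x|lborel. (\<eta> x)\<^sup>2 * ln ((\<eta> x)\<^sup>2)) / 2"
proof -
  have p0: "p > 0" using p by simp
  have uH: "u \<in> H_half" using u by (simp add: W_half_def)
  note uL = H_half_L2[OF uH]
  note [measurable] = L2_measurable[OF uL] cutoffD(1)[OF \<eta>]
  note ci = cutoff_integrals[OF \<eta> p0]
  note li = localize_integrands[OF \<eta> p0, of u]
  note loc = localize_L2[OF uL \<eta>]
  have u2: "integrable lborel (\<lambda>x. (cmod (u x))\<^sup>2)" by (rule L2_integrable[OF uL])
  have ul: "integrable lborel (\<lambda>x. (cmod (u x))\<^sup>2 * ln ((cmod (u x))\<^sup>2))" using u by (simp add: W_half_def)
  let ?F = "\<lambda>y k. fourier_integral (localize \<eta> u y) k"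
  define Q where "Q y = (\<integral>\<^sup>+k. ennreal (drift_symbol m v k * (cmod (?F y k))\<^sup>2) \<partial>lborel)" for y
  let ?B = "(LINT x|lborel. (\<eta> x)\<^sup>2) * drift_form m v u + 2 * (L2norm u)\<^sup>2 * J"
  have c0: "(LINT x|lborel. (\<eta> x)\<^sup>2) \<ge> 0" by (rule integral_nonneg_AE) auto
  have B0: "?B \<ge> 0" using c0 drift_form_ge(2)[OF v uH] J by simp
  have QB: "(\<integral>\<^sup>+y. Q y \<partial>lborel) \<le> ennreal ?B"
    unfolding Q_def by (rule localized_drift_average[OF v uH \<eta> I J])
  have Qm [measurable]: "Q \<in> borel_measurable borel"
  proof -
    note [measurable] = localized_transform_measurable[OF L2_measurable[OF uL] cutoffD(1)[OF \<eta>], unfolded case_prod_unfold]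
    show ?thesis unfolding Q_def[abs_def]
      by (intro lborel.borel_measurable_nn_integral) (simp add: case_prod_unfold, measurable)
  qed
  have "(\<integral>\<^sup>+y. Q y \<partial>lborel) \<noteq> \<infinity>" using QB by (auto simp: top_unique)
  then have Qfin: "AE y in lborel. Q y \<noteq> \<infinity>" by (intro nn_integral_PInf_AE) auto
  have Qr: "(\<integral>\<^sup>+y. ennreal (enn2real (Q y)) \<partial>lborel) = (\<integral>\<^sup>+y. Q y \<partial>lborel)"
    by (rule nn_integral_cong_AE) (use Qfin in eventually_elim, simp add: less_top)
  have Qint: "integrable lborel (\<lambda>y. enn2real (Q y))"
    by (rule integrableI_nonneg) (use Qr QB in \<open>auto intro: le_less_trans\<close>)
  have Qle: "(LINT y|lborel. enn2real (Q y)) \<le> ?B"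
    using QB B0 unfolding Qr[symmetric] by (subst (asm) nn_integral_eq_integral[OF Qint]) auto
  have H: "AE y in lborel. localize \<eta> u y \<in> H_half \<and> drift_form m v (localize \<eta> u y) = enn2real (Q y)"
    using Qfin
  proof eventually_elim
    case (elim y)
    note ly = loc[of y]
    note [measurable] = fourier_measurable[OF ly(1)]
    have Fe: "AE k in lborel. fourier (localize \<eta> u y) k = ?F y k" by (rule fourier_integrable[OF ly(2,1)])
    have Qy: "(\<integral>\<^sup>+k. ennreal (drift_symbol m v k * (cmod (fourier (localize \<eta> u y) k))\<^sup>2) \<partial>lborel) = Q y"
      unfolding Q_def by (rule nn_integral_cong_AE) (use Fe in eventually_elim, simp)
    have Di: "integrable lborel (\<lambda>k. drift_symbol m v k * (cmod (fourier (localize \<eta> u y) k))\<^sup>2)"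
      by (rule integrableI_nonneg) (use drift_symbol_bounds(2)[OF v, of m] Qy elim in \<open>auto simp: less_top\<close>)
    have "integrable lborel (\<lambda>k. norm k * (cmod (fourier (localize \<eta> u y) k))\<^sup>2)"
    proof (rule Bochner_Integration.integrable_bound)
      show "integrable lborel (\<lambda>k. 1 / (1 - norm v) * (drift_symbol m v k * (cmod (fourier (localize \<eta> u y) k))\<^sup>2))" using Di by simp
      have "norm k * (cmod (fourier (localize \<eta> u y) k))\<^sup>2 \<le>
          1 / (1 - norm v) * (drift_symbol m v k * (cmod (fourier (localize \<eta> u y) k))\<^sup>2)" for k
      proof -
        have "norm k \<le> 1 / (1 - norm v) * drift_symbol m v k"
          using drift_symbol_bounds(1)[OF v, of k m] v by (simp add: field_simps)
        from mult_right_mono[OF this, of "(cmod (fourier (localize \<eta> u y) k))\<^sup>2"] show ?thesis by (simp only: mult.assoc) simp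
      qed
      then have le: "norm k * (cmod (fourier (localize \<eta> u y) k))\<^sup>2 \<le>
          norm (1 / (1 - norm v) * (drift_symbol m v k * (cmod (fourier (localize \<eta> u y) k))\<^sup>2))" for k
        unfolding real_norm_def by (rule order_trans[OF _ abs_ge_self])
      then show "AE k in lborel. norm (norm k * (cmod (fourier (localize \<eta> u y) k))\<^sup>2) \<le>
          norm (1 / (1 - norm v) * (drift_symbol m v k * (cmod (fourier (localize \<eta> u y) k))\<^sup>2))"
        by (intro AE_I2) (subst real_norm_def, subst abs_of_nonneg, simp, rule le)
    qed measurable
    then have "localize \<eta> u y \<in> H_half" by (rule H_half_I[OF ly(1)])
    moreover have "drift_form m v (localize \<eta> u y) = enn2real (Q y)"
      unfolding Qy[symmetric] drift_form_def
      by (subst nn_integral_eq_integral[OF Di]) (use drift_symbol_bounds(2)[OF v, of m] in \<open>auto intro!: integral_nonneg_AE\<close>)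
    ultimately show ?case by simp
  qed
  let ?M = "\<lambda>y. LINT x|lborel. (\<eta> (x - y))\<^sup>2 * (cmod (u x))\<^sup>2"
  let ?P = "\<lambda>y. LINT x|lborel. \<eta> (x - y) powr p * cmod (u x) powr p"
  let ?L1 = "\<lambda>y. LINT x|lborel. (\<eta> (x - y))\<^sup>2 * ((cmod (u x))\<^sup>2 * ln ((cmod (u x))\<^sup>2))"
  let ?L2 = "\<lambda>y. LINT x|lborel. ((\<eta> (x - y))\<^sup>2 * ln ((\<eta> (x - y))\<^sup>2)) * (cmod (u x))\<^sup>2"
  note cM = convolution_integral[OF ci(1) u2]
  note cP = convolution_integral[OF ci(2) up]
  note cL1 = convolution_integral[OF ci(1) ul]
  note cL2 = convolution_integral[OF ci(3) u2]
  have i1: "integrable lborel (\<lambda>x. (\<eta> (x - y))\<^sup>2 * ((cmod (u x))\<^sup>2 * ln ((cmod (u x))\<^sup>2)))" for y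
    by (rule integrable_bounded_mult[OF ul, where C=1]) (use cutoffD(2,3)[OF \<eta>] in \<open>auto simp: power_le_one\<close>)
  have i2: "integrable lborel (\<lambda>x. ((\<eta> (x - y))\<^sup>2 * ln ((\<eta> (x - y))\<^sup>2)) * (cmod (u x))\<^sup>2)" for y
    by (rule integrable_bounded_mult[OF u2 _ ci(4)]) measurable
  have W: "localize \<eta> u y \<in> W_half" if "localize \<eta> u y \<in> H_half" for y
    using that i1 i2 by (simp add: W_half_def li(3))
  have mass: "(L2norm (localize \<eta> u y))\<^sup>2 = ?M y" for y by (simp only: L2norm_square li(1))
  define q where "q y = enn2real (Q y) / 2 - m / 2 * ?M y - ?P y / p - (?L1 y + ?L2 y - ?M y) / 2" for y
  show ?thesis
  proof (rule that)
    show "integrable lborel q" unfolding q_def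
      using Qint cM(1) cP(1) cL1(1) cL2(1) by simp
    show "AE y in lborel. localize \<eta> u y \<in> W_half \<and> E_energy m v p (localize \<eta> u y) = q y"
      using H
    proof eventually_elim
      case (elim y)
      then have Wy: "localize \<eta> u y \<in> W_half" using W by blast
      have "log_term (localize \<eta> u y) = ?L1 y + ?L2 y - ?M y"
        unfolding log_term_eq(2)[OF Wy] mass li(3) using i1[of y] i2[of y] by simp
      then show ?case using Wy elim p0
        by (simp add: E_energy_eq[OF v] mass li(2) q_def)
    qed
    have "(LINT y|lborel. q y) = (LINT y|lborel. enn2real (Q y)) / 2 - m / 2 * (LINT y|lborel. ?M y) - (LINT y|lborel. ?P y) / p
        - ((LINT y|lborel. ?L1 y) + (LINT y|lborel. ?L2 y) - (LINT y|lborel. ?M y)) / 2"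
      unfolding q_def using Qint cM(1) cP(1) cL1(1) cL2(1) by simp
    also have "\<dots> \<le> ?B / 2 - m / 2 * (LINT y|lborel. ?M y) - (LINT y|lborel. ?P y) / p
        - ((LINT y|lborel. ?L1 y) + (LINT y|lborel. ?L2 y) - (LINT y|lborel. ?M y)) / 2"
      using Qle by simp
    also have "\<dots> = (LINT x|lborel. (\<eta> x)\<^sup>2) * E_energy m v p u + (L2norm u)\<^sup>2 * J
       + ((LINT x|lborel. (\<eta> x)\<^sup>2) - (LINT x|lborel. \<eta> x powr p)) * (LINT x|lborel. cmod (u x) powr p) / p
       - (L2norm u)\<^sup>2 * (LINT x|lborel. (\<eta> x)\<^sup>2 * ln ((\<eta> x)\<^sup>2)) / 2"
    proof -
      have alg: "(c * \<Phi> + 2 * M * J) / 2 - m / 2 * (c * M) - cp * P / p - (c * l1 + cl * M - c * M) / 2 =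
          c * (\<Phi> / 2 - m * M / 2 - P / p - (l1 - M) / 2) + M * J + (c - cp) * P / p - M * cl / 2"
        for c \<Phi> M cp P l1 cl :: real using p0 by (simp add: field_simps)
      show ?thesis
        unfolding cM(2) cP(2) cL1(2) cL2(2) E_energy_eq[OF v uH p0] log_term_eq(2)[OF u] L2norm_square[of u, symmetric]
        by (rule alg)
    qed
    finally show "(LINT y|lborel. q y) \<le> (LINT x|lborel. (\<eta> x)\<^sup>2) * E_energy m v p u + (L2norm u)\<^sup>2 * J
       + ((LINT x|lborel. (\<eta> x)\<^sup>2) - (LINT x|lborel. \<eta> x powr p)) * (LINT x|lborel. cmod (u x) powr p) / p
       - (L2norm u)\<^sup>2 * (LINT x|lborel. (\<eta> x)\<^sup>2 * ln ((\<eta> x)\<^sup>2)) / 2" .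
  qed
qed

lemma zero_energy:
  assumes v: "norm v < 1" and p: "p > 0" and w: "w \<in> W_half" and z: "L2norm w = 0"
  shows "0 \<le> E_energy m v p w"
proof -
  have wH: "w \<in> H_half" using w by (simp add: W_half_def)
  note wL = H_half_L2[OF wH]
  note [measurable] = L2_measurable[OF wL]
  have AE0: "AE x in lborel. w x = 0" by (rule L2norm_zero_AE[OF wL z])
  have "(LINT x|lborel. cmod (w x) powr p) = (LINT x|(lborel::'a measure). 0)"
    by (rule integral_cong_AE) (measurable, use AE0 in eventually_elim, simp)
  moreover have "log_term w = (LINT x|(lborel::'a measure). 0)"
    unfolding log_term_def by (rule integral_cong_AE) (measurable, use AE0 in eventually_elim, simp)
  ultimately show ?thesis using drift_form_ge(2)[OF v wH, of m] z by (simp add: E_energy_eq[OF v wH p])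
qed

text \<open>
  If every localized piece carried at most the fraction \<open>exp (- e)\<close> of the mass, then the scaling bound
  would put the average energy of the pieces at \<open>d + a e / 2\<close> or more, which exceeds the energy of
  \<open>u\<close> plus the localization error.
\<close>
lemma almost_minimizer_concentrates:
  fixes u :: "'a::euclidean_space \<Rightarrow> complex"
  assumes v: "norm v < 1" and p: "p > 2" and a: "a > 0" and e: "e > 0"
    and u: "u \<in> S_mass a" and up: "integrable lborel (\<lambda>x. cmod (u x) powr p)"
    and d: "\<And>\<phi> :: 'a \<Rightarrow> complex. \<phi> \<in> S_mass a \<Longrightarrow> d \<le> E_energy m v p \<phi>"
    and \<eta>: "cutoff \<eta> L" "(LINT x|lborel. (\<eta> x)\<^sup>2) > 0"
    and \<eta>p: "(1 - \<epsilon>) * (LINT x|lborel. (\<eta> x)\<^sup>2) \<le> (LINT x|lborel. \<eta> x powr p)"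
    and \<eta>l: "- (\<epsilon> * (LINT x|lborel. (\<eta> x)\<^sup>2)) \<le> (LINT x|lborel. (\<eta> x)\<^sup>2 * ln ((\<eta> x)\<^sup>2))"
    and \<eta>k: "(\<integral>\<^sup>+l. ennreal (norm l * (cmod (fourier_integral (\<lambda>x. complex_of_real (\<eta> x)) l))\<^sup>2) \<partial>lborel)
       \<le> ennreal (\<epsilon> * (LINT x|lborel. (\<eta> x)\<^sup>2))"
    and \<epsilon>: "\<epsilon> > 0"
    and small: "E_energy m v p u - d + \<epsilon> * (3 * a / 2 + (LINT x|lborel. cmod (u x) powr p) / p) < a * e / 2"
  shows "\<exists>y. a * exp (- e) < (L2norm (localize \<eta> u y))\<^sup>2"
proof (rule ccontr)
  assume "\<not> ?thesis"
  then have less: "(L2norm (localize \<eta> u y))\<^sup>2 \<le> a * exp (- e)" for y by (simp add: not_less)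
  let ?c = "LINT x|lborel. (\<eta> x)\<^sup>2"
  let ?P = "LINT x|lborel. cmod (u x) powr p"
  let ?M = "\<lambda>y. (L2norm (localize \<eta> u y))\<^sup>2"
  have uW: "u \<in> W_half" and ua: "(L2norm u)\<^sup>2 = a" using u by (auto simp: S_mass_iff)
  then have uL: "u \<in> L2" by (simp add: W_half_def H_half_def)
  have J: "\<epsilon> * ?c \<ge> 0" using \<epsilon> \<eta>(2) by simp
  obtain q where q: "integrable lborel q"
    "AE y in lborel. localize \<eta> u y \<in> W_half \<and> E_energy m v p (localize \<eta> u y) = q y"
    "(LINT y|lborel. q y) \<le> ?c * E_energy m v p u + (L2norm u)\<^sup>2 * (\<epsilon> * ?c)
       + (?c - (LINT x|lborel. \<eta> x powr p)) * ?P / p - (L2norm u)\<^sup>2 * (LINT x|lborel. (\<eta> x)\<^sup>2 * ln ((\<eta> x)\<^sup>2)) / 2"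
    by (rule localized_energy_average[OF v p uW up \<eta>(1) J \<eta>k])
  have P0: "?P \<ge> 0" by (rule integral_nonneg_AE) auto
  have M: "?M = (\<lambda>y. LINT x|lborel. (\<eta> (x - y))\<^sup>2 * (cmod (u x))\<^sup>2)"
    by (rule ext) (simp only: L2norm_square localize_integrands(1)[OF \<eta>(1) zero_less_one])
  note cM = convolution_integral[OF cutoff_integrals(1)[OF \<eta>(1) zero_less_one] L2_integrable[OF uL], folded M]
  have LM: "(LINT y|lborel. ?M y) = ?c * a" unfolding cM(2) L2norm_square[symmetric] ua ..
  have low: "AE y in lborel. ?M y * (d / a + e / 2) \<le> q y"
    using q(2)
  proof eventually_elim
    case (elim y)
    then have W: "localize \<eta> u y \<in> W_half" and qy: "E_energy m v p (localize \<eta> u y) = q y" by auto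
    show ?case
    proof (cases "L2norm (localize \<eta> u y) = 0")
      case True
      then show ?thesis using zero_energy[OF v _ W True, of p m] p qy by simp
    next
      case False
      then have pos: "0 < ?M y" by simp
      have "a * exp (- e) \<le> a" using a e by simp
      then have "?M y \<le> a" using less[of y] by linarith
      from energy_lower_bound_by_scaling[OF v p W pos this d]
      have 1: "?M y / a * d + ?M y / 2 * ln (a / ?M y) \<le> q y" using qy by simp
      have "exp e \<le> a / ?M y"
        using less[of y] pos by (simp add: field_simps exp_minus)
      then have "e \<le> ln (a / ?M y)" using a pos by (subst ln_ge_iff) (auto simp: zero_less_divide_iff)
      then have "?M y / 2 * e \<le> ?M y / 2 * ln (a / ?M y)" by (intro mult_left_mono) auto
      then have "?M y / a * d + ?M y / 2 * e \<le> q y" using 1 by linarith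
      then show ?thesis by (simp add: distrib_left)
    qed
  qed
  have "?c * a * (d / a + e / 2) = (LINT y|lborel. ?M y * (d / a + e / 2))" using LM by simp
  also have "\<dots> \<le> (LINT y|lborel. q y)" using cM(1) by (intro integral_mono_AE[OF _ q(1) low]) simp
  also have "\<dots> \<le> ?c * E_energy m v p u + a * (\<epsilon> * ?c) + (?c - (LINT x|lborel. \<eta> x powr p)) * ?P / p
     - a * (LINT x|lborel. (\<eta> x)\<^sup>2 * ln ((\<eta> x)\<^sup>2)) / 2" using q(3) unfolding ua .
  also have "\<dots> \<le> ?c * E_energy m v p u + a * (\<epsilon> * ?c) + (\<epsilon> * ?c) * ?P / p + a * (\<epsilon> * ?c) / 2"
  proof -
    have "(?c - (LINT x|lborel. \<eta> x powr p)) * ?P \<le> (\<epsilon> * ?c) * ?P"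
      using \<eta>p P0 by (intro mult_right_mono) (auto simp: left_diff_distrib)
    then have "(?c - (LINT x|lborel. \<eta> x powr p)) * ?P / p \<le> (\<epsilon> * ?c) * ?P / p"
      using p by (intro divide_right_mono) auto
    moreover have "a * - (\<epsilon> * ?c) \<le> a * (LINT x|lborel. (\<eta> x)\<^sup>2 * ln ((\<eta> x)\<^sup>2))"
      using \<eta>l a by (intro mult_left_mono) auto
    then have "- (a * (\<epsilon> * ?c)) \<le> a * (LINT x|lborel. (\<eta> x)\<^sup>2 * ln ((\<eta> x)\<^sup>2))"
      by (simp only: mult_minus_right)
    ultimately show ?thesis by linarith
  qed
  also have "\<dots> = ?c * (E_energy m v p u + \<epsilon> * (3 * a / 2 + ?P / p))"
    using p by (simp add: field_simps)
  finally have "?c * (a * (d / a + e / 2)) \<le> ?c * (E_energy m v p u + \<epsilon> * (3 * a / 2 + ?P / p))" by (simp only: mult.assoc)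
  then have "a * (d / a + e / 2) \<le> E_energy m v p u + \<epsilon> * (3 * a / 2 + ?P / p)"
    using \<eta>(2) by (simp only: mult_le_cancel_left_pos)
  moreover have "a * (d / a + e / 2) = d + a * e / 2" using a by (simp add: distrib_left)
  ultimately show False using small by linarith
qed

section \<open>Coercivity and lower semicontinuity\<close>

lemma log_le_power:
  fixes p s :: real
  assumes p: "p > 2" and s: "s \<ge> 0"
  shows "s\<^sup>2 * ln (s\<^sup>2) / 2 \<le> s powr p / (p - 2)"
proof (cases "s = 0")
  case False
  with s have s0: "s > 0" by simp
  have "(p - 2) * ln s = ln (s powr (p - 2))" using s0 by (simp add: ln_powr)
  also have "\<dots> \<le> s powr (p - 2)" using s0 ln_le_minus_one[of "s powr (p - 2)"] by simp
  finally have "ln s \<le> s powr (p - 2) / (p - 2)" using p by (simp add: field_simps)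
  then have "s\<^sup>2 * ln s \<le> s\<^sup>2 * (s powr (p - 2) / (p - 2))" by (intro mult_left_mono) auto
  also have "s\<^sup>2 * (s powr (p - 2) / (p - 2)) = s powr p / (p - 2)" using s0 by (simp add: powr_diff)
  also have "s\<^sup>2 * ln s = s\<^sup>2 * ln (s\<^sup>2) / 2" using s0 by (simp add: ln_realpow)
  finally show ?thesis .
qed simp

definition potential :: "real \<Rightarrow> real \<Rightarrow> real" where
  "potential p s = - (s powr p / p) - s\<^sup>2 * (ln (s\<^sup>2) - 1) / 2"

lemma potential_lower_bound:
  assumes p: "p > 2" and s: "s \<ge> 0"
  shows "- ((1 / p + 1 / (p - 2)) * s powr p) \<le> potential p s"
proof -
  have "potential p s = - (s powr p / p) - s\<^sup>2 * ln (s\<^sup>2) / 2 + s\<^sup>2 / 2"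
    by (simp add: potential_def right_diff_distrib diff_divide_distrib)
  moreover have "(1 / p + 1 / (p - 2)) * s powr p = s powr p / p + s powr p / (p - 2)"
    by (simp add: distrib_right)
  moreover have "0 \<le> s\<^sup>2 / 2" by simp
  ultimately show ?thesis using log_le_power[OF p s] by linarith
qed

lemma potential_integral:
  assumes u: "u \<in> W_half" and up: "integrable lborel (\<lambda>x. cmod (u x) powr p)"
  shows "integrable lborel (\<lambda>x. potential p (cmod (u x)))"
    "(LINT x|lborel. potential p (cmod (u x))) = - (LINT x|lborel. cmod (u x) powr p) / p - log_term u / 2"
  unfolding potential_def log_term_def using log_term_eq(1)[OF u] up by simp_all

lemma E_energy_potential:
  assumes v: "norm v < 1" and p: "p > 0" and u: "u \<in> W_half" and up: "integrable lborel (\<lambda>x. cmod (u x) powr p)"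
  shows "E_energy m v p u = drift_form m v u / 2 - m * (L2norm u)\<^sup>2 / 2 + (LINT x|lborel. potential p (cmod (u x)))"
  using E_energy_eq[OF v _ p, of u m] u potential_integral(2)[OF u up] by (simp add: W_half_def)

text \<open>
  The height \<open>T\<close> is chosen so that the tail of \<open>|u|\<^sup>p\<close> above \<open>T\<close> costs at most half of the lower bound for
  the quadratic form; below \<open>T\<close> the power is bounded by the mass.
\<close>
lemma E_energy_coercive:
  fixes v :: "'a::euclidean_space"
  assumes v: "norm v < 1" and p: "2 < p" "p < 2 + 2 / DIM('a)" and a: "a > 0"
  obtains K where "\<And>u :: 'a \<Rightarrow> complex. u \<in> S_mass a \<Longrightarrow> integrable lborel (\<lambda>x. cmod (u x) powr p) \<and>
     (1 - norm v) / 4 * half_energy u \<le> E_energy m v p u + K \<and>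
     (LINT x|lborel. cmod (u x) powr p) \<le> K * (1 + half_energy u)"
proof -
  define \<tau> where "\<tau> = p - 2 - 2 / real DIM('a)"
  have \<tau>: "\<tau> < 0" using p by (simp add: \<tau>_def)
  define \<kappa> where "\<kappa> = 1 / p + 1 / (p - 2)"
  have \<kappa>: "\<kappa> > 0" using p by (simp add: \<kappa>_def add_pos_pos)
  obtain C where C: "C \<ge> 0" "\<And>(u :: 'a \<Rightarrow> complex) T. u \<in> H_half \<Longrightarrow> L2norm u \<le> sqrt a \<Longrightarrow> T > 0 \<Longrightarrow>
     (\<integral>\<^sup>+x. ennreal (indicator {x. T < cmod (u x)} x * cmod (u x) powr p) \<partial>lborel)
       \<le> ennreal (C * T powr (p - 2 - 2 / DIM('a)) * half_energy u)"
    by (rule Lp_tail_uniform[OF real_sqrt_ge_zero[OF less_imp_le[OF a]] p]) blast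
  note C = C[folded \<tau>_def]
  define q where "q = (1 - norm v) / 4 / (\<kappa> * (C + 1))"
  have q: "q > 0" using v \<kappa> C(1) by (simp add: q_def)
  define T where "T = q powr (1 / \<tau>)"
  have T: "T > 0" "T powr \<tau> = q" using q \<tau> by (auto simp: T_def powr_powr)
  have absorb: "\<kappa> * (C * q) \<le> (1 - norm v) / 4"
  proof -
    have "\<kappa> * (C * q) \<le> \<kappa> * ((C + 1) * q)" using \<kappa> q by (intro mult_left_mono mult_right_mono) auto
    also have "\<dots> = (\<kappa> * (C + 1)) * q" by (simp only: mult.assoc)
    also have "\<dots> = (1 - norm v) / 4" using \<kappa> C(1) by (simp add: q_def)
    finally show ?thesis .
  qed
  define P0 where "P0 = T powr (p - 2) * a"
  define K where "K = \<bar>m\<bar> * a / 2 + \<kappa> * P0 + P0 + C * q"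
  have P0: "P0 \<ge> 0" using a by (simp add: P0_def)
  show ?thesis
  proof (rule that[of K], intro conjI)
    fix u :: "'a \<Rightarrow> complex" assume u: "u \<in> S_mass a"
    then have uW: "u \<in> W_half" and ua: "(L2norm u)\<^sup>2 = a" by (auto simp: S_mass_iff)
    have uH: "u \<in> H_half" using uW by (simp add: W_half_def)
    have us: "L2norm u \<le> sqrt a" using ua by (simp add: real_le_rsqrt)
    let ?A = "half_energy u"
    have tail: "(\<integral>\<^sup>+x. ennreal (indicator {x. T < cmod (u x)} x * cmod (u x) powr p) \<partial>lborel) \<le> ennreal (C * q * ?A)"
      using C(2)[OF uH us T(1)] unfolding T(2) .
    have D: "C * q * ?A \<ge> 0" using C(1) q by simp
    show up: "integrable lborel (\<lambda>x. cmod (u x) powr p)" by (rule Lp_bound(1)[OF H_half_L2[OF uH] p(1) T(1) D tail])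
    let ?P = "LINT x|lborel. cmod (u x) powr p"
    have P: "?P \<le> P0 + C * q * ?A"
      using Lp_bound(2)[OF H_half_L2[OF uH] p(1) T(1) D tail] unfolding ua P0_def .
    have "(LINT x|lborel. - (\<kappa> * cmod (u x) powr p)) \<le> (LINT x|lborel. potential p (cmod (u x)))"
      using potential_lower_bound[OF p(1)] up potential_integral(1)[OF uW up] unfolding \<kappa>_def by (intro integral_mono) auto
    then have pot: "- (\<kappa> * ?P) \<le> (LINT x|lborel. potential p (cmod (u x)))" by simp
    have "\<kappa> * ?P \<le> \<kappa> * P0 + \<kappa> * (C * q) * ?A"
      using mult_left_mono[OF P, of \<kappa>] \<kappa> by (simp add: distrib_left mult.assoc)
    also have "\<kappa> * (C * q) * ?A \<le> (1 - norm v) / 4 * ?A" by (intro mult_right_mono absorb) simp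
    finally have 1: "\<kappa> * ?P \<le> \<kappa> * P0 + (1 - norm v) / 4 * ?A" by simp
    have "m * a \<le> \<bar>m\<bar> * a" using a by (intro mult_right_mono) auto
    then have K1: "m * a / 2 + \<kappa> * P0 \<le> K" using P0 mult_nonneg_nonneg[OF C(1) less_imp_le[OF q]] unfolding K_def by linarith
    have "E_energy m v p u = drift_form m v u / 2 - m * a / 2 + (LINT x|lborel. potential p (cmod (u x)))"
      using E_energy_potential[OF v _ uW up, of m] p ua by simp
    moreover have "(1 - norm v) * ?A / 2 \<le> drift_form m v u / 2" using drift_form_ge(1)[OF v uH, of m] by simp
    moreover have "(1 - norm v) * ?A / 2 = (1 - norm v) / 4 * ?A + (1 - norm v) / 4 * ?A" by simp
    ultimately show "(1 - norm v) / 4 * ?A \<le> E_energy m v p u + K" using pot 1 K1 by linarith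
    have "P0 \<le> K" "C * q \<le> K" using a P0 C(1) q \<kappa> by (auto simp: K_def)
    then have "P0 + C * q * ?A \<le> K + K * ?A" by (intro add_mono mult_right_mono) auto
    then show "?P \<le> K * (1 + ?A)" using P by (simp add: distrib_left)
  qed
qed

text \<open>
  The potential alone is not bounded below, so a multiple of \<open>s\<^sup>2 max(T, s)\<^sup>p\<^sup>-\<^sup>2\<close> is added to make Fatou's
  lemma applicable. Below \<open>T\<close> this is a multiple of the fixed mass, and above \<open>T\<close> it is uniformly
  small, so it disappears as \<open>T\<close> grows.
\<close>
definition compensator :: "real \<Rightarrow> real \<Rightarrow> real \<Rightarrow> real" where
  "compensator p T s = (1 / p + 1 / (p - 2)) * (s\<^sup>2 * max T s powr (p - 2))"

lemma compensator_bounds: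
  assumes p: "p > 2" and s: "s \<ge> 0" and T: "T > 0"
  shows "0 \<le> potential p s + compensator p T s"
    "(1 / p + 1 / (p - 2)) * (T powr (p - 2) * s\<^sup>2) \<le> compensator p T s"
    "compensator p T s \<le> (1 / p + 1 / (p - 2)) * (T powr (p - 2) * s\<^sup>2 + (if T < s then s powr p else 0))"
proof -
  let ?k = "1 / p + 1 / (p - 2)"
  have k: "?k \<ge> 0" using p by simp
  have sp: "s powr p = s\<^sup>2 * s powr (p - 2)"
    using s by (cases "s = 0") (auto simp: powr_diff)
  have "s\<^sup>2 * s powr (p - 2) \<le> s\<^sup>2 * max T s powr (p - 2)"
    using p s by (intro mult_left_mono powr_mono2) auto
  from mult_left_mono[OF this k] have "?k * s powr p \<le> compensator p T s" unfolding compensator_def sp .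
  then show "0 \<le> potential p s + compensator p T s" using potential_lower_bound[OF p s] by linarith
  have "T powr (p - 2) * s\<^sup>2 \<le> max T s powr (p - 2) * s\<^sup>2"
    using p T by (intro mult_right_mono powr_mono2) auto
  then show "?k * (T powr (p - 2) * s\<^sup>2) \<le> compensator p T s"
    unfolding compensator_def by (intro mult_left_mono k) (simp add: mult.commute)
  have "s\<^sup>2 * max T s powr (p - 2) \<le> T powr (p - 2) * s\<^sup>2 + (if T < s then s powr p else 0)"
    unfolding sp by (auto simp: max_def)
  then show "compensator p T s \<le> ?k * (T powr (p - 2) * s\<^sup>2 + (if T < s then s powr p else 0))"
    unfolding compensator_def by (intro mult_left_mono k)
qed

lemma compensator_integral:
  fixes u :: "'a::euclidean_space \<Rightarrow> complex"
  assumes p: "p > 2" and T: "T > 0" and u: "u \<in> L2" and up: "integrable lborel (\<lambda>x. cmod (u x) powr p)"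
  shows "integrable lborel (\<lambda>x. compensator p T (cmod (u x)))"
    "(1 / p + 1 / (p - 2)) * (T powr (p - 2) * (L2norm u)\<^sup>2) \<le> (LINT x|lborel. compensator p T (cmod (u x)))"
    "(\<integral>\<^sup>+x. ennreal (indicator {x. T < cmod (u x)} x * cmod (u x) powr p) \<partial>lborel) \<le> ennreal D \<Longrightarrow> D \<ge> 0 \<Longrightarrow>
     (LINT x|lborel. compensator p T (cmod (u x))) \<le> (1 / p + 1 / (p - 2)) * (T powr (p - 2) * (L2norm u)\<^sup>2 + D)"
proof -
  let ?k = "1 / p + 1 / (p - 2)"
  have k: "?k \<ge> 0" using p by simp
  note [measurable] = L2_measurable[OF u]
  note cb = compensator_bounds[OF p norm_ge_zero T]
  have u2: "integrable lborel (\<lambda>x. (cmod (u x))\<^sup>2)" by (rule L2_integrable[OF u])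
  let ?t = "\<lambda>x. if T < cmod (u x) then cmod (u x) powr p else 0"
  have ti: "integrable lborel ?t" by (rule Bochner_Integration.integrable_bound[OF up]) auto
  let ?b = "\<lambda>x. ?k * (T powr (p - 2) * (cmod (u x))\<^sup>2 + ?t x)"
  have bi: "integrable lborel ?b" using u2 ti by simp
  have c0: "0 \<le> compensator p T s" for s unfolding compensator_def using k by simp
  show ci: "integrable lborel (\<lambda>x. compensator p T (cmod (u x)))"
  proof (rule Bochner_Integration.integrable_bound[OF bi])
    show "(\<lambda>x. compensator p T (cmod (u x))) \<in> borel_measurable lborel" unfolding compensator_def by measurable
    show "AE x in lborel. norm (compensator p T (cmod (u x))) \<le> norm (?b x)"
    proof (rule AE_I2)
      fix x
      have "norm (compensator p T (cmod (u x))) = compensator p T (cmod (u x))" using c0 by simp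
      also have "\<dots> \<le> ?b x" by (rule cb(3))
      also have "\<dots> \<le> norm (?b x)" unfolding real_norm_def by (rule abs_ge_self)
      finally show "norm (compensator p T (cmod (u x))) \<le> norm (?b x)" .
    qed
  qed
  have "(LINT x|lborel. ?k * (T powr (p - 2) * (cmod (u x))\<^sup>2)) \<le> (LINT x|lborel. compensator p T (cmod (u x)))"
    using u2 ci cb(2) by (intro integral_mono) simp_all
  then show "?k * (T powr (p - 2) * (L2norm u)\<^sup>2) \<le> (LINT x|lborel. compensator p T (cmod (u x)))"
    by (simp add: L2norm_square)
  assume tail: "(\<integral>\<^sup>+x. ennreal (indicator {x. T < cmod (u x)} x * cmod (u x) powr p) \<partial>lborel) \<le> ennreal D" and D: "D \<ge> 0"
  have teq: "(\<lambda>x. indicator {x. T < cmod (u x)} x * cmod (u x) powr p) = ?t" by (auto simp: indicator_def)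
  have tle: "(LINT x|lborel. ?t x) \<le> D"
    using tail D unfolding teq[THEN fun_cong] by (subst (asm) nn_integral_eq_integral[OF ti]) auto
  have "(LINT x|lborel. compensator p T (cmod (u x))) \<le> (LINT x|lborel. ?b x)"
    by (intro integral_mono ci bi cb(3))
  also have "\<dots> = ?k * (T powr (p - 2) * (L2norm u)\<^sup>2 + (LINT x|lborel. ?t x))"
    using u2 ti by (simp add: L2norm_square)
  also have "\<dots> \<le> ?k * (T powr (p - 2) * (L2norm u)\<^sup>2 + D)" by (intro mult_left_mono k add_left_mono tle)
  finally show "(LINT x|lborel. compensator p T (cmod (u x))) \<le> ?k * (T powr (p - 2) * (L2norm u)\<^sup>2 + D)" .
qed

lemma potential_compensator_tendsto:
  assumes p: "p > 2" and T: "T > 0" and s: "s > 0" and f: "f \<longlonglongrightarrow> s"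
  shows "(\<lambda>n. potential p (f n) + compensator p T (f n)) \<longlonglongrightarrow> potential p s + compensator p T s"
  unfolding potential_def compensator_def using p T s by (intro tendsto_intros f) auto

lemma drift_form_le:
  assumes v: "norm v < 1" and u: "u \<in> H_half"
  shows "drift_form m v u \<le> 2 * half_energy u + \<bar>m\<bar> * (L2norm u)\<^sup>2"
proof -
  note uL = H_half_L2[OF u]
  note I = H_half_integrable[OF u] L2_integrable[OF fourier_spec(1)[OF uL]]
  have "drift_form m v u \<le> (LINT k|lborel. 2 * (norm k * (cmod (fourier u k))\<^sup>2) + \<bar>m\<bar> * (cmod (fourier u k))\<^sup>2)"
    unfolding drift_form_def
  proof (rule integral_mono[OF drift_form_integrable[OF v u]])
    show "integrable lborel (\<lambda>k. 2 * (norm k * (cmod (fourier u k))\<^sup>2) + \<bar>m\<bar> * (cmod (fourier u k))\<^sup>2)" using I by simp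
    show "drift_symbol m v k * (cmod (fourier u k))\<^sup>2 \<le> 2 * (norm k * (cmod (fourier u k))\<^sup>2) + \<bar>m\<bar> * (cmod (fourier u k))\<^sup>2" for k
      using mult_right_mono[OF drift_symbol_bounds(3)[OF v, of m k], of "(cmod (fourier u k))\<^sup>2"] by (simp add: algebra_simps)
  qed
  also have "\<dots> = 2 * half_energy u + \<bar>m\<bar> * (L2norm (fourier u))\<^sup>2"
    using I by (simp add: half_energy_def L2norm_square)
  finally show ?thesis by (simp add: fourier_isometry[OF uL])
qed

text \<open>
  Along a subsequence both the functions and their transforms converge almost everywhere and the
  quadratic form converges. Fatou's lemma then applies separately to the quadratic form and to the
  compensated potential.
\<close>
lemma E_energy_lower_semicontinuous:
  fixes v :: "'a::euclidean_space" and w :: "nat \<Rightarrow> 'a \<Rightarrow> complex"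
  assumes v: "norm v < 1" and p: "2 < p" "p < 2 + 2 / DIM('a)" and a: "a > 0"
    and w: "\<And>n. w n \<in> S_mass a" and M: "\<And>n. half_energy (w n) \<le> M"
    and u: "u \<in> L2" and lim: "(\<lambda>n. L2norm (\<lambda>x. w n x - u x)) \<longlonglongrightarrow> 0"
    and d: "(\<lambda>n. E_energy m v p (w n)) \<longlonglongrightarrow> d"
  shows "u \<in> S_mass a" "E_energy m v p u \<le> d"
proof -
  define \<kappa> where "\<kappa> = 1 / p + 1 / (p - 2)"
  have \<kappa>: "\<kappa> > 0" using p by (simp add: \<kappa>_def add_pos_pos)
  define \<tau> where "\<tau> = p - 2 - 2 / real DIM('a)"
  have \<tau>: "\<tau> < 0" using p by (simp add: \<tau>_def)
  have p0: "p > 0" using p by simp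
  have wW: "w n \<in> W_half" and wa: "(L2norm (w n))\<^sup>2 = a" for n using w by (auto simp: S_mass_iff)
  have wH: "w n \<in> H_half" for n using wW by (simp add: W_half_def)
  note wL = H_half_L2[OF wH]
  have wn: "L2norm (w n) = sqrt a" for n using wa[of n] L2norm_nonneg[of "w n"] by (simp add: real_sqrt_unique)
  have ua: "(L2norm u)\<^sup>2 = a"
  proof -
    have "(\<lambda>n. L2norm (w n)) \<longlonglongrightarrow> L2norm u" by (rule L2norm_tendsto[OF wL u lim])
    then have "L2norm u = sqrt a" unfolding wn using LIMSEQ_const_iff by metis
    then show ?thesis using a by simp
  qed
  have M0: "M \<ge> 0" using order_trans[OF half_energy_nonneg M[of 0]] .
  obtain K where K: "\<And>u :: 'a \<Rightarrow> complex. u \<in> S_mass a \<Longrightarrow> integrable lborel (\<lambda>x. cmod (u x) powr p) \<and>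
     (1 - norm v) / 4 * half_energy u \<le> E_energy m v p u + K \<and>
     (LINT x|lborel. cmod (u x) powr p) \<le> K * (1 + half_energy u)"
    by (rule E_energy_coercive[OF v p a, of m]) blast
  have wp: "integrable lborel (\<lambda>x. cmod (w n x) powr p)" for n using K[OF w] by blast
  obtain C where C: "C \<ge> 0" "\<And>(u :: 'a \<Rightarrow> complex) T. u \<in> H_half \<Longrightarrow> L2norm u \<le> sqrt a \<Longrightarrow> T > 0 \<Longrightarrow>
     (\<integral>\<^sup>+x. ennreal (indicator {x. T < cmod (u x)} x * cmod (u x) powr p) \<partial>lborel)
       \<le> ennreal (C * T powr (p - 2 - 2 / DIM('a)) * half_energy u)"
    by (rule Lp_tail_uniform[OF real_sqrt_ge_zero[OF less_imp_le[OF a]] p]) blast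
  note C = C[folded \<tau>_def]
  have "bounded (range (\<lambda>n. drift_form m v (w n)))"
  proof (rule boundedI)
    fix x assume "x \<in> range (\<lambda>n. drift_form m v (w n))"
    then obtain n where x: "x = drift_form m v (w n)" by blast
    have "x \<le> 2 * M + \<bar>m\<bar> * a" using drift_form_le[OF v wH, of m n] M[of n] wa[of n] x by simp
    then show "norm x \<le> 2 * M + \<bar>m\<bar> * a" using drift_form_ge(2)[OF v wH, of m n] x by simp
  qed
  then obtain \<Phi> r1 where r1: "strict_mono r1" and \<Phi>: "((\<lambda>n. drift_form m v (w n)) \<circ> r1) \<longlonglongrightarrow> \<Phi>"
    using bounded_imp_convergent_subsequence by blast
  have lim1: "(\<lambda>n. L2norm (\<lambda>x. w (r1 n) x - u x)) \<longlonglongrightarrow> 0"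
    using LIMSEQ_subseq_LIMSEQ[OF lim r1] by (simp add: o_def)
  obtain r2 where r2: "strict_mono r2" "AE x in lborel. (\<lambda>n. w (r1 (r2 n)) x) \<longlonglongrightarrow> u x"
    by (rule L2_limit_AE_subseq[OF wL u lim1])
  have lim2: "(\<lambda>n. L2norm (\<lambda>k. fourier (w (r1 (r2 n))) k - fourier u k)) \<longlonglongrightarrow> 0"
    unfolding fourier_diff_isometry[OF wL u] using LIMSEQ_subseq_LIMSEQ[OF lim1 r2(1)] by (simp add: o_def)
  obtain r3 where r3: "strict_mono r3" "AE k in lborel. (\<lambda>n. fourier (w (r1 (r2 (r3 n)))) k) \<longlonglongrightarrow> fourier u k"
    by (rule L2_limit_AE_subseq[OF fourier_spec(1)[OF wL] fourier_spec(1)[OF u] lim2])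
  define r where "r n = r1 (r2 (r3 n))" for n
  have AEw: "AE x in lborel. (\<lambda>n. w (r n) x) \<longlonglongrightarrow> u x"
    using r2(2) by eventually_elim (use LIMSEQ_subseq_LIMSEQ[OF _ r3(1)] in \<open>force simp: r_def o_def\<close>)
  have AEF: "AE k in lborel. (\<lambda>n. fourier (w (r n)) k) \<longlonglongrightarrow> fourier u k" using r3(2) by (simp add: r_def)
  have \<Phi>r: "(\<lambda>n. drift_form m v (w (r n))) \<longlonglongrightarrow> \<Phi>"
    using LIMSEQ_subseq_LIMSEQ[OF LIMSEQ_subseq_LIMSEQ[OF \<Phi> r2(1)] r3(1)] by (simp add: r_def o_def)
  have dr: "(\<lambda>n. E_energy m v p (w (r n))) \<longlonglongrightarrow> d"
    using LIMSEQ_subseq_LIMSEQ[OF LIMSEQ_subseq_LIMSEQ[OF LIMSEQ_subseq_LIMSEQ[OF d r1] r2(1)] r3(1)] by (simp add: r_def o_def)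
  have [measurable]: "fourier (w n) \<in> borel_measurable borel" "w n \<in> borel_measurable borel" for n
    using fourier_measurable[OF wL] L2_measurable[OF wL] by auto
  note [measurable] = fourier_measurable[OF u] L2_measurable[OF u]
  have "(\<integral>\<^sup>+k. ennreal (norm k * (cmod (fourier u k))\<^sup>2) \<partial>lborel) \<le> ennreal M"
  proof (rule nn_integral_Fatou_bound[where b="\<lambda>_. M"])
    show "AE k in lborel. (\<lambda>n. ennreal (norm k * (cmod (fourier (w (r n)) k))\<^sup>2)) \<longlonglongrightarrow> ennreal (norm k * (cmod (fourier u k))\<^sup>2)"
      using AEF by eventually_elim (intro tendsto_ennrealI tendsto_intros)
    show "(\<integral>\<^sup>+k. ennreal (norm k * (cmod (fourier (w (r n)) k))\<^sup>2) \<partial>lborel) \<le> ennreal M" for n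
      using M[of "r n"] by (subst nn_integral_eq_integral[OF H_half_integrable[OF wH]]) (auto simp: half_energy_def intro!: ennreal_leI)
  qed auto
  then have "integrable lborel (\<lambda>k. norm k * (cmod (fourier u k))\<^sup>2)"
    by (intro integrableI_nonneg) (auto intro: le_less_trans)
  then have uH: "u \<in> H_half" by (rule H_half_I[OF u])
  have \<Phi>0: "\<Phi> \<ge> 0" by (rule LIMSEQ_le_const[OF \<Phi>r]) (use drift_form_ge(2)[OF v wH] in auto)
  have "(\<integral>\<^sup>+k. ennreal (drift_symbol m v k * (cmod (fourier u k))\<^sup>2) \<partial>lborel) \<le> ennreal \<Phi>"
  proof (rule nn_integral_Fatou_bound[OF _ _ _ \<Phi>r])
    show "AE k in lborel. (\<lambda>n. ennreal (drift_symbol m v k * (cmod (fourier (w (r n)) k))\<^sup>2)) \<longlonglongrightarrow> ennreal (drift_symbol m v k * (cmod (fourier u k))\<^sup>2)"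
      using AEF by eventually_elim (intro tendsto_ennrealI tendsto_intros)
    show "(\<integral>\<^sup>+k. ennreal (drift_symbol m v k * (cmod (fourier (w (r n)) k))\<^sup>2) \<partial>lborel) \<le> ennreal (drift_form m v (w (r n)))" for n
      by (subst nn_integral_eq_integral[OF drift_form_integrable[OF v wH]]) (use drift_symbol_bounds(2)[OF v, of m] in \<open>auto simp: drift_form_def\<close>)
  qed measurable
  then have \<Phi>le: "drift_form m v u \<le> \<Phi>"
    using drift_symbol_bounds(2)[OF v, of m] \<Phi>0
    by (subst (asm) nn_integral_eq_integral[OF drift_form_integrable[OF v uH]]) (auto simp: drift_form_def)
  have us: "L2norm u \<le> sqrt a" using ua by (simp add: real_le_rsqrt)
  have up: "integrable lborel (\<lambda>x. cmod (u x) powr p)"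
    by (rule Lp_bound(1)[OF u p(1) zero_less_one _ C(2)[OF uH us zero_less_one]]) (use C(1) in simp)
  let ?N = "d - \<Phi> / 2 + m * a / 2"
  let ?G = "\<lambda>T z x. potential p (cmod (z x)) + compensator p T (cmod (z x))"
  have G: "integrable lborel (?G T u) \<and> (LINT x|lborel. ?G T u x) \<le> ?N + \<kappa> * (T powr (p - 2) * a + C * T powr \<tau> * M)"
    if T: "T > 0" for T
  proof -
    let ?R = "\<kappa> * (T powr (p - 2) * a + C * T powr \<tau> * M)"
    let ?b = "\<lambda>n. E_energy m v p (w (r n)) - drift_form m v (w (r n)) / 2 + m * a / 2 + ?R"
    have Gn: "integrable lborel (?G T (w n))" "(LINT x|lborel. ?G T (w n) x) \<le> E_energy m v p (w n) - drift_form m v (w n) / 2 + m * a / 2 + ?R" for n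
    proof -
      note pi = potential_integral(1)[OF wW[of n] wp[of n]] and ci = compensator_integral[OF p(1) T wL[of n] wp[of n]]
      show "integrable lborel (?G T (w n))" by (intro Bochner_Integration.integrable_add pi ci(1))
      have D: "C * T powr \<tau> * half_energy (w n) \<ge> 0" using C(1) by simp
      have "(LINT x|lborel. compensator p T (cmod (w n x))) \<le> \<kappa> * (T powr (p - 2) * a + C * T powr \<tau> * half_energy (w n))"
        using ci(3)[OF C(2)[OF wH _ T] D] wn wa unfolding \<kappa>_def by simp
      also have "\<dots> \<le> ?R" using \<kappa> C(1) M by (intro mult_left_mono add_left_mono) auto
      finally have "(LINT x|lborel. compensator p T (cmod (w n x))) \<le> ?R" .
      then show "(LINT x|lborel. ?G T (w n) x) \<le> E_energy m v p (w n) - drift_form m v (w n) / 2 + m * a / 2 + ?R"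
        using pi ci(1) E_energy_potential[OF v p0 wW[of n] wp[of n], of m] wa[of n] by simp
    qed
    have G0: "0 \<le> ?G T z x" for z :: "'a \<Rightarrow> complex" and x by (rule compensator_bounds(1)[OF p(1) norm_ge_zero T])
    have b: "?b \<longlonglongrightarrow> ?N + ?R" by (intro tendsto_intros dr \<Phi>r) simp
    have b0: "0 \<le> ?b n" for n
    proof -
      have "0 \<le> (LINT x|lborel. ?G T (w (r n)) x)" by (rule integral_nonneg_AE) (simp add: G0)
      then show ?thesis by (rule order_trans[OF _ Gn(2)])
    qed
    have N0: "0 \<le> ?N + ?R" by (rule LIMSEQ_le_const[OF b]) (use b0 in blast)
    have Gm: "(\<lambda>x. ?G T z x) \<in> borel_measurable borel" if "z \<in> borel_measurable borel" for z :: "'a \<Rightarrow> complex"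
      unfolding potential_def compensator_def using that by measurable
    have Gle: "(\<integral>\<^sup>+x. ennreal (?G T u x) \<partial>lborel) \<le> ennreal (?N + ?R)"
    proof (rule nn_integral_Fatou_bound_zero[OF _ _ _ b])
      show "(\<lambda>x. ennreal (?G T (w (r n)) x)) \<in> borel_measurable lborel" for n
        using Gm[OF L2_measurable[OF wL]] by measurable
      show "AE x in lborel. ennreal (?G T u x) = 0 \<or> (\<lambda>n. ennreal (?G T (w (r n)) x)) \<longlonglongrightarrow> ennreal (?G T u x)"
        using AEw
      proof eventually_elim
        case (elim x)
        show ?case
        proof (cases "u x = 0")
          case True
          then show ?thesis by (simp add: potential_def compensator_def)
        next
          case False
          then have "(\<lambda>n. ?G T (w (r n)) x) \<longlonglongrightarrow> ?G T u x"
            using potential_compensator_tendsto[OF p(1) T _ tendsto_norm[OF elim]] by simp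
          then show ?thesis by (intro disjI2 tendsto_ennrealI)
        qed
      qed
      show "(\<integral>\<^sup>+x. ennreal (?G T (w (r n)) x) \<partial>lborel) \<le> ennreal (?b n)" for n
        using Gn[of "r n"] G0 by (subst nn_integral_eq_integral) (auto intro!: ennreal_leI)
    qed
    have Gi: "integrable lborel (?G T u)"
      by (rule integrableI_nonneg) (use Gm[OF L2_measurable[OF u]] G0 le_less_trans[OF Gle] in auto)
    moreover have "(LINT x|lborel. ?G T u x) \<le> ?N + ?R"
      using Gle N0 G0 by (subst (asm) nn_integral_eq_integral[OF Gi]) auto
    ultimately show ?thesis by blast
  qed
  note ci = compensator_integral[OF p(1) _ u up]
  have poti: "integrable lborel (\<lambda>x. potential p (cmod (u x)))"
    using Bochner_Integration.integrable_diff[OF conjunct1[OF G[OF zero_less_one]] ci(1)[OF zero_less_one]] by simp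
  have "integrable lborel (\<lambda>x. (cmod (u x))\<^sup>2 * ln ((cmod (u x))\<^sup>2))"
  proof -
    have "integrable lborel (\<lambda>x. (cmod (u x))\<^sup>2 - 2 * potential p (cmod (u x)) - 2 / p * cmod (u x) powr p)"
      using poti up L2_integrable[OF u] by simp
    moreover have "(cmod (u x))\<^sup>2 - 2 * potential p (cmod (u x)) - 2 / p * cmod (u x) powr p = (cmod (u x))\<^sup>2 * ln ((cmod (u x))\<^sup>2)" for x
      using p0 by (simp add: potential_def field_simps)
    ultimately show ?thesis by simp
  qed
  then have uW: "u \<in> W_half" using uH by (simp add: W_half_def)
  then show "u \<in> S_mass a" using ua by (simp add: S_mass_iff)
  have "(LINT x|lborel. potential p (cmod (u x))) \<le> ?N"
  proof (rule field_le_epsilon)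
    fix e :: real assume e: "e > 0"
    define q where "q = e / (\<kappa> * C * M + 1)"
    have den: "\<kappa> * C * M + 1 > 0" using \<kappa> C(1) M0 by (simp add: add_nonneg_pos)
    have q: "q > 0" using e den by (simp add: q_def)
    (* since \<tau> < 0, a small q = T powr \<tau> corresponds to a large T *)
    define T where "T = q powr (1 / \<tau>)"
    have T: "T > 0" "T powr \<tau> = q" using q \<tau> by (auto simp: T_def powr_powr)
    have "(LINT x|lborel. ?G T u x) = (LINT x|lborel. potential p (cmod (u x))) + (LINT x|lborel. compensator p T (cmod (u x)))"
      using poti ci(1)[OF T(1)] by simp
    moreover have "\<kappa> * (T powr (p - 2) * a) \<le> (LINT x|lborel. compensator p T (cmod (u x)))"
      using ci(2)[OF T(1)] ua unfolding \<kappa>_def by simp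
    moreover have "(LINT x|lborel. ?G T u x) \<le> ?N + \<kappa> * (T powr (p - 2) * a + C * q * M)"
      using G[OF T(1)] unfolding T(2) by blast
    moreover have "\<kappa> * (T powr (p - 2) * a + C * q * M) = \<kappa> * (T powr (p - 2) * a) + \<kappa> * C * M * q"
      by (simp add: distrib_left)
    moreover have "\<kappa> * C * M * q \<le> e"
    proof -
      have "\<kappa> * C * M * q \<le> (\<kappa> * C * M + 1) * q" using q by (intro mult_right_mono) auto
      also have "\<dots> = e" using den by (simp add: q_def)
      finally show ?thesis .
    qed
    ultimately show "(LINT x|lborel. potential p (cmod (u x))) \<le> ?N + e" by linarith
  qed
  then show "E_energy m v p u \<le> d"
    using E_energy_potential[OF v p0 uW up, of m] \<Phi>le ua by simp
qed

lemma W_half_translate: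
  fixes u :: "'a::euclidean_space \<Rightarrow> complex"
  assumes u: "u \<in> W_half"
  shows "(\<lambda>x. u (x + y)) \<in> W_half" "L2norm (\<lambda>x. u (x + y)) = L2norm u"
    "half_energy (\<lambda>x. u (x + y)) = half_energy u"
    "norm v < 1 \<Longrightarrow> p > 0 \<Longrightarrow> integrable lborel (\<lambda>x. cmod (u x) powr p) \<Longrightarrow> E_energy m v p (\<lambda>x. u (x + y)) = E_energy m v p u"
proof -
  let ?w = "\<lambda>x. u (x + y)"
  have uH: "u \<in> H_half" using u by (simp add: W_half_def)
  note uL = H_half_L2[OF uH] note wL = L2_shift[OF uL, of y]
  note [measurable] = fourier_measurable[OF uL] fourier_measurable[OF wL(1)] L2_measurable[OF uL]
  have F: "AE k in lborel. cmod (fourier ?w k) = cmod (fourier u k)"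
  proof -
    have "AE k in lborel. fourier ?w k = cis (k \<bullet> y) * fourier u k" using fourier_translate[OF uL, of "-y"] by simp
    then show ?thesis by eventually_elim (simp add: norm_mult)
  qed
  have "integrable lborel (\<lambda>k. norm k * (cmod (fourier ?w k))\<^sup>2) \<longleftrightarrow> integrable lborel (\<lambda>k. norm k * (cmod (fourier u k))\<^sup>2)"
    by (rule integrable_cong_AE) (measurable, use F in eventually_elim, simp)
  then have wH: "?w \<in> H_half" using H_half_integrable[OF uH] by (intro H_half_I wL) simp
  have ul: "integrable lborel (\<lambda>x. (cmod (u x))\<^sup>2 * ln ((cmod (u x))\<^sup>2))" using u by (simp add: W_half_def)
  show w: "?w \<in> W_half" using wH integrable_lborel_shift[OF ul, of y] by (simp add: W_half_def)
  show n: "L2norm ?w = L2norm u" by (rule wL(2))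
  show "half_energy ?w = half_energy u" unfolding half_energy_def
    by (rule integral_cong_AE) (measurable, use F in eventually_elim, simp)
  assume v: "norm v < 1" and p: "p > 0" and up: "integrable lborel (\<lambda>x. cmod (u x) powr p)"
  have "drift_form m v ?w = drift_form m v u" unfolding drift_form_def
    by (rule integral_cong_AE) (measurable, use F in eventually_elim, simp)
  moreover have "log_term ?w = log_term u" unfolding log_term_def
    by (rule integral_lborel_shift[OF log_term_eq(1)[OF u]])
  moreover have "(LINT x|lborel. cmod (?w x) powr p) = (LINT x|lborel. cmod (u x) powr p)"
    by (rule integral_lborel_shift[OF up])
  ultimately show "E_energy m v p ?w = E_energy m v p u"
    by (simp add: E_energy_eq[OF v wH p] E_energy_eq[OF v uH p] n)
qed

section \<open>Existence of a minimizer\<close>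

lemma L2_ball_mass:
  fixes u :: "'a::euclidean_space \<Rightarrow> complex"
  assumes u: "u \<in> L2" and A: "A \<in> sets borel"
  shows "integrable lborel (\<lambda>x. indicat_real A x * (cmod (u x))\<^sup>2)"
    "(LINT x|lborel. indicat_real A x * (cmod (u x))\<^sup>2) \<le> (L2norm u)\<^sup>2"
proof -
  have m: "indicat_real A \<in> borel_measurable borel" using A by simp
  show i: "integrable lborel (\<lambda>x. indicat_real A x * (cmod (u x))\<^sup>2)"
    by (rule integrable_bounded_mult[OF L2_integrable[OF u] m, of 1]) (auto simp: indicator_def)
  show "(LINT x|lborel. indicat_real A x * (cmod (u x))\<^sup>2) \<le> (L2norm u)\<^sup>2"
    unfolding L2norm_square by (rule integral_mono[OF i L2_integrable[OF u]]) (auto simp: indicator_def)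
qed

lemma localize_mass_le:
  fixes u :: "'a::euclidean_space \<Rightarrow> complex"
  assumes u: "u \<in> L2" and \<eta>: "cutoff \<eta> L"
  shows "(L2norm (localize \<eta> u y))\<^sup>2 \<le> (LINT x|lborel. indicat_real (cball y L) x * (cmod (u x))\<^sup>2)"
  unfolding L2norm_square
proof (rule integral_mono[OF L2_integrable[OF localize_L2(1)[OF u \<eta>]]])
  show "integrable lborel (\<lambda>x. indicat_real (cball y L) x * (cmod (u x))\<^sup>2)"
    by (rule L2_ball_mass(1)[OF u]) simp
  show "(cmod (localize \<eta> u y x))\<^sup>2 \<le> indicat_real (cball y L) x * (cmod (u x))\<^sup>2" for x
  proof (cases "x \<in> cball y L")
    case True
    have "(\<eta> (x - y))\<^sup>2 \<le> 1" using cutoffD(2,3)[OF \<eta>] by (simp add: power_le_one)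
    from mult_right_mono[OF this, of "(cmod (u x))\<^sup>2"] show ?thesis
      using True by (simp add: localize_integrands(1)[OF \<eta> zero_less_one])
  next
    case False
    then have "\<eta> (x - y) = 0" using cutoffD(4)[OF \<eta>, of "x - y"] by (simp add: dist_norm norm_minus_commute)
    then show ?thesis by (simp add: localize_def)
  qed
qed

lemma ball_cut_complement_mass:
  fixes u :: "'a::euclidean_space \<Rightarrow> complex"
  assumes u: "u \<in> L2"
  shows "(L2norm (\<lambda>x. u (x + y) - ball_cut (\<lambda>x. u (x + y)) R x))\<^sup>2 =
    (L2norm u)\<^sup>2 - (LINT x|lborel. indicat_real (cball y R) x * (cmod (u x))\<^sup>2)"
proof -
  let ?w = "\<lambda>x. u (x + y)"
  have w: "?w \<in> L2" by (rule L2_shift(1)[OF u])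
  have i: "integrable lborel (\<lambda>x. indicat_real (cball y R) x * (cmod (u x))\<^sup>2)" by (rule L2_ball_mass(1)[OF u]) simp
  have i': "integrable lborel (\<lambda>x. indicat_real (cball 0 R) x * (cmod (?w x))\<^sup>2)" by (rule L2_ball_mass(1)[OF w]) simp
  have "(cmod (?w x - ball_cut ?w R x))\<^sup>2 = (cmod (?w x))\<^sup>2 - indicat_real (cball 0 R) x * (cmod (?w x))\<^sup>2" for x
    by (simp add: ball_cut_def indicator_def)
  then have "(L2norm (\<lambda>x. ?w x - ball_cut ?w R x))\<^sup>2 = (L2norm ?w)\<^sup>2 - (LINT x|lborel. indicat_real (cball 0 R) x * (cmod (?w x))\<^sup>2)"
    using L2_integrable[OF w] i' by (simp add: L2norm_square)
  moreover have "indicat_real (cball 0 R) x * (cmod (?w x))\<^sup>2 = indicat_real (cball y R) (x + y) * (cmod (u (x + y)))\<^sup>2" for x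
    by (simp add: indicator_def dist_norm)
  ultimately show ?thesis using integral_lborel_shift[OF i, of y] L2_shift(2)[OF u, of y] by simp
qed

text \<open>
  Two balls that carry more than half of the mass each must meet, so the centres chosen for a fixed
  fraction of the mass serve every larger fraction, at the price of a larger radius.
\<close>
lemma concentration_imp_tight:
  fixes u :: "nat \<Rightarrow> 'a::euclidean_space \<Rightarrow> complex"
  assumes a: "a > 0" and u: "\<And>n. u n \<in> L2" and ua: "\<And>n. (L2norm (u n))\<^sup>2 = a"
    and conc: "\<And>e. e > 0 \<Longrightarrow> \<exists>L n0. \<forall>n\<ge>n0. \<exists>y. a * exp (- e) < (LINT x|lborel. indicat_real (cball y L) x * (cmod (u n x))\<^sup>2)"
  obtains y where "\<And>e. e > 0 \<Longrightarrow> \<exists>(j::nat) n0. \<forall>n\<ge>n0.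
      L2norm (\<lambda>x. u n (x + y n) - ball_cut (\<lambda>x. u n (x + y n)) (real j) x) \<le> e"
proof -
  define \<mu> where "\<mu> n A = (LINT x|lborel. indicat_real A x * (cmod (u n x))\<^sup>2)" for n A
  (* the fraction exp (- ln (3/2)) = 2/3 exceeds 1/2 *)
  have half: "ln (3/2 :: real) > 0" by simp
  have e23: "exp (- ln (3/2 :: real)) = 2/3" by (simp add: exp_minus)
  obtain L0 n0 where 0: "\<And>n. n \<ge> n0 \<Longrightarrow> \<exists>y. a * (2/3) < \<mu> n (cball y L0)"
    using conc[OF half] unfolding e23 \<mu>_def by blast
  then obtain y where y: "\<And>n. n \<ge> n0 \<Longrightarrow> a * (2/3) < \<mu> n (cball (y n) L0)" by metis
  show ?thesis
  proof (rule that[of y])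
    fix e :: real assume e: "e > 0"
    (* the first bound makes 1 - exp (- e') at most e^2 / a, the second keeps the fraction at least 2/3 *)
    define e' where "e' = min (e\<^sup>2 / a) (ln (3/2))"
    have e': "e' > 0" "e' \<le> ln (3/2)" "a * e' \<le> e\<^sup>2"
      using e a half by (auto simp: e'_def min_def field_simps)
    obtain L1 n1 where 1: "\<And>n. n \<ge> n1 \<Longrightarrow> \<exists>z. a * exp (- e') < \<mu> n (cball z L1)"
      using conc[OF e'(1)] unfolding \<mu>_def by blast
    define j where "j = nat \<lceil>L0 + 2 * L1\<rceil>"
    have j: "L0 + 2 * L1 \<le> real j" unfolding j_def by (rule real_nat_ceiling_ge)
    have "L2norm (\<lambda>x. u n (x + y n) - ball_cut (\<lambda>x. u n (x + y n)) (real j) x) \<le> e" if n: "n \<ge> max n0 n1" for n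
    proof -
      obtain z where z: "a * exp (- e') < \<mu> n (cball z L1)" using 1[of n] n by auto
      have "exp (- ln (3/2)) \<le> exp (- e')" using e'(2) by simp
      then have "a * (2/3) \<le> a * exp (- e')" unfolding e23 using a by (intro mult_left_mono) auto
      then have z23: "a * (2/3) < \<mu> n (cball z L1)" using z by linarith
      have i: "integrable lborel (\<lambda>x. indicat_real (cball c R) x * (cmod (u n x))\<^sup>2)" for c R
        by (rule L2_ball_mass(1)[OF u]) simp
      have "cball (y n) L0 \<inter> cball z L1 \<noteq> {}"
      proof
        assume dis: "cball (y n) L0 \<inter> cball z L1 = {}"
        have "\<mu> n (cball (y n) L0) + \<mu> n (cball z L1) =
            (LINT x|lborel. indicat_real (cball (y n) L0) x * (cmod (u n x))\<^sup>2 + indicat_real (cball z L1) x * (cmod (u n x))\<^sup>2)"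
          unfolding \<mu>_def using i by simp
        also have "\<dots> = (LINT x|lborel. indicat_real (cball (y n) L0 \<union> cball z L1) x * (cmod (u n x))\<^sup>2)"
          by (rule Bochner_Integration.integral_cong) (simp_all add: indicator_disj_union[OF dis] distrib_right)
        also have "\<dots> \<le> a" using L2_ball_mass(2)[OF u, of "cball (y n) L0 \<union> cball z L1" n] ua[of n] by simp
        finally show False using z23 y[of n] n a by simp
      qed
      then obtain c where c: "dist (y n) c \<le> L0" "dist z c \<le> L1" by auto
      have sub: "cball z L1 \<subseteq> cball (y n) (real j)"
      proof
        fix x assume "x \<in> cball z L1"
        then show "x \<in> cball (y n) (real j)"
          using c j dist_triangle[of "y n" x c] dist_triangle2[of c x z] by (simp add: dist_commute)
      qed
      have "\<mu> n (cball z L1) \<le> \<mu> n (cball (y n) (real j))"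
        unfolding \<mu>_def using sub by (intro integral_mono i mult_right_mono) (auto simp: indicator_def)
      then have "(L2norm (\<lambda>x. u n (x + y n) - ball_cut (\<lambda>x. u n (x + y n)) (real j) x))\<^sup>2 \<le> a - a * exp (- e')"
        unfolding ball_cut_complement_mass[OF u] ua \<mu>_def[symmetric] using z by linarith
      also have "\<dots> \<le> a * e'"
      proof -
        have "1 - exp (- e') \<le> e'" using exp_ge_add_one_self[of "- e'"] by simp
        from mult_left_mono[OF this, of a] show ?thesis using a by (simp add: right_diff_distrib)
      qed
      also have "\<dots> \<le> e\<^sup>2" by (rule e'(3))
      finally show ?thesis by (rule power2_le_imp_le) (use e in simp)
    qed
    then show "\<exists>(j::nat) n0. \<forall>n\<ge>n0. L2norm (\<lambda>x. u n (x + y n) - ball_cut (\<lambda>x. u n (x + y n)) (real j) x) \<le> e"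
      by blast
  qed
qed

text \<open>
  The tolerance \<open>\<epsilon>\<close> of the cutoff depends only on the uniform bound for the integrals of \<open>|u n|\<^sup>p\<close>, so one cutoff works for
  the whole sequence. The localization error and the excess energy take \<open>a e / 4\<close> each.
\<close>
lemma minimizing_sequence_concentrates:
  fixes v :: "'a::euclidean_space" and u :: "nat \<Rightarrow> 'a \<Rightarrow> complex"
  assumes v: "norm v < 1" and p: "p > 2" and a: "a > 0" and e: "e > 0"
    and d: "\<And>\<phi> :: 'a \<Rightarrow> complex. \<phi> \<in> S_mass a \<Longrightarrow> d \<le> E_energy m v p \<phi>"
    and u: "\<And>n. u n \<in> S_mass a" and ud: "(\<lambda>n. E_energy m v p (u n)) \<longlonglongrightarrow> d"
    and up: "\<And>n. integrable lborel (\<lambda>x. cmod (u n x) powr p)" and P: "\<And>n. (LINT x|lborel. cmod (u n x) powr p) \<le> B"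
  shows "\<exists>L n0. \<forall>n\<ge>n0. \<exists>y. a * exp (- e) < (LINT x|lborel. indicat_real (cball y L) x * (cmod (u n x))\<^sup>2)"
proof -
  let ?X = "3 * a / 2 + B / p"
  have B0: "B \<ge> 0" by (rule order_trans[OF _ P[of 0]]) (rule integral_nonneg_AE, auto)
  have X: "?X > 0" using a B0 p by (simp add: add_pos_nonneg)
  define \<epsilon> where "\<epsilon> = min 1 (a * e / 4 / ?X)"
  have "a * e / 4 / ?X > 0" using a e X by (intro divide_pos_pos) auto
  then have \<epsilon>: "0 < \<epsilon>" "\<epsilon> \<le> 1" by (auto simp: \<epsilon>_def)
  have \<epsilon>X: "\<epsilon> * ?X \<le> a * e / 4"
  proof -
    have "\<epsilon> \<le> a * e / 4 / ?X" by (simp add: \<epsilon>_def)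
    then show ?thesis using X by (simp only: pos_le_divide_eq)
  qed
  obtain \<eta> :: "'a \<Rightarrow> real" and L where \<eta>: "cutoff \<eta> L" "(LINT x|lborel. (\<eta> x)\<^sup>2) > 0"
    "(1 - \<epsilon>) * (LINT x|lborel. (\<eta> x)\<^sup>2) \<le> (LINT x|lborel. \<eta> x powr p)"
    "- (\<epsilon> * (LINT x|lborel. (\<eta> x)\<^sup>2)) \<le> (LINT x|lborel. (\<eta> x)\<^sup>2 * ln ((\<eta> x)\<^sup>2))"
    "(\<integral>\<^sup>+l. ennreal (norm l * (cmod (fourier_integral (\<lambda>x. complex_of_real (\<eta> x)) l))\<^sup>2) \<partial>lborel)
       \<le> ennreal (\<epsilon> * (LINT x|lborel. (\<eta> x)\<^sup>2))"
    by (rule cheap_cutoff_exists[OF p \<epsilon>]) blast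
  have "d < d + a * e / 4" using a e by simp
  from order_tendstoD(2)[OF ud this] obtain n0 where n0: "\<And>n. n \<ge> n0 \<Longrightarrow> E_energy m v p (u n) < d + a * e / 4"
    by (auto simp: eventually_sequentially)
  have "\<exists>y. a * exp (- e) < (LINT x|lborel. indicat_real (cball y L) x * (cmod (u n x))\<^sup>2)" if "n \<ge> n0" for n
  proof -
    have "(LINT x|lborel. cmod (u n x) powr p) / p \<le> B / p" using P p by (intro divide_right_mono) auto
    then have "\<epsilon> * (3 * a / 2 + (LINT x|lborel. cmod (u n x) powr p) / p) \<le> \<epsilon> * ?X"
      using \<epsilon> by (intro mult_left_mono) auto
    then have "E_energy m v p (u n) - d + \<epsilon> * (3 * a / 2 + (LINT x|lborel. cmod (u n x) powr p) / p) < a * e / 2"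
      using n0[OF that] \<epsilon>X by linarith
    from almost_minimizer_concentrates[OF v p a e u up d \<eta> \<epsilon>(1) this]
    obtain y where y: "a * exp (- e) < (L2norm (localize \<eta> (u n) y))\<^sup>2" by blast
    have "u n \<in> L2" using u[of n] by (simp add: S_mass_def W_half_def H_half_def)
    from less_le_trans[OF y localize_mass_le[OF this \<eta>(1)]] show ?thesis by blast
  qed
  then show ?thesis by blast
qed

text \<open>
  The direct method: a minimizing sequence is recentred at its points of concentration, which changes
  neither mass nor energy, and then has a convergent subsequence.
\<close>
lemma minimizer_exists:
  fixes v :: "'a::euclidean_space"
  assumes v: "norm v < 1" and p: "2 < p" "p < 2 + 2 / DIM('a)" and a: "a > 0"
  shows "\<exists>\<phi>\<in>S_mass a. \<forall>\<psi>\<in>S_mass a. E_energy m v p \<phi> \<le> E_energy m v p \<psi>"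
proof -
  let ?S = "S_mass a :: ('a \<Rightarrow> complex) set"
  let ?E = "E_energy m v p"
  obtain K where K: "\<And>u :: 'a \<Rightarrow> complex. u \<in> ?S \<Longrightarrow> integrable lborel (\<lambda>x. cmod (u x) powr p) \<and>
     (1 - norm v) / 4 * half_energy u \<le> ?E u + K \<and> (LINT x|lborel. cmod (u x) powr p) \<le> K * (1 + half_energy u)"
    by (rule E_energy_coercive[OF v p a, of m]) blast
  have p0: "p > 0" using p by simp
  have bdd: "bdd_below (?E ` ?S)"
  proof (rule bdd_belowI2)
    fix u assume "u \<in> ?S"
    moreover have "0 \<le> (1 - norm v) / 4 * half_energy u" using v by simp
    ultimately show "- K \<le> ?E u" using K[of u] by linarith
  qed
  have ne: "?S \<noteq> {}" by (rule S_mass_nonempty[OF a])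
  define d where "d = (INF u\<in>?S. ?E u)"
  have d: "d \<le> ?E u" if "u \<in> ?S" for u unfolding d_def by (rule cINF_lower[OF bdd that])
  have "\<exists>u. u \<in> ?S \<and> ?E u < d + 1 / real (Suc n)" for n
  proof -
    have "(INF u\<in>?S. ?E u) < d + 1 / real (Suc n)" unfolding d_def by simp
    then show ?thesis using cINF_less_iff[OF ne bdd] by auto
  qed
  then obtain u where u: "\<And>n. u n \<in> ?S" and uE: "\<And>n. ?E (u n) < d + 1 / real (Suc n)" by metis
  have ud: "(\<lambda>n. ?E (u n)) \<longlonglongrightarrow> d"
  proof (rule tendsto_sandwich[OF _ _ tendsto_const])
    show "\<forall>\<^sub>F n in sequentially. d \<le> ?E (u n)" using d[OF u] by simp
    show "\<forall>\<^sub>F n in sequentially. ?E (u n) \<le> d + 1 / real (Suc n)" using uE less_imp_le by (intro always_eventually) blast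
    show "(\<lambda>n. d + 1 / real (Suc n)) \<longlonglongrightarrow> d" using tendsto_add[OF tendsto_const LIMSEQ_Suc[OF lim_1_over_n]] by force
  qed
  have uW: "u n \<in> W_half" and ua: "(L2norm (u n))\<^sup>2 = a" for n using u by (auto simp: S_mass_iff)
  have uL: "u n \<in> L2" for n using uW by (simp add: W_half_def H_half_def)
  define M where "M = (d + 1 + K) / ((1 - norm v) / 4)"
  have M: "half_energy (u n) \<le> M" for n
  proof -
    have "1 / real (Suc n) \<le> 1" by simp
    then have "(1 - norm v) / 4 * half_energy (u n) \<le> d + 1 + K" using K[OF u, of n] uE[of n] by linarith
    then have "half_energy (u n) * ((1 - norm v) / 4) \<le> d + 1 + K" by (simp only: mult.commute)
    then show ?thesis unfolding M_def using v by (subst pos_le_divide_eq) auto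
  qed
  have up: "integrable lborel (\<lambda>x. cmod (u n x) powr p)" for n using K[OF u] by blast
  have P: "(LINT x|lborel. cmod (u n x) powr p) \<le> \<bar>K\<bar> * (1 + M)" for n
  proof -
    have "K * (1 + half_energy (u n)) \<le> \<bar>K\<bar> * (1 + M)"
      using M[of n] by (intro mult_mono) auto
    then show ?thesis using K[OF u, of n] by linarith
  qed
  obtain y where tight: "\<And>e. e > 0 \<Longrightarrow> \<exists>(j::nat) n0. \<forall>n\<ge>n0.
      L2norm (\<lambda>x. u n (x + y n) - ball_cut (\<lambda>x. u n (x + y n)) (real j) x) \<le> e"
    by (rule concentration_imp_tight[OF a uL ua minimizing_sequence_concentrates[OF v p(1) a _ d u ud up P]]) blast+
  define w where "w n x = u n (x + y n)" for n x
  note tr = W_half_translate[OF uW, folded w_def]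
  have w: "w n \<in> ?S" for n using tr(1,2) ua by (simp add: S_mass_iff w_def[abs_def])
  have wH: "w n \<in> H_half" for n using w by (simp add: S_mass_def W_half_def)
  have wn: "L2norm (w n) \<le> sqrt a" for n using w[of n] by (simp add: S_mass_iff real_le_rsqrt)
  have wM: "half_energy (w n) \<le> M" for n using W_half_translate(3)[OF uW, of n "y n"] M[of n] by (simp add: w_def[abs_def])
  have wE: "?E (w n) = ?E (u n)" for n
    using W_half_translate(4)[OF uW v p0 up, of m n "y n"] by (simp add: w_def[abs_def])
  have wt: "\<exists>(j::nat) n0. \<forall>n\<ge>n0. L2norm (\<lambda>x. w n x - ball_cut (w n) (real j) x) \<le> e" if "e > 0" for e
    using tight[OF that] by (simp add: w_def[abs_def])
  obtain r \<phi> where r: "strict_mono (r :: nat \<Rightarrow> nat)" and \<phi>: "\<phi> \<in> L2" "(\<lambda>n. L2norm (\<lambda>x. w (r n) x - \<phi> x)) \<longlonglongrightarrow> 0"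
    by (rule tight_sequence_precompact[OF wH wn wM wt]) blast
  have "(\<lambda>n. ?E (w (r n))) \<longlonglongrightarrow> d" unfolding wE using LIMSEQ_subseq_LIMSEQ[OF ud r] by (simp add: o_def)
  from E_energy_lower_semicontinuous[OF v p a w wM \<phi> this]
  have "\<phi> \<in> ?S" "?E \<phi> \<le> d" by auto
  then show ?thesis using d order_trans by blast
qed

theorem theorem1p1:
  fixes v :: "real ^ 'n" and p a m :: real
  assumes "CARD('n) \<ge> 2"
    and "norm v < 1"
    and "2 < p" and "p < 2 + 2 / real CARD('n)"
    and "a > 0"
    and "m > 0" and "m > m_star v p a"
  shows "\<exists>\<phi> \<in> S_mass a. ereal (E_energy m v p \<phi>) = d_inf m v p a"
proof -
  have "p < 2 + 2 / real DIM(real ^ 'n)" using assms(4) by simp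
  then obtain \<phi> :: "real ^ 'n \<Rightarrow> complex" where \<phi>: "\<phi> \<in> S_mass a"
    "\<And>\<psi>. \<psi> \<in> S_mass a \<Longrightarrow> E_energy m v p \<phi> \<le> E_energy m v p \<psi>"
    using minimizer_exists[OF assms(2,3) _ assms(5), of m] by blast
  have "ereal (E_energy m v p \<phi>) = d_inf m v p a"
    unfolding d_inf_def by (rule antisym) (auto intro!: INF_greatest INF_lower \<phi>)
  with \<phi>(1) show ?thesis by blast
qed

end
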